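(* For any associative ring $R$ with unit the following statements are equivalent: (a) $R$ is semilocal; (b) every left $R$-module is semilocal; (c) every left $R$-module is the direct sum of a semisimple module and a semilocal module with essential radical; (d) every left $R$-module with small radical is weakly supplemented; (e) every finitely generated left $R$-module has finite hollow dimension; (f) every product of semisimple left $R$-modules is semisimple; (g) there exist an $n \in \mathbb{N}$ and a map $d: R \to \{0, 1, \ldots, n\}$ such that for all $a, b \in R$: (i) if $d(a) = 0$ then $a$ is a unit; (ii) $d(a(1-ba)) = d(a) + d(1-ba)$; (h) there exists a partial ordering $(R, \leq)$ on the set $R$ such that: (i) $(R, \leq)$ is an artinian poset; (ii) for all $a, b \in R$ such that $1 - ba$ is not a unit, $a > a(1-ba)$. In this case $\mathrm{hdim}({}_RR) \leq n$ holds (for $n$ as in (g)).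
   Context: Modules are left unital. A submodule $N$ of $M$ is small, $N \ll M$, if $N + L \neq M$ for every proper submodule $L$ of $M$; it is essential if it meets every nonzero submodule of $M$ nontrivially. $\mathrm{Rad}(M)$ is the radical of $M$, the intersection of all maximal submodules ($=M$ if there are none). $M$ has small (essential) radical if $\mathrm{Rad}(M)$ is small (essential) in $M$. $M$ is semilocal if $M/\mathrm{Rad}(M)$ is semisimple; the ring $R$ is semilocal if ${}_RR$ is a semilocal module. A weak supplement of $N \subseteq M$ is a submodule $L \subseteq M$ with $N + L = M$ and $N \cap L \ll M$; $M$ is weakly supplemented if every submodule has a weak supplement in $M$. A module is hollow if it is nonzero and every proper submodule is small in it. $M$ has finite hollow dimension if there is an epimorphism $g: M \to \bigoplus_{i=1}^n H_i$ with all $H_i$ hollow and $\mathrm{Ker}(g) \ll M$; then $n \ge 0$ is uniquely determined and one writes $\mathrm{hdim}(M) = n$ (so $\mathrm{hdim}(0)=0$). A poset is artinian if it satisfies the descending chain condition. *)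

theory Defs
  imports "HOL-Algebra.Module" "HOL-Algebra.AbelCoset"
begin

text \<open>
  The locale \<open>module\<close> of the library is restricted to commutative rings, so unital left modules
  over an arbitrary ring are introduced here, on the library's record type \<open>module\<close>. The fields
  \<open>mult\<close> and \<open>one\<close> which that record inherits from rings play no role. The library's \<open>submodule\<close>
  does not assume commutativity and is used as it is.
\<close>

locale left_module = R?: ring R + M?: abelian_group M
  for R :: "('a, 'r) ring_scheme" (structure) and M :: "('a, 'm, 'x) module_scheme" (structure) +
  assumes smult_closed: "\<lbrakk>a \<in> carrier R; x \<in> carrier M\<rbrakk> \<Longrightarrow> a \<odot>\<^bsub>M\<^esub> x \<in> carrier M"
    and smult_l_distr: "\<lbrakk>a \<in> carrier R; b \<in> carrier R; x \<in> carrier M\<rbrakk>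
      \<Longrightarrow> (a \<oplus> b) \<odot>\<^bsub>M\<^esub> x = a \<odot>\<^bsub>M\<^esub> x \<oplus>\<^bsub>M\<^esub> b \<odot>\<^bsub>M\<^esub> x"
    and smult_r_distr: "\<lbrakk>a \<in> carrier R; x \<in> carrier M; y \<in> carrier M\<rbrakk>
      \<Longrightarrow> a \<odot>\<^bsub>M\<^esub> (x \<oplus>\<^bsub>M\<^esub> y) = a \<odot>\<^bsub>M\<^esub> x \<oplus>\<^bsub>M\<^esub> a \<odot>\<^bsub>M\<^esub> y"
    and smult_assoc: "\<lbrakk>a \<in> carrier R; b \<in> carrier R; x \<in> carrier M\<rbrakk>
      \<Longrightarrow> (a \<otimes> b) \<odot>\<^bsub>M\<^esub> x = a \<odot>\<^bsub>M\<^esub> (b \<odot>\<^bsub>M\<^esub> x)"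
    and smult_one: "x \<in> carrier M \<Longrightarrow> \<one> \<odot>\<^bsub>M\<^esub> x = x"

definition regular_module :: "('a, 'r) ring_scheme \<Rightarrow> ('a, 'a) module" where
  "regular_module R = \<lparr>carrier = carrier R, monoid.mult = monoid.mult R, one = \<one>\<^bsub>R\<^esub>,
     ring.zero = \<zero>\<^bsub>R\<^esub>, ring.add = ring.add R, smult = monoid.mult R\<rparr>"

definition quotient_module :: "('a, 'm, 'x) module_scheme \<Rightarrow> 'm set \<Rightarrow> ('a, 'm set) module" where
  "quotient_module M N = \<lparr>carrier = a_rcosets\<^bsub>M\<^esub> N, monoid.mult = (\<lambda>X Y. N), one = N,
     ring.zero = N, ring.add = set_add M, smult = (\<lambda>a X. \<Union>x\<in>X. N +>\<^bsub>M\<^esub> (a \<odot>\<^bsub>M\<^esub> x))\<rparr>"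

definition product_module :: "'i set \<Rightarrow> ('i \<Rightarrow> ('a, 'm, 'x) module_scheme) \<Rightarrow> ('a, 'i \<Rightarrow> 'm) module" where
  "product_module I M = \<lparr>carrier = (\<Pi>\<^sub>E i\<in>I. carrier (M i)),
     monoid.mult = (\<lambda>x y. \<lambda>i\<in>I. \<zero>\<^bsub>M i\<^esub>), one = (\<lambda>i\<in>I. \<zero>\<^bsub>M i\<^esub>),
     ring.zero = (\<lambda>i\<in>I. \<zero>\<^bsub>M i\<^esub>), ring.add = (\<lambda>x y. \<lambda>i\<in>I. x i \<oplus>\<^bsub>M i\<^esub> y i),
     smult = (\<lambda>a x. \<lambda>i\<in>I. a \<odot>\<^bsub>M i\<^esub> x i)\<rparr>"

definition left_module_hom ::
  "('a, 'r) ring_scheme \<Rightarrow> ('a, 'm, 'x) module_scheme \<Rightarrow> ('a, 'k, 'y) module_scheme \<Rightarrow> ('m \<Rightarrow> 'k) set" where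
  "left_module_hom R M N = {g \<in> carrier M \<rightarrow> carrier N.
     (\<forall>x\<in>carrier M. \<forall>y\<in>carrier M. g (x \<oplus>\<^bsub>M\<^esub> y) = g x \<oplus>\<^bsub>N\<^esub> g y) \<and>
     (\<forall>a\<in>carrier R. \<forall>x\<in>carrier M. g (a \<odot>\<^bsub>M\<^esub> x) = a \<odot>\<^bsub>N\<^esub> g x)}"

definition submodule_generated ::
  "('a, 'r) ring_scheme \<Rightarrow> ('a, 'm, 'x) module_scheme \<Rightarrow> 'm set \<Rightarrow> 'm set" where
  "submodule_generated R M X = \<Inter>{N. submodule N R M \<and> X \<subseteq> N}"

definition finitely_generated :: "('a, 'r) ring_scheme \<Rightarrow> ('a, 'm, 'x) module_scheme \<Rightarrow> bool" where
  "finitely_generated R M \<longleftrightarrow>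
     (\<exists>X. finite X \<and> X \<subseteq> carrier M \<and> submodule_generated R M X = carrier M)"

definition simple_submodule :: "('a, 'r) ring_scheme \<Rightarrow> ('a, 'm, 'x) module_scheme \<Rightarrow> 'm set \<Rightarrow> bool" where
  "simple_submodule R M S \<longleftrightarrow> submodule S R M \<and> S \<noteq> {\<zero>\<^bsub>M\<^esub>} \<and>
     (\<forall>L. submodule L R M \<and> L \<subseteq> S \<longrightarrow> L = {\<zero>\<^bsub>M\<^esub>} \<or> L = S)"

text \<open>A module is semisimple if it is the sum of its simple submodules.\<close>

definition semisimple_module :: "('a, 'r) ring_scheme \<Rightarrow> ('a, 'm, 'x) module_scheme \<Rightarrow> bool" where
  "semisimple_module R M \<longleftrightarrow>
     submodule_generated R M (\<Union>{S. simple_submodule R M S}) = carrier M"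

definition maximal_submodule :: "('a, 'r) ring_scheme \<Rightarrow> ('a, 'm, 'x) module_scheme \<Rightarrow> 'm set \<Rightarrow> bool" where
  "maximal_submodule R M N \<longleftrightarrow> submodule N R M \<and> N \<noteq> carrier M \<and>
     (\<forall>L. submodule L R M \<and> N \<subseteq> L \<longrightarrow> L = N \<or> L = carrier M)"

text \<open>The intersection with the carrier gives \<open>Rad M = M\<close> when there is no maximal submodule.\<close>

definition Rad :: "('a, 'r) ring_scheme \<Rightarrow> ('a, 'm, 'x) module_scheme \<Rightarrow> 'm set" where
  "Rad R M = carrier M \<inter> \<Inter>{N. maximal_submodule R M N}"

definition small_submodule :: "('a, 'r) ring_scheme \<Rightarrow> ('a, 'm, 'x) module_scheme \<Rightarrow> 'm set \<Rightarrow> bool" where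
  "small_submodule R M N \<longleftrightarrow> submodule N R M \<and>
     (\<forall>L. submodule L R M \<and> L \<noteq> carrier M \<longrightarrow> N <+>\<^bsub>M\<^esub> L \<noteq> carrier M)"

definition essential_submodule :: "('a, 'r) ring_scheme \<Rightarrow> ('a, 'm, 'x) module_scheme \<Rightarrow> 'm set \<Rightarrow> bool" where
  "essential_submodule R M N \<longleftrightarrow> submodule N R M \<and>
     (\<forall>L. submodule L R M \<and> L \<noteq> {\<zero>\<^bsub>M\<^esub>} \<longrightarrow> N \<inter> L \<noteq> {\<zero>\<^bsub>M\<^esub>})"

definition has_small_radical :: "('a, 'r) ring_scheme \<Rightarrow> ('a, 'm, 'x) module_scheme \<Rightarrow> bool" where
  "has_small_radical R M \<longleftrightarrow> small_submodule R M (Rad R M)"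

definition has_essential_radical :: "('a, 'r) ring_scheme \<Rightarrow> ('a, 'm, 'x) module_scheme \<Rightarrow> bool" where
  "has_essential_radical R M \<longleftrightarrow> essential_submodule R M (Rad R M)"

definition semilocal_module :: "('a, 'r) ring_scheme \<Rightarrow> ('a, 'm, 'x) module_scheme \<Rightarrow> bool" where
  "semilocal_module R M \<longleftrightarrow> semisimple_module R (quotient_module M (Rad R M))"

definition semilocal_ring :: "('a, 'r) ring_scheme \<Rightarrow> bool" where
  "semilocal_ring R \<longleftrightarrow> semilocal_module R (regular_module R)"

definition weak_supplement :: "('a, 'r) ring_scheme \<Rightarrow> ('a, 'm, 'x) module_scheme \<Rightarrow> 'm set \<Rightarrow> 'm set \<Rightarrow> bool" where
  "weak_supplement R M N L \<longleftrightarrow>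
     submodule L R M \<and> N <+>\<^bsub>M\<^esub> L = carrier M \<and> small_submodule R M (N \<inter> L)"

definition weakly_supplemented :: "('a, 'r) ring_scheme \<Rightarrow> ('a, 'm, 'x) module_scheme \<Rightarrow> bool" where
  "weakly_supplemented R M \<longleftrightarrow> (\<forall>N. submodule N R M \<longrightarrow> (\<exists>L. weak_supplement R M N L))"

definition hollow_module :: "('a, 'r) ring_scheme \<Rightarrow> ('a, 'm, 'x) module_scheme \<Rightarrow> bool" where
  "hollow_module R M \<longleftrightarrow> carrier M \<noteq> {\<zero>\<^bsub>M\<^esub>} \<and>
     (\<forall>N. submodule N R M \<and> N \<noteq> carrier M \<longrightarrow> small_submodule R M N)"

text \<open>
  The finite direct sum of the \<open>H i\<close> is written as their product. Taking the \<open>H i\<close> on subsets of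
  \<open>'m set\<close> is no restriction: each of them is an epimorphic image of \<open>M\<close>, hence isomorphic to a
  quotient module of \<open>M\<close>, whose elements are cosets.
\<close>

definition has_hollow_dim :: "('a, 'r) ring_scheme \<Rightarrow> ('a, 'm, 'x) module_scheme \<Rightarrow> nat \<Rightarrow> bool" where
  "has_hollow_dim R M n \<longleftrightarrow> (\<exists>(H :: nat \<Rightarrow> ('a, 'm set) module) g.
     (\<forall>i<n. left_module R (H i) \<and> hollow_module R (H i)) \<and>
     g \<in> left_module_hom R M (product_module {..<n} H) \<and>
     g ` carrier M = carrier (product_module {..<n} H) \<and>
     small_submodule R M (a_kernel M (product_module {..<n} H) g))"

definition finite_hollow_dim :: "('a, 'r) ring_scheme \<Rightarrow> ('a, 'm, 'x) module_scheme \<Rightarrow> bool" where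
  "finite_hollow_dim R M \<longleftrightarrow> (\<exists>n. has_hollow_dim R M n)"

definition hdim :: "('a, 'r) ring_scheme \<Rightarrow> ('a, 'm, 'x) module_scheme \<Rightarrow> nat" where
  "hdim R M = (THE n. has_hollow_dim R M n)"

text \<open>
  A type argument \<open>TYPE('m)\<close> stands for the class of all left modules whose elements belong
  to the type \<open>'m\<close>. The direct sum in the second definition is internal.
\<close>

definition all_modules_semilocal :: "('a, 'r) ring_scheme \<Rightarrow> 'm itself \<Rightarrow> bool" where
  "all_modules_semilocal R TYPE('m) \<longleftrightarrow>
     (\<forall>M :: ('a, 'm) module. left_module R M \<longrightarrow> semilocal_module R M)"

definition all_modules_decompose :: "('a, 'r) ring_scheme \<Rightarrow> 'm itself \<Rightarrow> bool" where
  "all_modules_decompose R TYPE('m) \<longleftrightarrow>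
     (\<forall>M :: ('a, 'm) module. left_module R M \<longrightarrow>
        (\<exists>S T. submodule S R M \<and> submodule T R M \<and>
           S <+>\<^bsub>M\<^esub> T = carrier M \<and> S \<inter> T = {\<zero>\<^bsub>M\<^esub>} \<and>
           semisimple_module R (M\<lparr>carrier := S\<rparr>) \<and>
           semilocal_module R (M\<lparr>carrier := T\<rparr>) \<and>
           has_essential_radical R (M\<lparr>carrier := T\<rparr>)))"

definition all_small_radical_weakly_supplemented :: "('a, 'r) ring_scheme \<Rightarrow> 'm itself \<Rightarrow> bool" where
  "all_small_radical_weakly_supplemented R TYPE('m) \<longleftrightarrow>
     (\<forall>M :: ('a, 'm) module. left_module R M \<and> has_small_radical R M \<longrightarrow> weakly_supplemented R M)"

definition all_fin_gen_finite_hollow_dim :: "('a, 'r) ring_scheme \<Rightarrow> 'm itself \<Rightarrow> bool" where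
  "all_fin_gen_finite_hollow_dim R TYPE('m) \<longleftrightarrow>
     (\<forall>M :: ('a, 'm) module. left_module R M \<and> finitely_generated R M \<longrightarrow> finite_hollow_dim R M)"

definition products_of_semisimple_semisimple ::
  "('a, 'r) ring_scheme \<Rightarrow> 'i itself \<Rightarrow> 'm itself \<Rightarrow> bool" where
  "products_of_semisimple_semisimple R TYPE('i) TYPE('m) \<longleftrightarrow>
     (\<forall>(I :: 'i set) (M :: 'i \<Rightarrow> ('a, 'm) module).
        (\<forall>i\<in>I. left_module R (M i) \<and> semisimple_module R (M i)) \<longrightarrow>
        semisimple_module R (product_module I M))"

definition semilocal_rank_function :: "('a, 'r) ring_scheme \<Rightarrow> nat \<Rightarrow> ('a \<Rightarrow> nat) \<Rightarrow> bool" where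
  "semilocal_rank_function R n d \<longleftrightarrow> d \<in> carrier R \<rightarrow> {0..n} \<and>
     (\<forall>a\<in>carrier R. d a = 0 \<longrightarrow> a \<in> Units R) \<and>
     (\<forall>a\<in>carrier R. \<forall>b\<in>carrier R.
        d (a \<otimes>\<^bsub>R\<^esub> (\<one>\<^bsub>R\<^esub> \<ominus>\<^bsub>R\<^esub> b \<otimes>\<^bsub>R\<^esub> a)) = d a + d (\<one>\<^bsub>R\<^esub> \<ominus>\<^bsub>R\<^esub> b \<otimes>\<^bsub>R\<^esub> a))"

text \<open>In the following two definitions \<open>(x, y) \<in> rel\<close> is read as \<open>x \<le> y\<close>.\<close>

definition artinian_poset :: "'a set \<Rightarrow> ('a \<times> 'a) set \<Rightarrow> bool" where
  "artinian_poset A rel \<longleftrightarrow> partial_order_on A rel \<and>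
     (\<forall>f :: nat \<Rightarrow> 'a. (\<forall>i. f i \<in> A) \<and> (\<forall>i. (f (Suc i), f i) \<in> rel) \<longrightarrow>
        (\<exists>k. \<forall>i\<ge>k. f i = f k))"

definition semilocal_ordering :: "('a, 'r) ring_scheme \<Rightarrow> ('a \<times> 'a) set \<Rightarrow> bool" where
  "semilocal_ordering R rel \<longleftrightarrow> artinian_poset (carrier R) rel \<and>
     (\<forall>a\<in>carrier R. \<forall>b\<in>carrier R. \<one>\<^bsub>R\<^esub> \<ominus>\<^bsub>R\<^esub> b \<otimes>\<^bsub>R\<^esub> a \<notin> Units R \<longrightarrow>
        (a \<otimes>\<^bsub>R\<^esub> (\<one>\<^bsub>R\<^esub> \<ominus>\<^bsub>R\<^esub> b \<otimes>\<^bsub>R\<^esub> a), a) \<in> rel \<and> a \<otimes>\<^bsub>R\<^esub> (\<one>\<^bsub>R\<^esub> \<ominus>\<^bsub>R\<^esub> b \<otimes>\<^bsub>R\<^esub> a) \<noteq> a)"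

definition all_equivalent :: "bool list \<Rightarrow> bool" where
  "all_equivalent Ps \<longleftrightarrow> (\<forall>P\<in>set Ps. \<forall>Q\<in>set Ps. P \<longleftrightarrow> Q)"

text \<open>
  Since a formula cannot quantify over types, ``every left module'' is rendered in two steps: the
  conditions are equivalent for the modules (and index sets) on any type \<open>'u\<close> into which \<open>'a set\<close>
  embeds, and a semilocal ring satisfies them for modules and index sets on arbitrary types. Some
  size assumption on \<open>'u\<close> is unavoidable, as a small type may carry no nonzero left module.
\<close>

definition large_universe :: "'a itself \<Rightarrow> 'u itself \<Rightarrow> bool" where
  "large_universe TYPE('a) TYPE('u) \<longleftrightarrow> (\<exists>f :: 'a set \<Rightarrow> 'u. inj f)"

end

theory Submission
  imports Defs
begin

text \<open>
  Everything is read off from the lattice of submodules. A module is semisimple iff each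
  submodule has a complement, and more generally \<open>M/N\<close> is semisimple iff each submodule \<open>L\<close> has
  some \<open>K\<close> with \<open>L + K = M\<close> and \<open>L \<inter> K \<subseteq> N\<close>; this relation, \<open>complemented_modulo\<close>, is stated
  inside \<open>M\<close>. A module is semilocal iff it is complemented modulo its radical. In what follows
  \<open>J\<close> is the radical of the regular module, the Jacobson radical of \<open>R\<close>.

  Modules over a semilocal ring. For \<open>x \<in> M\<close> the map \<open>r \<mapsto> r x\<close> is a homomorphism, so it sends
  \<open>J\<close> into \<open>Rad M\<close>. Hence \<open>J\<close> kills \<open>M/Rad M\<close>, whose cyclic submodules are then images of the
  semisimple module \<open>R/J\<close>: every module is semilocal. A submodule \<open>S\<close> maximal with zero
  intersection with \<open>Rad M\<close> embeds in \<open>M/Rad M\<close> and splits off, leaving a summand in which the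
  radical is essential. Complements modulo a small radical are weak supplements. Since \<open>J\<close> kills
  semisimple modules, it kills their products, which are therefore semisimple. In the other
  direction each module condition is applied to a copy of the regular module in the given universe
  type, except that for products the module is the product of all simple quotients of \<open>R\<close>, which
  contains \<open>R/J\<close>.

  Finite hollow dimension is translated into finite coindependent families of submodules. For
  these there is an exchange theorem, \<open>hollow_exchange\<close>, dual to Steinitz exchange for uniform
  submodules. It shows that the hollow dimension is unique and bounds the length of every
  coindependent family of proper submodules. If such lengths are bounded, a longest family of maximal
  submodules meets in the radical, and a finite intersection of maximal submodules always has
  complements modulo itself; so the module is semilocal. Conversely \<open>M/Rad M\<close> is a finite sum of
  simple modules when \<open>M\<close> is finitely generated and semilocal, and then every submodule above the
  radical is the meet of a coindependent family of maximal submodules.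

  The last two conditions are due to Camps and Dicks. The length of \<open>R/(R a + J)\<close> is a rank
  function, as \<open>R a\<close> and \<open>R (1 - b a)\<close> are comaximal with intersection \<open>R a (1 - b a)\<close>. A rank
  function gives an ordering by decreasing rank. Given an ordering, a minimal element of the coset
  \<open>1 + L\<close> of a left ideal \<open>L\<close> generates a complement of \<open>L\<close> modulo \<open>J\<close>. Finally, along a
  coindependent family of proper left ideals one can multiply by factors \<open>1 - b a\<close> that are not
  units, one for each member, so the rank bounds the length of the family and hence the hollow
  dimension of \<open>R\<close>.
\<close>


section \<open>The lattice of submodules\<close>

context left_module
begin

lemma smult_zero_left: "x \<in> carrier M \<Longrightarrow> \<zero> \<odot>\<^bsub>M\<^esub> x = \<zero>\<^bsub>M\<^esub>"
  using smult_l_distr[of \<zero> \<zero> x] smult_closed[of \<zero> x] by (metis M.add.r_cancel_one' R.r_zero R.zero_closed)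

lemma smult_zero_right: "a \<in> carrier R \<Longrightarrow> a \<odot>\<^bsub>M\<^esub> \<zero>\<^bsub>M\<^esub> = \<zero>\<^bsub>M\<^esub>"
  using smult_r_distr[of a "\<zero>\<^bsub>M\<^esub>" "\<zero>\<^bsub>M\<^esub>"] smult_closed[of a "\<zero>\<^bsub>M\<^esub>"]
  by (metis M.add.r_cancel_one' M.r_zero M.zero_closed)

lemma smult_minus_left:
  assumes "a \<in> carrier R" "x \<in> carrier M"
  shows "(\<ominus> a) \<odot>\<^bsub>M\<^esub> x = \<ominus>\<^bsub>M\<^esub> (a \<odot>\<^bsub>M\<^esub> x)"
  using smult_l_distr[of "\<ominus> a" a x] assms smult_zero_left[of x]
  by (metis M.minus_equality R.a_inv_closed R.l_neg smult_closed)

lemma submoduleI: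
  assumes "H \<subseteq> carrier M" "\<zero>\<^bsub>M\<^esub> \<in> H"
    and "\<And>x y. \<lbrakk>x \<in> H; y \<in> H\<rbrakk> \<Longrightarrow> x \<oplus>\<^bsub>M\<^esub> y \<in> H"
    and smult: "\<And>a x. \<lbrakk>a \<in> carrier R; x \<in> H\<rbrakk> \<Longrightarrow> a \<odot>\<^bsub>M\<^esub> x \<in> H"
  shows "submodule H R M"
proof -
  have "\<ominus>\<^bsub>M\<^esub> x \<in> H" if "x \<in> H" for x
    using smult[of "\<ominus> \<one>" x] that assms(1) by (auto simp: smult_minus_left smult_one subset_iff)
  then show ?thesis
    using assms by (intro submodule.intro subgroup.intro submodule_axioms.intro)
      (auto simp: a_inv_def)
qed

lemma submodule_subset: "submodule N R M \<Longrightarrow> N \<subseteq> carrier M"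
  using subgroup.subset[OF submodule.axioms(1)] by fastforce

lemma submodule_mem: "\<lbrakk>submodule N R M; x \<in> N\<rbrakk> \<Longrightarrow> x \<in> carrier M"
  using submodule_subset by blast

lemma submodule_zero: "submodule N R M \<Longrightarrow> \<zero>\<^bsub>M\<^esub> \<in> N"
  using subgroup.one_closed[OF submodule.axioms(1)] by fastforce

lemma submodule_add: "\<lbrakk>submodule N R M; x \<in> N; y \<in> N\<rbrakk> \<Longrightarrow> x \<oplus>\<^bsub>M\<^esub> y \<in> N"
  using subgroup.m_closed[OF submodule.axioms(1)] by fastforce

lemma submodule_smult: "\<lbrakk>submodule N R M; a \<in> carrier R; x \<in> N\<rbrakk> \<Longrightarrow> a \<odot>\<^bsub>M\<^esub> x \<in> N"
  by (rule submodule.smult_closed)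

lemma submodule_neg: "\<lbrakk>submodule N R M; x \<in> N\<rbrakk> \<Longrightarrow> \<ominus>\<^bsub>M\<^esub> x \<in> N"
  using submodule_smult[of N "\<ominus> \<one>" x] submodule_mem[of N x] by (simp add: smult_minus_left smult_one)

lemma submodule_minus: "\<lbrakk>submodule N R M; x \<in> N; y \<in> N\<rbrakk> \<Longrightarrow> x \<ominus>\<^bsub>M\<^esub> y \<in> N"
  by (simp add: a_minus_def submodule_add submodule_neg)

lemmas submodule_rules = submodule_mem submodule_zero submodule_add submodule_smult submodule_neg submodule_minus

lemma submodule_carrier: "submodule (carrier M) R M"
  by (rule submoduleI) (auto simp: smult_closed)

lemma submodule_zero_set: "submodule {\<zero>\<^bsub>M\<^esub>} R M"
  by (rule submoduleI) (auto simp: smult_zero_right)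

lemma submodule_Int: "\<lbrakk>submodule A R M; submodule B R M\<rbrakk> \<Longrightarrow> submodule (A \<inter> B) R M"
  by (rule submoduleI) (auto intro: submodule_rules)

lemma submodule_Inter:
  assumes "\<And>N. N \<in> F \<Longrightarrow> submodule N R M"
  shows "submodule (carrier M \<inter> \<Inter>F) R M"
  by (rule submoduleI) (auto intro: submodule_rules dest: assms smult_closed)

lemma submodule_Union_chain:
  assumes "C \<noteq> {}" "\<And>N. N \<in> C \<Longrightarrow> submodule N R M" "\<And>A B. \<lbrakk>A \<in> C; B \<in> C\<rbrakk> \<Longrightarrow> A \<subseteq> B \<or> B \<subseteq> A"
  shows "submodule (\<Union>C) R M"
proof (rule submoduleI)
  show "\<Union>C \<subseteq> carrier M" using assms(2) submodule_subset by blast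
  show "\<zero>\<^bsub>M\<^esub> \<in> \<Union>C" using assms(1,2) submodule_zero by blast
  show "x \<oplus>\<^bsub>M\<^esub> y \<in> \<Union>C" if xy: "x \<in> \<Union>C" "y \<in> \<Union>C" for x y
  proof -
    obtain A B where "A \<in> C" "x \<in> A" "B \<in> C" "y \<in> B" using xy by blast
    then show ?thesis using assms(2,3)[of A] assms(2)[of B] assms(3)[of A B] submodule_add by blast
  qed
  show "a \<odot>\<^bsub>M\<^esub> x \<in> \<Union>C" if "a \<in> carrier R" "x \<in> \<Union>C" for a x
    using that assms(2) submodule_smult by blast
qed

lemma sum_iff: "x \<in> A <+>\<^bsub>M\<^esub> B \<longleftrightarrow> (\<exists>a\<in>A. \<exists>b\<in>B. x = a \<oplus>\<^bsub>M\<^esub> b)"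
  by (auto simp: set_add_def set_mult_def)

lemma sum_memI: "\<lbrakk>a \<in> A; b \<in> B\<rbrakk> \<Longrightarrow> a \<oplus>\<^bsub>M\<^esub> b \<in> A <+>\<^bsub>M\<^esub> B"
  using sum_iff by blast

lemma sum_memE:
  assumes "x \<in> A <+>\<^bsub>M\<^esub> B"
  obtains a b where "a \<in> A" "b \<in> B" "x = a \<oplus>\<^bsub>M\<^esub> b"
  using assms sum_iff by blast

lemma submodule_sum:
  assumes "submodule A R M" "submodule B R M"
  shows "submodule (A <+>\<^bsub>M\<^esub> B) R M"
proof (rule submoduleI)
  show "A <+>\<^bsub>M\<^esub> B \<subseteq> carrier M"
    using assms by (auto elim!: sum_memE simp: submodule_mem)
  show "\<zero>\<^bsub>M\<^esub> \<in> A <+>\<^bsub>M\<^esub> B"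
    using sum_memI[of "\<zero>\<^bsub>M\<^esub>" A "\<zero>\<^bsub>M\<^esub>" B] assms by (simp add: submodule_zero)
next
  fix x y assume "x \<in> A <+>\<^bsub>M\<^esub> B" "y \<in> A <+>\<^bsub>M\<^esub> B"
  then obtain a b a' b' where *: "a \<in> A" "b \<in> B" "a' \<in> A" "b' \<in> B"
    "x = a \<oplus>\<^bsub>M\<^esub> b" "y = a' \<oplus>\<^bsub>M\<^esub> b'" by (metis sum_memE)
  then have "x \<oplus>\<^bsub>M\<^esub> y = (a \<oplus>\<^bsub>M\<^esub> a') \<oplus>\<^bsub>M\<^esub> (b \<oplus>\<^bsub>M\<^esub> b')"
    using assms by (simp add: submodule_mem M.add.m_ac)
  then show "x \<oplus>\<^bsub>M\<^esub> y \<in> A <+>\<^bsub>M\<^esub> B" using * assms by (simp add: sum_memI submodule_add)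
next
  fix r x assume r: "r \<in> carrier R" "x \<in> A <+>\<^bsub>M\<^esub> B"
  then obtain a b where *: "a \<in> A" "b \<in> B" "x = a \<oplus>\<^bsub>M\<^esub> b" by (metis sum_memE)
  then have "r \<odot>\<^bsub>M\<^esub> x = r \<odot>\<^bsub>M\<^esub> a \<oplus>\<^bsub>M\<^esub> r \<odot>\<^bsub>M\<^esub> b"
    using assms r by (simp add: submodule_mem smult_r_distr)
  then show "r \<odot>\<^bsub>M\<^esub> x \<in> A <+>\<^bsub>M\<^esub> B" using * r assms by (simp add: sum_memI submodule_smult)
qed

lemma sum_commute:
  assumes "A \<subseteq> carrier M" "B \<subseteq> carrier M"
  shows "A <+>\<^bsub>M\<^esub> B = B <+>\<^bsub>M\<^esub> A"
proof -
  have "X <+>\<^bsub>M\<^esub> Y \<subseteq> Y <+>\<^bsub>M\<^esub> X" if "X \<subseteq> carrier M" "Y \<subseteq> carrier M" for X Y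
    using that M.a_comm by (auto elim!: sum_memE simp: sum_iff) (metis subsetD)
  then show ?thesis using assms by blast
qed

lemma sum_upper1:
  assumes "submodule A R M" "submodule B R M"
  shows "A \<subseteq> A <+>\<^bsub>M\<^esub> B"
  using assms by (metis sum_memI submodule_zero submodule_mem M.r_zero subsetI)

lemma sum_upper2:
  assumes "submodule A R M" "submodule B R M"
  shows "B \<subseteq> A <+>\<^bsub>M\<^esub> B"
  using assms by (metis sum_memI submodule_zero submodule_mem M.l_zero subsetI)

lemma sum_least: "\<lbrakk>submodule C R M; A \<subseteq> C; B \<subseteq> C\<rbrakk> \<Longrightarrow> A <+>\<^bsub>M\<^esub> B \<subseteq> C"
  by (auto elim!: sum_memE intro: submodule_add)

lemma sum_mono: "\<lbrakk>A \<subseteq> A'; B \<subseteq> B'\<rbrakk> \<Longrightarrow> A <+>\<^bsub>M\<^esub> B \<subseteq> A' <+>\<^bsub>M\<^esub> B'"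
  by (auto elim!: sum_memE intro: sum_memI)

lemma sum_absorb:
  assumes "submodule A R M" "submodule B R M" "A \<subseteq> B"
  shows "A <+>\<^bsub>M\<^esub> B = B" "B <+>\<^bsub>M\<^esub> A = B"
  using sum_least[OF assms(2,3) subset_refl] sum_least[OF assms(2) subset_refl assms(3)]
    sum_upper2[OF assms(1,2)] sum_upper1[OF assms(2,1)] by (auto intro!: subset_antisym)

text \<open>
  This modularity of the submodule lattice carries the decomposition arguments; the reverse
  inclusion holds in every lattice.
\<close>

lemma modular_law:
  assumes "submodule A R M" "submodule B R M" "submodule C R M" "A \<subseteq> C"
  shows "(A <+>\<^bsub>M\<^esub> B) \<inter> C \<subseteq> A <+>\<^bsub>M\<^esub> (B \<inter> C)"
proof
  fix x assume "x \<in> (A <+>\<^bsub>M\<^esub> B) \<inter> C"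
  then obtain a b where *: "a \<in> A" "b \<in> B" "x = a \<oplus>\<^bsub>M\<^esub> b" "x \<in> C" by (auto elim: sum_memE)
  then have "b = x \<ominus>\<^bsub>M\<^esub> a"
    using assms M.a_comm[of a b] by (simp add: M.minus_eq M.a_assoc M.r_neg submodule_mem)
  then have "b \<in> C" using * assms by (metis submodule_minus subsetD)
  then show "x \<in> A <+>\<^bsub>M\<^esub> (B \<inter> C)" using * sum_memI by blast
qed

text \<open>
  Most sums below are to be shown to fill the whole module. It suffices that they contain two
  submodules which already do so.
\<close>

lemma sum_full_mono:
  assumes "A <+>\<^bsub>M\<^esub> B = carrier M" "submodule C R M" "A \<subseteq> C" "B \<subseteq> C"
  shows "C = carrier M"
  using assms sum_least[of C A B] submodule_subset by blast

text \<open>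
  Zorn's lemma for submodules. Two properties inherited by unions of chains are used later:
  avoiding a given set, and not containing a given finite set.
\<close>

lemma exists_maximal_in_chain_closed:
  assumes "submodule A R M" "P A"
    and union: "\<And>C. \<lbrakk>C \<noteq> {}; subset.chain {N. submodule N R M \<and> A \<subseteq> N \<and> P N} C\<rbrakk> \<Longrightarrow> P (\<Union>C)"
  shows "\<exists>N. submodule N R M \<and> A \<subseteq> N \<and> P N \<and> (\<forall>L. submodule L R M \<and> N \<subseteq> L \<and> P L \<longrightarrow> L = N)"
proof -
  let ?S = "{N. submodule N R M \<and> A \<subseteq> N \<and> P N}"
  have "\<exists>N\<in>?S. \<forall>X\<in>?S. N \<subseteq> X \<longrightarrow> X = N"
  proof (rule subset_Zorn_nonempty)
    show "?S \<noteq> {}" using assms by auto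
    fix C assume C: "C \<noteq> {}" "subset.chain ?S C"
    then have "\<And>A B. \<lbrakk>A \<in> C; B \<in> C\<rbrakk> \<Longrightarrow> A \<subseteq> B \<or> B \<subseteq> A" "\<And>N. N \<in> C \<Longrightarrow> submodule N R M \<and> A \<subseteq> N"
      by (auto simp: subset.chain_def subset_iff_psubset_eq)
    then show "\<Union>C \<in> ?S" using C(1) union[OF C] submodule_Union_chain[of C] by blast
  qed
  then show ?thesis by (metis (mono_tags, lifting) mem_Collect_eq order_trans)
qed

lemma exists_maximal_avoiding:
  assumes "submodule A R M" "A \<inter> S = {}"
  shows "\<exists>N. submodule N R M \<and> A \<subseteq> N \<and> N \<inter> S = {} \<and>
    (\<forall>L. submodule L R M \<and> N \<subseteq> L \<and> L \<inter> S = {} \<longrightarrow> L = N)"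
  by (rule exists_maximal_in_chain_closed[OF assms(1), where P = "\<lambda>N. N \<inter> S = {}"])
    (use assms in \<open>auto simp: subset.chain_def\<close>)

lemma generated_least: "\<lbrakk>submodule N R M; X \<subseteq> N\<rbrakk> \<Longrightarrow> submodule_generated R M X \<subseteq> N"
  by (auto simp: submodule_generated_def)

lemma generated_upper: "X \<subseteq> submodule_generated R M X"
  by (auto simp: submodule_generated_def)

lemma generated_submodule:
  assumes "X \<subseteq> carrier M"
  shows "submodule (submodule_generated R M X) R M"
proof -
  have "submodule_generated R M X = carrier M \<inter> \<Inter>{N. submodule N R M \<and> X \<subseteq> N}"
    using assms submodule_carrier by (auto simp: submodule_generated_def)
  then show ?thesis using submodule_Inter[of "{N. submodule N R M \<and> X \<subseteq> N}"] by auto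
qed

text \<open>
  A finite generating set inside the union of a chain already lies in one member of the chain, so
  a chain of proper submodules above \<open>A\<close> has a proper union.
\<close>

lemma proper_submodule_below_maximal:
  assumes "finitely_generated R M" "submodule A R M" "A \<noteq> carrier M"
  shows "\<exists>N. maximal_submodule R M N \<and> A \<subseteq> N"
proof -
  obtain X where X: "finite X" "X \<subseteq> carrier M" "submodule_generated R M X = carrier M"
    using assms(1) by (auto simp: finitely_generated_def)
  have proper: "X \<subseteq> N \<longleftrightarrow> N = carrier M" if "submodule N R M" for N
    using X generated_least[OF that] submodule_subset[OF that] by auto
  have "\<exists>N. submodule N R M \<and> A \<subseteq> N \<and> \<not> X \<subseteq> N \<and> (\<forall>L. submodule L R M \<and> N \<subseteq> L \<and> \<not> X \<subseteq> L \<longrightarrow> L = N)"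
  proof (rule exists_maximal_in_chain_closed[OF assms(2), where P = "\<lambda>N. \<not> X \<subseteq> N"])
    show "\<not> X \<subseteq> A" using assms proper by simp
    fix C assume C: "C \<noteq> {}" "subset.chain {N. submodule N R M \<and> A \<subseteq> N \<and> \<not> X \<subseteq> N} C"
    show "\<not> X \<subseteq> \<Union>C"
    proof
      assume "X \<subseteq> \<Union>C"
      then obtain B where "B \<in> C" "X \<subseteq> B"
        using finite_subset_Union_chain[OF X(1) _ C] by metis
      then show False using C by (auto simp: subset.chain_def)
    qed
  qed
  then show ?thesis unfolding maximal_submodule_def using proper by metis
qed

end

section \<open>Complements modulo a submodule\<close>

text \<open>
  For \<open>N \<subseteq> A\<close> this says that every submodule of \<open>A/N\<close> has a complement, expressed without cosets.
  The cases of interest are \<open>N = 0\<close>, which is semisimplicity of \<open>A\<close>, and \<open>N\<close> the radical, which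
  is semilocality.
\<close>

definition complemented_modulo ::
  "('a, 'r) ring_scheme \<Rightarrow> ('a, 'm, 'x) module_scheme \<Rightarrow> 'm set \<Rightarrow> 'm set \<Rightarrow> bool" where
  "complemented_modulo R M A N \<longleftrightarrow> (\<forall>L. submodule L R M \<and> L \<subseteq> A \<longrightarrow>
     (\<exists>K. submodule K R M \<and> K \<subseteq> A \<and> L <+>\<^bsub>M\<^esub> K = A \<and> L \<inter> K \<subseteq> N))"

lemma complemented_modulo_mono:
  "\<lbrakk>complemented_modulo R M A N; N \<subseteq> N'\<rbrakk> \<Longrightarrow> complemented_modulo R M A N'"
  unfolding complemented_modulo_def by (meson order_trans)

context left_module
begin

lemma complement_exists:
  assumes "complemented_modulo R M A N" "submodule L R M" "L \<subseteq> A"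
  obtains K where "submodule K R M" "K \<subseteq> A" "L <+>\<^bsub>M\<^esub> K = A" "L \<inter> K \<subseteq> N"
  using assms unfolding complemented_modulo_def by blast

text \<open>A complement of \<open>L\<close> in \<open>A\<close>, cut down to \<open>B\<close>, is one in \<open>B\<close> by modularity.\<close>

lemma complemented_modulo_hereditary:
  assumes A: "complemented_modulo R M A N" and B: "submodule B R M" "B \<subseteq> A"
  shows "complemented_modulo R M B N"
  unfolding complemented_modulo_def
proof (intro allI impI)
  fix L assume L: "submodule L R M \<and> L \<subseteq> B"
  then obtain K where K: "submodule K R M" "K \<subseteq> A" "L <+>\<^bsub>M\<^esub> K = A" "L \<inter> K \<subseteq> N"
    using complement_exists[OF A, of L] B by blast
  have "B \<subseteq> L <+>\<^bsub>M\<^esub> (K \<inter> B)"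
    using modular_law[of L K B] L K B by blast
  moreover have "L <+>\<^bsub>M\<^esub> (K \<inter> B) \<subseteq> B" using sum_least[of B L "K \<inter> B"] L B by blast
  ultimately show "\<exists>K. submodule K R M \<and> K \<subseteq> B \<and> L <+>\<^bsub>M\<^esub> K = B \<and> L \<inter> K \<subseteq> N"
    using K B submodule_Int by (intro exI[of _ "K \<inter> B"]) auto
qed

text \<open>
  Given \<open>L\<close>, first \<open>T1\<close> is chosen in \<open>T\<close> as a complement of the part of \<open>L + S\<close> that lies in \<open>T\<close>,
  then \<open>S1\<close> in \<open>S\<close> as a complement of the part of \<open>L + T1\<close> that lies in \<open>S\<close>. If \<open>s + t\<close> with \<open>s \<in>
  S1\<close> and \<open>t \<in> T1\<close> belongs to \<open>L\<close>, both \<open>t\<close> and \<open>s\<close> are forced into \<open>N\<close>.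
\<close>

lemma complemented_modulo_sum:
  assumes S: "submodule S R M" "complemented_modulo R M S N"
    and T: "submodule T R M" "complemented_modulo R M T N"
    and N: "submodule N R M" and full: "S <+>\<^bsub>M\<^esub> T = carrier M"
  shows "complemented_modulo R M (carrier M) N"
  unfolding complemented_modulo_def
proof (intro allI impI)
  fix L assume "submodule L R M \<and> L \<subseteq> carrier M"
  then have L: "submodule L R M" by simp
  have LS: "submodule (L <+>\<^bsub>M\<^esub> S) R M" by (rule submodule_sum[OF L S(1)])
  obtain T1 where T1: "submodule T1 R M" "T1 \<subseteq> T" "((L <+>\<^bsub>M\<^esub> S) \<inter> T) <+>\<^bsub>M\<^esub> T1 = T"
    "((L <+>\<^bsub>M\<^esub> S) \<inter> T) \<inter> T1 \<subseteq> N"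
    using complement_exists[OF T(2), of "(L <+>\<^bsub>M\<^esub> S) \<inter> T"] submodule_Int[OF LS T(1)] by blast
  have LT: "submodule (L <+>\<^bsub>M\<^esub> T1) R M" by (rule submodule_sum[OF L T1(1)])
  obtain S1 where S1: "submodule S1 R M" "S1 \<subseteq> S" "((L <+>\<^bsub>M\<^esub> T1) \<inter> S) <+>\<^bsub>M\<^esub> S1 = S"
    "((L <+>\<^bsub>M\<^esub> T1) \<inter> S) \<inter> S1 \<subseteq> N"
    using complement_exists[OF S(2), of "(L <+>\<^bsub>M\<^esub> T1) \<inter> S"] submodule_Int[OF LT S(1)] by blast
  let ?K = "S1 <+>\<^bsub>M\<^esub> T1"
  have K: "submodule ?K R M" by (rule submodule_sum[OF S1(1) T1(1)])
  have LK: "submodule (L <+>\<^bsub>M\<^esub> ?K) R M" by (rule submodule_sum[OF L K])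
  have up: "L \<subseteq> L <+>\<^bsub>M\<^esub> ?K" "S1 \<subseteq> L <+>\<^bsub>M\<^esub> ?K" "T1 \<subseteq> L <+>\<^bsub>M\<^esub> ?K"
    using sum_upper1[OF L K] sum_upper2[OF L K] sum_upper1[OF S1(1) T1(1)] sum_upper2[OF S1(1) T1(1)]
    by blast+
  have "L <+>\<^bsub>M\<^esub> T1 \<subseteq> L <+>\<^bsub>M\<^esub> ?K" by (rule sum_least[OF LK up(1,3)])
  then have S_le: "S \<subseteq> L <+>\<^bsub>M\<^esub> ?K"
    using sum_least[OF LK, of "(L <+>\<^bsub>M\<^esub> T1) \<inter> S" S1] up(2) S1(3) by blast
  then have "L <+>\<^bsub>M\<^esub> S \<subseteq> L <+>\<^bsub>M\<^esub> ?K" by (rule sum_least[OF LK up(1)])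
  then have T_le: "T \<subseteq> L <+>\<^bsub>M\<^esub> ?K"
    using sum_least[OF LK, of "(L <+>\<^bsub>M\<^esub> S) \<inter> T" T1] up(3) T1(3) by blast
  have "L <+>\<^bsub>M\<^esub> ?K = carrier M" by (rule sum_full_mono[OF full LK S_le T_le])
  moreover have "L \<inter> ?K \<subseteq> N"
  proof
    fix x assume x: "x \<in> L \<inter> ?K"
    then obtain s t where st: "s \<in> S1" "t \<in> T1" "x = s \<oplus>\<^bsub>M\<^esub> t" by (auto elim: sum_memE)
    have c: "x \<in> carrier M" "s \<in> carrier M" "t \<in> carrier M"
      using x st L S1 T1 submodule_mem by blast+
    have "t = x \<oplus>\<^bsub>M\<^esub> \<ominus>\<^bsub>M\<^esub> s"
      using c st(3) M.a_comm[of s t] by (simp add: M.a_assoc M.r_neg)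
    moreover have "s = x \<oplus>\<^bsub>M\<^esub> \<ominus>\<^bsub>M\<^esub> t"
      using c st(3) by (simp add: M.a_assoc M.r_neg)
    ultimately have "t \<in> L <+>\<^bsub>M\<^esub> S" "s \<in> L <+>\<^bsub>M\<^esub> T1"
      using x st S1 T1 S submodule_neg by (metis IntD1 sum_memI subsetD)+
    then have "t \<in> N" "s \<in> N" using st T1 S1 by blast+
    then show "x \<in> N" using N st(3) submodule_add by blast
  qed
  ultimately show "\<exists>K. submodule K R M \<and> K \<subseteq> carrier M \<and> L <+>\<^bsub>M\<^esub> K = carrier M \<and> L \<inter> K \<subseteq> N"
    using K submodule_subset by blast
qed

text \<open>
  A submodule \<open>K\<close> maximal with \<open>K \<inter> L = 0\<close> is a complement of \<open>L\<close>, since a simple submodule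
  outside \<open>L + K\<close> could be added to \<open>K\<close>.
\<close>

lemma semisimple_imp_complemented:
  assumes "semisimple_module R M"
  shows "complemented_modulo R M (carrier M) {\<zero>\<^bsub>M\<^esub>}"
  unfolding complemented_modulo_def
proof (intro allI impI)
  fix L assume "submodule L R M \<and> L \<subseteq> carrier M"
  then have L: "submodule L R M" by simp
  obtain K where K: "submodule K R M" "K \<inter> (L - {\<zero>\<^bsub>M\<^esub>}) = {}"
    and max: "\<forall>K'. submodule K' R M \<and> K \<subseteq> K' \<and> K' \<inter> (L - {\<zero>\<^bsub>M\<^esub>}) = {} \<longrightarrow> K' = K"
    using exists_maximal_avoiding[OF submodule_zero_set, of "L - {\<zero>\<^bsub>M\<^esub>}"] by auto
  have LK: "submodule (L <+>\<^bsub>M\<^esub> K) R M" by (rule submodule_sum[OF L K(1)])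
  have "S \<subseteq> L <+>\<^bsub>M\<^esub> K" if S: "simple_submodule R M S" for S
  proof (rule ccontr)
    assume not: "\<not> S \<subseteq> L <+>\<^bsub>M\<^esub> K"
    have Ss: "submodule S R M" using S by (simp add: simple_submodule_def)
    have int: "S \<inter> (L <+>\<^bsub>M\<^esub> K) = {\<zero>\<^bsub>M\<^esub>}"
      using S not submodule_Int[OF Ss LK] unfolding simple_submodule_def by (metis Int_lower1 inf.absorb_iff1)
    have "(K <+>\<^bsub>M\<^esub> S) \<inter> (L - {\<zero>\<^bsub>M\<^esub>}) = {}"
    proof -
      have "x = \<zero>\<^bsub>M\<^esub>" if x: "x \<in> K <+>\<^bsub>M\<^esub> S" "x \<in> L" for x
      proof -
        obtain k s where ks: "k \<in> K" "s \<in> S" "x = k \<oplus>\<^bsub>M\<^esub> s" using x by (auto elim: sum_memE)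
        have c: "x \<in> carrier M" "k \<in> carrier M" "s \<in> carrier M"
          using x ks L K(1) Ss submodule_mem by blast+
        have "s = x \<oplus>\<^bsub>M\<^esub> \<ominus>\<^bsub>M\<^esub> k"
          using c ks(3) M.a_comm[of k s] by (simp add: M.a_assoc M.r_neg)
        then have "s \<in> L <+>\<^bsub>M\<^esub> K" using x ks K submodule_neg sum_memI by metis
        then have "s = \<zero>\<^bsub>M\<^esub>" using int ks by blast
        then show ?thesis using ks c x K(2) by auto
      qed
      then show ?thesis by blast
    qed
    then have "K <+>\<^bsub>M\<^esub> S = K"
      using max submodule_sum[OF K(1) Ss] sum_upper1[OF K(1) Ss] by blast
    then show False using not sum_upper2[OF K(1) Ss] sum_upper2[OF L K(1)] by blast
  qed
  then have "carrier M \<subseteq> L <+>\<^bsub>M\<^esub> K"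
    using assms generated_least[OF LK, of "\<Union>{S. simple_submodule R M S}"]
    unfolding semisimple_module_def by auto
  then have "L <+>\<^bsub>M\<^esub> K = carrier M" using submodule_subset[OF LK] by blast
  then show "\<exists>K. submodule K R M \<and> K \<subseteq> carrier M \<and> L <+>\<^bsub>M\<^esub> K = carrier M \<and> L \<inter> K \<subseteq> {\<zero>\<^bsub>M\<^esub>}"
    using K submodule_subset by (intro exI[of _ K]) auto
qed

lemma simple_submodules_in_carrier: "\<Union>{S. simple_submodule R M S} \<subseteq> carrier M"
  using submodule_subset by (auto simp: simple_submodule_def)

text \<open>
  If the socle misses \<open>x\<close>, let \<open>N\<close> be maximal among the submodules that contain the socle and
  miss \<open>x\<close>. A complement \<open>C\<close> of \<open>N\<close> is simple: were \<open>C\<close> the direct sum of nonzero \<open>D\<close> and \<open>E\<close>,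
  then \<open>x\<close> would lie in \<open>N + D\<close> and in \<open>N + E\<close>, hence in \<open>N\<close>. But a simple submodule lies in the
  socle, hence in \<open>N\<close>, and cannot be complementary to \<open>N\<close>.
\<close>

lemma complemented_imp_semisimple:
  assumes comp: "complemented_modulo R M (carrier M) {\<zero>\<^bsub>M\<^esub>}"
  shows "semisimple_module R M"
proof (rule ccontr)
  let ?soc = "submodule_generated R M (\<Union>{S. simple_submodule R M S})"
  have soc: "submodule ?soc R M" by (rule generated_submodule[OF simple_submodules_in_carrier])
  assume "\<not> semisimple_module R M"
  then obtain x where x: "x \<in> carrier M" "x \<notin> ?soc"
    using submodule_subset[OF soc] unfolding semisimple_module_def by blast
  obtain N where N: "submodule N R M" "?soc \<subseteq> N" "x \<notin> N"
    and max: "\<forall>L. submodule L R M \<and> N \<subseteq> L \<and> x \<notin> L \<longrightarrow> L = N"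
    using exists_maximal_avoiding[OF soc, of "{x}"] x by auto
  obtain C where C: "submodule C R M" "N <+>\<^bsub>M\<^esub> C = carrier M" "N \<inter> C \<subseteq> {\<zero>\<^bsub>M\<^esub>}"
    by (rule complement_exists[OF comp N(1) submodule_subset[OF N(1)]])
  have above: "x \<in> N <+>\<^bsub>M\<^esub> D" if D: "submodule D R M" "D \<subseteq> C" "D \<noteq> {\<zero>\<^bsub>M\<^esub>}" for D
  proof (rule ccontr)
    assume "x \<notin> N <+>\<^bsub>M\<^esub> D"
    then have "N <+>\<^bsub>M\<^esub> D = N" using max submodule_sum sum_upper1 N(1) D(1) by blast
    then have "D \<subseteq> N" using sum_upper2[OF N(1) D(1)] by simp
    then show False using D C(3) submodule_zero by blast
  qed
  have "C \<noteq> {\<zero>\<^bsub>M\<^esub>}"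
  proof
    assume "C = {\<zero>\<^bsub>M\<^esub>}"
    then have "N = carrier M" using C N(1) sum_absorb(2)[OF C(1) N(1)] submodule_zero by simp
    then show False using N x by simp
  qed
  moreover have "D = {\<zero>\<^bsub>M\<^esub>} \<or> D = C" if D: "submodule D R M" "D \<subseteq> C" for D
  proof (rule ccontr)
    assume not: "\<not> (D = {\<zero>\<^bsub>M\<^esub>} \<or> D = C)"
    obtain E where E: "submodule E R M" "E \<subseteq> C" "D <+>\<^bsub>M\<^esub> E = C" "D \<inter> E \<subseteq> {\<zero>\<^bsub>M\<^esub>}"
      using complement_exists[OF complemented_modulo_hereditary[OF comp C(1)]] D submodule_subset[OF C(1)] by blast
    have "E \<noteq> {\<zero>\<^bsub>M\<^esub>}"
    proof
      assume "E = {\<zero>\<^bsub>M\<^esub>}"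
      then have "C = D" using E D(1) sum_absorb(2)[OF E(1) D(1)] submodule_zero by simp
      then show False using not by simp
    qed
    then have "x \<in> N <+>\<^bsub>M\<^esub> D" "x \<in> N <+>\<^bsub>M\<^esub> E" using above D E not by blast+
    then obtain n d n' e where *: "n \<in> N" "d \<in> D" "n' \<in> N" "e \<in> E" "x = n \<oplus>\<^bsub>M\<^esub> d" "x = n' \<oplus>\<^bsub>M\<^esub> e"
      by (metis sum_memE)
    have c: "n \<in> carrier M" "d \<in> carrier M" "n' \<in> carrier M" "e \<in> carrier M"
      using * N D E submodule_mem by blast+
    \<comment> \<open>The two decompositions of \<open>x\<close> agree because \<open>N + C\<close> is direct.\<close>
    have "n \<ominus>\<^bsub>M\<^esub> n' = e \<ominus>\<^bsub>M\<^esub> d"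
    proof -
      have "n \<ominus>\<^bsub>M\<^esub> n' = (n \<oplus>\<^bsub>M\<^esub> d) \<oplus>\<^bsub>M\<^esub> (\<ominus>\<^bsub>M\<^esub> d \<oplus>\<^bsub>M\<^esub> \<ominus>\<^bsub>M\<^esub> n')"
        using c by (simp add: M.minus_eq M.a_assoc M.r_neg1 M.r_neg2)
      also have "\<dots> = (e \<oplus>\<^bsub>M\<^esub> n') \<oplus>\<^bsub>M\<^esub> (\<ominus>\<^bsub>M\<^esub> n' \<oplus>\<^bsub>M\<^esub> \<ominus>\<^bsub>M\<^esub> d)"
        using c *(5,6) M.a_comm[of n' e] M.a_comm[of "\<ominus>\<^bsub>M\<^esub> d" "\<ominus>\<^bsub>M\<^esub> n'"] by simp
      also have "\<dots> = e \<ominus>\<^bsub>M\<^esub> d" using c by (simp add: M.minus_eq M.a_assoc M.r_neg1 M.r_neg2)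
      finally show ?thesis .
    qed
    moreover have "n \<ominus>\<^bsub>M\<^esub> n' \<in> N" "e \<ominus>\<^bsub>M\<^esub> d \<in> C"
      using * N(1) C(1) D E submodule_minus by blast+
    ultimately have "e \<ominus>\<^bsub>M\<^esub> d = \<zero>\<^bsub>M\<^esub>" using C(3) by auto
    then have "e = d" using c M.add.inv_solve_right[of "\<zero>\<^bsub>M\<^esub>" e d] by (simp add: M.minus_eq a_inv_def)
    then have "d = \<zero>\<^bsub>M\<^esub>" using * E(4) by blast
    then show False using * N c by simp
  qed
  ultimately have "simple_submodule R M C" using C(1) unfolding simple_submodule_def by blast
  then have "C \<subseteq> N" using N(2) generated_upper[of "\<Union>{S. simple_submodule R M S}"] by blast
  then have "C = {\<zero>\<^bsub>M\<^esub>}" using C(1,3) submodule_zero by blast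
  with \<open>C \<noteq> {\<zero>\<^bsub>M\<^esub>}\<close> show False by simp
qed

theorem semisimple_iff_complemented:
  "semisimple_module R M \<longleftrightarrow> complemented_modulo R M (carrier M) {\<zero>\<^bsub>M\<^esub>}"
  using semisimple_imp_complemented complemented_imp_semisimple by blast

lemma submodule_as_module:
  assumes S: "submodule S R M"
  shows "left_module R (M\<lparr>carrier := S\<rparr>)"
proof -
  have "abelian_group (M\<lparr>carrier := S\<rparr>)"
  proof (rule abelian_groupI; simp)
    fix x assume x: "x \<in> S"
    then show "\<exists>y\<in>S. y \<oplus>\<^bsub>M\<^esub> x = \<zero>\<^bsub>M\<^esub>"
      using submodule_neg[OF S x] submodule_mem[OF S x] M.l_neg by blast
  qed (use S in \<open>auto simp: submodule_rules M.a_assoc intro: M.a_comm\<close>)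
  then show ?thesis
    using S by (intro left_module.intro left_module_axioms.intro R.ring_axioms)
      (auto simp: submodule_rules smult_l_distr smult_r_distr smult_assoc smult_one)
qed

lemma submodule_of_submodule_iff:
  assumes S: "submodule S R M"
  shows "submodule L R (M\<lparr>carrier := S\<rparr>) \<longleftrightarrow> submodule L R M \<and> L \<subseteq> S"
proof -
  interpret S: left_module R "M\<lparr>carrier := S\<rparr>" by (rule submodule_as_module[OF S])
  show ?thesis
  proof
    assume L: "submodule L R (M\<lparr>carrier := S\<rparr>)"
    have "L \<subseteq> S" using S.submodule_subset[OF L] by simp
    moreover have "submodule L R M"
      using S.submodule_zero[OF L] S.submodule_add[OF L] S.submodule_smult[OF L] \<open>L \<subseteq> S\<close> submodule_subset[OF S]
      by (intro submoduleI) auto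
    ultimately show "submodule L R M \<and> L \<subseteq> S" by simp
  next
    assume L: "submodule L R M \<and> L \<subseteq> S"
    then show "submodule L R (M\<lparr>carrier := S\<rparr>)"
      by (intro S.submoduleI) (auto simp: submodule_rules)
  qed
qed

lemma sum_in_submodule: "A <+>\<^bsub>M\<lparr>carrier := S\<rparr>\<^esub> B = A <+>\<^bsub>M\<^esub> B"
  by (simp add: set_add_def set_mult_def)

lemma complemented_in_submodule:
  assumes "submodule S R M" "A \<subseteq> S"
  shows "complemented_modulo R (M\<lparr>carrier := S\<rparr>) A N \<longleftrightarrow> complemented_modulo R M A N"
  using assms(2) unfolding complemented_modulo_def submodule_of_submodule_iff[OF assms(1)] sum_in_submodule
  by (metis order_trans)

lemma semisimple_submodule_iff:
  assumes "submodule S R M"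
  shows "semisimple_module R (M\<lparr>carrier := S\<rparr>) \<longleftrightarrow> complemented_modulo R M S {\<zero>\<^bsub>M\<^esub>}"
  using left_module.semisimple_iff_complemented[OF submodule_as_module[OF assms]]
    complemented_in_submodule[OF assms] by simp

end

section \<open>Homomorphisms and quotients\<close>

locale left_module_morphism =
  M: left_module R M + P: left_module R P
  for R :: "('a, 'r) ring_scheme" (structure)
    and M :: "('a, 'm, 'x) module_scheme" (structure)
    and P :: "('a, 'p, 'y) module_scheme" (structure) +
  fixes g :: "'m \<Rightarrow> 'p"
  assumes hom: "g \<in> left_module_hom R M P"
begin

text \<open>The restriction to the carrier matters, because \<open>g\<close> is arbitrary outside it.\<close>

definition preimage :: "'p set \<Rightarrow> 'm set" where
  "preimage L = {x \<in> carrier M. g x \<in> L}"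

lemma hom_closed: "x \<in> carrier M \<Longrightarrow> g x \<in> carrier P"
  using hom by (auto simp: left_module_hom_def)

lemma hom_add: "\<lbrakk>x \<in> carrier M; y \<in> carrier M\<rbrakk> \<Longrightarrow> g (x \<oplus>\<^bsub>M\<^esub> y) = g x \<oplus>\<^bsub>P\<^esub> g y"
  using hom by (auto simp: left_module_hom_def)

lemma hom_smult: "\<lbrakk>a \<in> carrier R; x \<in> carrier M\<rbrakk> \<Longrightarrow> g (a \<odot>\<^bsub>M\<^esub> x) = a \<odot>\<^bsub>P\<^esub> g x"
  using hom by (auto simp: left_module_hom_def)

lemma hom_zero: "g \<zero>\<^bsub>M\<^esub> = \<zero>\<^bsub>P\<^esub>"
  using hom_smult[of "\<zero>\<^bsub>R\<^esub>" "\<zero>\<^bsub>M\<^esub>"] hom_closed[of "\<zero>\<^bsub>M\<^esub>"]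
  by (simp add: M.smult_zero_left P.smult_zero_left)

lemma hom_neg: "x \<in> carrier M \<Longrightarrow> g (\<ominus>\<^bsub>M\<^esub> x) = \<ominus>\<^bsub>P\<^esub> g x"
  using hom_smult[of "\<ominus>\<^bsub>R\<^esub> \<one>\<^bsub>R\<^esub>" x] hom_closed[of x]
  by (simp add: M.smult_minus_left P.smult_minus_left M.smult_one P.smult_one)

lemma hom_minus: "\<lbrakk>x \<in> carrier M; y \<in> carrier M\<rbrakk> \<Longrightarrow> g (x \<ominus>\<^bsub>M\<^esub> y) = g x \<ominus>\<^bsub>P\<^esub> g y"
  by (simp add: a_minus_def hom_add hom_neg)

lemma submodule_preimage:
  assumes "submodule L R P"
  shows "submodule (preimage L) R M"
  using assms by (intro M.submoduleI)
    (auto simp: preimage_def hom_zero hom_add hom_smult M.smult_closed P.submodule_rules)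

lemma submodule_image:
  assumes L: "submodule L R M"
  shows "submodule (g ` L) R P"
proof (rule P.submoduleI)
  show "g ` L \<subseteq> carrier P" using hom_closed M.submodule_mem[OF L] by blast
  show "\<zero>\<^bsub>P\<^esub> \<in> g ` L" using hom_zero M.submodule_zero[OF L] by (metis imageI)
  show "x \<oplus>\<^bsub>P\<^esub> y \<in> g ` L" if xy: "x \<in> g ` L" "y \<in> g ` L" for x y
  proof -
    obtain u v where uv: "u \<in> L" "v \<in> L" "x = g u" "y = g v" using xy by blast
    then have "x \<oplus>\<^bsub>P\<^esub> y = g (u \<oplus>\<^bsub>M\<^esub> v)"
      using hom_add[of u v] M.submodule_mem[OF L] by simp
    then show ?thesis using M.submodule_add[OF L uv(1,2)] by simp
  qed
  show "a \<odot>\<^bsub>P\<^esub> x \<in> g ` L" if ax: "a \<in> carrier R" "x \<in> g ` L" for a x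
  proof -
    obtain u where u: "u \<in> L" "x = g u" using ax by blast
    then have "a \<odot>\<^bsub>P\<^esub> x = g (a \<odot>\<^bsub>M\<^esub> u)"
      using hom_smult[of a u] ax M.submodule_mem[OF L] by simp
    then show ?thesis using M.submodule_smult[OF L ax(1) u(1)] by simp
  qed
qed

text \<open>
  If \<open>L\<close> properly contains the preimage of \<open>N\<close>, then \<open>N + g(L) = P\<close>. So every element of \<open>M\<close> can
  be moved into the preimage of \<open>N\<close> by subtracting an element of \<open>L\<close>.
\<close>

lemma maximal_preimage:
  assumes N: "maximal_submodule R P N"
  shows "preimage N = carrier M \<or> maximal_submodule R M (preimage N)"
proof -
  have Ns: "submodule N R P" using N by (simp add: maximal_submodule_def)
  have pN: "submodule (preimage N) R M" by (rule submodule_preimage[OF Ns])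
  have "L = carrier M" if L: "submodule L R M" "preimage N \<subseteq> L" "L \<noteq> preimage N" for L
  proof -
    have gL: "submodule (g ` L) R P" by (rule submodule_image[OF L(1)])
    obtain l where "l \<in> L" "l \<notin> preimage N" using L by blast
    then have "\<not> g ` L \<subseteq> N" using M.submodule_mem[OF L(1)] by (auto simp: preimage_def)
    then have "N <+>\<^bsub>P\<^esub> g ` L \<noteq> N" using P.sum_upper2[OF Ns gL] by blast
    then have full: "N <+>\<^bsub>P\<^esub> g ` L = carrier P"
      using N P.submodule_sum[OF Ns gL] P.sum_upper1[OF Ns gL] unfolding maximal_submodule_def by blast
    have "m \<in> L" if m: "m \<in> carrier M" for m
    proof -
      have "g m \<in> N <+>\<^bsub>P\<^esub> g ` L" using hom_closed[OF m] full by simp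
      then obtain n l where nl: "n \<in> N" "l \<in> L" "g m = n \<oplus>\<^bsub>P\<^esub> g l" by (auto elim: P.sum_memE)
      have c: "n \<in> carrier P" "l \<in> carrier M" "g l \<in> carrier P"
        using P.submodule_mem[OF Ns nl(1)] M.submodule_mem[OF L(1) nl(2)] hom_closed by auto
      have "g (m \<ominus>\<^bsub>M\<^esub> l) = n"
        using nl(3) c m hom_minus[of m l] by (simp add: P.M.minus_eq P.M.a_assoc P.M.r_neg)
      then have "m \<ominus>\<^bsub>M\<^esub> l \<in> L" using L(2) m c nl(1) by (auto simp: preimage_def)
      then have "(m \<ominus>\<^bsub>M\<^esub> l) \<oplus>\<^bsub>M\<^esub> l \<in> L" by (rule M.submodule_add[OF L(1) _ nl(2)])
      then show ?thesis using m c by (simp add: M.M.minus_eq M.M.a_assoc M.M.l_neg)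
    qed
    then show ?thesis using M.submodule_subset[OF L(1)] by blast
  qed
  then show ?thesis using pN unfolding maximal_submodule_def by blast
qed

lemma hom_Rad: "x \<in> Rad R M \<Longrightarrow> g x \<in> Rad R P"
  using maximal_preimage hom_closed by (auto simp: Rad_def preimage_def)

end

locale left_module_epi = left_module_morphism +
  assumes surj: "g ` carrier M = carrier P"
begin

lemma lift:
  assumes "y \<in> carrier P"
  obtains x where "x \<in> carrier M" "g x = y"
proof -
  have "y \<in> g ` carrier M" using assms surj by simp
  then show thesis using that by blast
qed

lemma image_preimage:
  assumes "L \<subseteq> carrier P"
  shows "g ` preimage L = L"
proof
  show "L \<subseteq> g ` preimage L"
  proof
    fix y assume y: "y \<in> L"
    then obtain x where "x \<in> carrier M" "g x = y" using lift assms by blast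
    then show "y \<in> g ` preimage L" using y by (auto simp: preimage_def)
  qed
qed (auto simp: preimage_def)

lemma preimage_image:
  assumes "submodule L R M" "preimage {\<zero>\<^bsub>P\<^esub>} \<subseteq> L"
  shows "preimage (g ` L) = L"
proof
  show "L \<subseteq> preimage (g ` L)" using M.submodule_mem[OF assms(1)] by (auto simp: preimage_def)
  show "preimage (g ` L) \<subseteq> L"
  proof
    fix x assume "x \<in> preimage (g ` L)"
    then obtain l where l: "x \<in> carrier M" "l \<in> L" "g x = g l" by (auto simp: preimage_def)
    have lc: "l \<in> carrier M" by (rule M.submodule_mem[OF assms(1) l(2)])
    have "x \<ominus>\<^bsub>M\<^esub> l \<in> preimage {\<zero>\<^bsub>P\<^esub>}"
      using l lc hom_minus[of x l] hom_closed[of l] by (simp add: preimage_def P.M.minus_eq P.M.r_neg)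
    then have "(x \<ominus>\<^bsub>M\<^esub> l) \<oplus>\<^bsub>M\<^esub> l \<in> L" using assms l(2) M.submodule_add by blast
    then show "x \<in> L" using l(1) lc by (simp add: M.M.minus_eq M.M.a_assoc M.M.l_neg)
  qed
qed

lemma preimage_sum_full:
  assumes L: "submodule L R M" and full: "g ` L <+>\<^bsub>P\<^esub> K = carrier P" and K: "submodule K R P"
  shows "L <+>\<^bsub>M\<^esub> preimage K = carrier M"
proof -
  have "x \<in> L <+>\<^bsub>M\<^esub> preimage K" if x: "x \<in> carrier M" for x
  proof -
    have "g x \<in> g ` L <+>\<^bsub>P\<^esub> K" using full hom_closed[OF x] by simp
    then obtain l k where l: "l \<in> L" "k \<in> K" "g x = g l \<oplus>\<^bsub>P\<^esub> k" by (auto elim: P.sum_memE)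
    have lc: "l \<in> carrier M" "k \<in> carrier P" using l M.submodule_mem[OF L] P.submodule_mem[OF K] by auto
    have "g (x \<ominus>\<^bsub>M\<^esub> l) = k"
      using l lc x hom_minus[of x l] hom_closed[of l] P.M.a_comm[of "g l" k]
      by (simp add: P.M.minus_eq P.M.a_assoc P.M.r_neg)
    then have "x \<ominus>\<^bsub>M\<^esub> l \<in> preimage K" using l x lc by (simp add: preimage_def)
    moreover have "x = l \<oplus>\<^bsub>M\<^esub> (x \<ominus>\<^bsub>M\<^esub> l)"
      using x lc M.M.a_comm[of l "x \<ominus>\<^bsub>M\<^esub> l"] by (simp add: M.M.minus_eq M.M.a_assoc M.M.l_neg)
    ultimately show ?thesis using M.sum_memI[OF l(1)] by metis
  qed
  then show ?thesis
    using M.submodule_subset[OF M.submodule_sum[OF L submodule_preimage[OF K]]] by blast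
qed

lemma image_sum_full:
  assumes "A <+>\<^bsub>M\<^esub> B = carrier M" "submodule A R M" "submodule B R M"
  shows "g ` A <+>\<^bsub>P\<^esub> g ` B = carrier P"
proof -
  have "y \<in> g ` A <+>\<^bsub>P\<^esub> g ` B" if y: "y \<in> carrier P" for y
  proof -
    obtain x where x: "x \<in> carrier M" "g x = y" by (rule lift[OF y])
    then have "x \<in> A <+>\<^bsub>M\<^esub> B" using assms(1) by simp
    then obtain a b where ab: "a \<in> A" "b \<in> B" "x = a \<oplus>\<^bsub>M\<^esub> b" by (rule M.sum_memE)
    then have "y = g a \<oplus>\<^bsub>P\<^esub> g b"
      using x(2) hom_add[OF M.submodule_mem[OF assms(2) ab(1)] M.submodule_mem[OF assms(3) ab(2)]] by simp
    then show ?thesis using ab P.sum_memI[of "g a" "g ` A" "g b" "g ` B"] by simp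
  qed
  then show ?thesis
    using P.submodule_subset[OF P.submodule_sum[OF submodule_image[OF assms(2)] submodule_image[OF assms(3)]]] by blast
qed

text \<open>
  Complements are transported by taking preimages in one direction and images in the other.
\<close>

theorem complemented_modulo_preimage:
  assumes N: "N \<subseteq> carrier P"
  shows "complemented_modulo R M (carrier M) (preimage N) \<longleftrightarrow> complemented_modulo R P (carrier P) N"
proof
  assume comp: "complemented_modulo R P (carrier P) N"
  show "complemented_modulo R M (carrier M) (preimage N)"
    unfolding complemented_modulo_def
  proof (intro allI impI)
    fix L assume "submodule L R M \<and> L \<subseteq> carrier M"
    then have L: "submodule L R M" by simp
    obtain K where K: "submodule K R P" "g ` L <+>\<^bsub>P\<^esub> K = carrier P" "g ` L \<inter> K \<subseteq> N"
      by (rule P.complement_exists[OF comp submodule_image[OF L] P.submodule_subset[OF submodule_image[OF L]]])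
    have "L \<inter> preimage K \<subseteq> preimage N" using K(3) by (auto simp: preimage_def)
    then show "\<exists>K. submodule K R M \<and> K \<subseteq> carrier M \<and> L <+>\<^bsub>M\<^esub> K = carrier M \<and> L \<inter> K \<subseteq> preimage N"
      using preimage_sum_full[OF L K(2,1)] submodule_preimage[OF K(1)] M.submodule_subset by blast
  qed
next
  assume comp: "complemented_modulo R M (carrier M) (preimage N)"
  show "complemented_modulo R P (carrier P) N"
    unfolding complemented_modulo_def
  proof (intro allI impI)
    fix L assume L: "submodule L R P \<and> L \<subseteq> carrier P"
    then have pL: "submodule (preimage L) R M" using submodule_preimage by blast
    obtain K where K: "submodule K R M" "preimage L <+>\<^bsub>M\<^esub> K = carrier M" "preimage L \<inter> K \<subseteq> preimage N"
      by (rule M.complement_exists[OF comp pL M.submodule_subset[OF pL]])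
    have "L <+>\<^bsub>P\<^esub> g ` K = carrier P"
      using image_sum_full[OF K(2) pL K(1)] image_preimage[of L] L by simp
    moreover have "L \<inter> g ` K \<subseteq> N"
      using K(3) M.submodule_mem[OF K(1)] by (auto simp: preimage_def)
    ultimately show "\<exists>K. submodule K R P \<and> K \<subseteq> carrier P \<and> L <+>\<^bsub>P\<^esub> K = carrier P \<and> L \<inter> K \<subseteq> N"
      using submodule_image[OF K(1)] P.submodule_subset by blast
  qed
qed

text \<open>Semisimplicity of a quotient can thus be tested in the module itself.\<close>

corollary semisimple_iff_complemented_modulo_kernel:
  "semisimple_module R P \<longleftrightarrow> complemented_modulo R M (carrier M) (preimage {\<zero>\<^bsub>P\<^esub>})"
  by (simp add: P.semisimple_iff_complemented complemented_modulo_preimage)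

lemma maximal_image:
  assumes N: "maximal_submodule R M N" "preimage {\<zero>\<^bsub>P\<^esub>} \<subseteq> N"
  shows "maximal_submodule R P (g ` N)"
  unfolding maximal_submodule_def
proof (intro conjI allI impI)
  have Ns: "submodule N R M" "N \<noteq> carrier M" using N by (auto simp: maximal_submodule_def)
  have pN: "preimage (g ` N) = N" by (rule preimage_image[OF Ns(1) N(2)])
  show "submodule (g ` N) R P" by (rule submodule_image[OF Ns(1)])
  show "g ` N \<noteq> carrier P" using pN Ns(2) hom_closed by (auto simp: preimage_def)
  fix L assume L: "submodule L R P \<and> g ` N \<subseteq> L"
  then have "N \<subseteq> preimage L" using pN by (auto simp: preimage_def)
  then have "preimage L = N \<or> preimage L = carrier M"
    using N(1) submodule_preimage L unfolding maximal_submodule_def by blast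
  then show "L = g ` N \<or> L = carrier P"
    using image_preimage[of L] L P.submodule_subset surj by metis
qed

text \<open>Maximal submodules of \<open>M\<close> contain the kernel, so their images are maximal in \<open>P\<close>.\<close>

lemma preimage_Rad_subset:
  assumes "preimage {\<zero>\<^bsub>P\<^esub>} \<subseteq> Rad R M"
  shows "preimage (Rad R P) \<subseteq> Rad R M"
proof
  fix x assume x: "x \<in> preimage (Rad R P)"
  have "x \<in> N" if N: "maximal_submodule R M N" for N
  proof -
    have ker: "preimage {\<zero>\<^bsub>P\<^esub>} \<subseteq> N" using assms N by (auto simp: Rad_def)
    then have "g x \<in> g ` N" using x maximal_image[OF N] by (auto simp: preimage_def Rad_def)
    then have "x \<in> preimage (g ` N)" using x by (auto simp: preimage_def)
    then show ?thesis using preimage_image[OF _ ker] N by (simp add: maximal_submodule_def)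
  qed
  then show "x \<in> Rad R M" using x by (auto simp: Rad_def preimage_def)
qed

end

lemma left_module_morphismI:
  "\<lbrakk>left_module R M; left_module R P; g \<in> left_module_hom R M P\<rbrakk> \<Longrightarrow> left_module_morphism R M P g"
  by (simp add: left_module_morphism.intro left_module_morphism_axioms.intro)

lemma left_module_epiI:
  "\<lbrakk>left_module R M; left_module R P; g \<in> left_module_hom R M P; g ` carrier M = carrier P\<rbrakk>
    \<Longrightarrow> left_module_epi R M P g"
  by (simp add: left_module_epi.intro left_module_epi_axioms.intro left_module_morphismI)

text \<open>
  The module axioms pass to every structure onto which \<open>M\<close> maps compatibly with the operations.
  Quotients, images of homomorphisms and copies along injections are all obtained in this way.
\<close>

lemma (in left_module) epi_onto_image:
  fixes P :: "('a, 'p, 'y) module_scheme"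
  assumes carrier: "carrier P = g ` carrier M"
    and zero: "\<zero>\<^bsub>P\<^esub> = g \<zero>\<^bsub>M\<^esub>"
    and add: "\<And>x y. \<lbrakk>x \<in> carrier M; y \<in> carrier M\<rbrakk> \<Longrightarrow> g (x \<oplus>\<^bsub>M\<^esub> y) = g x \<oplus>\<^bsub>P\<^esub> g y"
    and smult: "\<And>a x. \<lbrakk>a \<in> carrier R; x \<in> carrier M\<rbrakk> \<Longrightarrow> g (a \<odot>\<^bsub>M\<^esub> x) = a \<odot>\<^bsub>P\<^esub> g x"
  shows "left_module_epi R M P g"
proof (rule left_module_epiI[OF left_module_axioms])
  have "abelian_group P"
  proof (rule abelian_groupI; unfold carrier zero)
    fix x assume "x \<in> g ` carrier M"
    then obtain u where u: "u \<in> carrier M" "x = g u" by blast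
    then have "g (\<ominus>\<^bsub>M\<^esub> u) \<oplus>\<^bsub>P\<^esub> x = g \<zero>\<^bsub>M\<^esub>" using add[of "\<ominus>\<^bsub>M\<^esub> u" u] by (simp add: M.l_neg)
    then show "\<exists>y\<in>g ` carrier M. y \<oplus>\<^bsub>P\<^esub> x = g \<zero>\<^bsub>M\<^esub>" using u by blast
  qed (auto simp flip: add simp: M.a_assoc intro: arg_cong[OF M.a_comm])
  then show "left_module R P"
    by (intro left_module.intro left_module_axioms.intro R.ring_axioms)
      (auto simp: carrier smult_closed smult_l_distr smult_r_distr smult_assoc smult_one simp flip: add smult)
  show "g \<in> left_module_hom R M P" using carrier add smult by (auto simp: left_module_hom_def)
qed (simp add: carrier)

lemma (in left_module_morphism) epi_image:
  "left_module_epi R M (P\<lparr>carrier := g ` carrier M\<rparr>) g"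
  by (rule M.epi_onto_image) (auto simp: hom_zero hom_add hom_smult)

lemma (in left_module_epi) finitely_generated_image:
  assumes "finitely_generated R M"
  shows "finitely_generated R P"
proof -
  obtain X where X: "finite X" "X \<subseteq> carrier M" "submodule_generated R M X = carrier M"
    using assms by (auto simp: finitely_generated_def)
  have full: "N = carrier P" if N: "submodule N R P" "g ` X \<subseteq> N" for N
  proof -
    have "carrier M \<subseteq> preimage N"
      using X N M.generated_least[OF submodule_preimage[OF N(1)], of X] by (auto simp: preimage_def)
    then have "g ` carrier M \<subseteq> N" by (auto simp: preimage_def)
    then show ?thesis using surj P.submodule_subset[OF N(1)] by simp
  qed
  have sub: "g ` X \<subseteq> carrier P" using X(2) hom_closed by blast
  have "submodule_generated R P (g ` X) = carrier P"
    by (rule full[OF P.generated_submodule[OF sub] P.generated_upper])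
  then show ?thesis unfolding finitely_generated_def using X(1) sub by blast
qed

context left_module
begin

lemma quotient_epi:
  assumes N: "submodule N R M"
  shows "left_module_epi R M (quotient_module M N) (\<lambda>x. N +>\<^bsub>M\<^esub> x)"
proof -
  interpret N: abelian_subgroup N M
    using submodule.axioms(1)[OF N] M.abelian_group_axioms
    by (intro abelian_subgroupI3 additive_subgroup.intro)
  show ?thesis
  proof (rule epi_onto_image)
    fix a x assume ax: "a \<in> carrier R" "x \<in> carrier M"
    have const: "N +>\<^bsub>M\<^esub> (a \<odot>\<^bsub>M\<^esub> y) = N +>\<^bsub>M\<^esub> (a \<odot>\<^bsub>M\<^esub> x)" if y: "y \<in> N +>\<^bsub>M\<^esub> x" for y
    proof -
      obtain n where n: "n \<in> N" "y = n \<oplus>\<^bsub>M\<^esub> x" using y by (auto simp: a_r_coset_def')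
      then have "a \<odot>\<^bsub>M\<^esub> y = a \<odot>\<^bsub>M\<^esub> n \<oplus>\<^bsub>M\<^esub> a \<odot>\<^bsub>M\<^esub> x"
        using ax submodule_mem[OF N] by (simp add: smult_r_distr)
      then have "a \<odot>\<^bsub>M\<^esub> y \<in> N +>\<^bsub>M\<^esub> (a \<odot>\<^bsub>M\<^esub> x)"
        using submodule_smult[OF N ax(1) n(1)] by (auto simp: a_r_coset_def')
      then show ?thesis by (rule N.a_repr_independence'[OF _ smult_closed[OF ax], symmetric])
    qed
    have "(\<Union>y\<in>N +>\<^bsub>M\<^esub> x. N +>\<^bsub>M\<^esub> (a \<odot>\<^bsub>M\<^esub> y)) = N +>\<^bsub>M\<^esub> (a \<odot>\<^bsub>M\<^esub> x)"
    proof (rule SUP_eq_const)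
      show "N +>\<^bsub>M\<^esub> x \<noteq> {}" using N.a_rcos_self[OF ax(2)] by blast
    qed (rule const)
    then show "N +>\<^bsub>M\<^esub> (a \<odot>\<^bsub>M\<^esub> x) = a \<odot>\<^bsub>quotient_module M N\<^esub> (N +>\<^bsub>M\<^esub> x)"
      by (simp add: quotient_module_def)
  qed (auto simp: quotient_module_def A_RCOSETS_def' N.a_rcos_sum N.a_rcos_const submodule_zero[OF N])
qed

lemma quotient_kernel:
  assumes N: "submodule N R M"
  shows "left_module_morphism.preimage M (\<lambda>x. N +>\<^bsub>M\<^esub> x) {\<zero>\<^bsub>quotient_module M N\<^esub>} = N"
proof -
  interpret left_module_epi R M "quotient_module M N" "\<lambda>x. N +>\<^bsub>M\<^esub> x" by (rule quotient_epi[OF N])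
  interpret N: abelian_subgroup N M
    using submodule.axioms(1)[OF N] M.abelian_group_axioms
    by (intro abelian_subgroupI3 additive_subgroup.intro)
  show ?thesis
    using N.a_rcos_self N.a_rcos_const submodule_mem[OF N]
    by (auto simp: preimage_def) (auto simp: quotient_module_def)
qed

lemma semisimple_quotient_iff:
  assumes N: "submodule N R M"
  shows "semisimple_module R (quotient_module M N) \<longleftrightarrow> complemented_modulo R M (carrier M) N"
  using left_module_epi.semisimple_iff_complemented_modulo_kernel[OF quotient_epi[OF N]]
  by (simp add: quotient_kernel[OF N])

section \<open>The radical\<close>

lemma submodule_Rad: "submodule (Rad R M) R M"
  unfolding Rad_def by (rule submodule_Inter) (simp add: maximal_submodule_def)

theorem semilocal_iff_complemented_modulo_Rad:
  "semilocal_module R M \<longleftrightarrow> complemented_modulo R M (carrier M) (Rad R M)"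
  unfolding semilocal_module_def by (rule semisimple_quotient_iff[OF submodule_Rad])

text \<open>A submodule that is not contained in a maximal submodule adds up to \<open>M\<close> with it.\<close>

lemma small_submodule_subset_Rad:
  assumes S: "small_submodule R M S"
  shows "S \<subseteq> Rad R M"
proof -
  have Ss: "submodule S R M" using S by (simp add: small_submodule_def)
  have "S \<subseteq> N" if N: "maximal_submodule R M N" for N
  proof -
    have Ns: "submodule N R M" "N \<noteq> carrier M" using N by (auto simp: maximal_submodule_def)
    have "S <+>\<^bsub>M\<^esub> N \<noteq> carrier M" using S Ns by (simp add: small_submodule_def)
    then have "S <+>\<^bsub>M\<^esub> N = N"
      using N submodule_sum[OF Ss Ns(1)] sum_upper2[OF Ss Ns(1)] unfolding maximal_submodule_def by blast
    then show ?thesis using sum_upper1[OF Ss Ns(1)] by simp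
  qed
  then show ?thesis using submodule_subset[OF Ss] by (auto simp: Rad_def)
qed

lemma small_submodule_mono:
  assumes "small_submodule R M S" "submodule L R M" "L \<subseteq> S"
  shows "small_submodule R M L"
  unfolding small_submodule_def
proof (intro conjI allI impI)
  fix K assume K: "submodule K R M \<and> K \<noteq> carrier M"
  have S: "submodule S R M" using assms by (simp add: small_submodule_def)
  have "S <+>\<^bsub>M\<^esub> K \<noteq> carrier M" using assms(1) K by (simp add: small_submodule_def)
  moreover have "L <+>\<^bsub>M\<^esub> K \<subseteq> S <+>\<^bsub>M\<^esub> K" by (rule sum_mono[OF assms(3) subset_refl])
  ultimately show "L <+>\<^bsub>M\<^esub> K \<noteq> carrier M"
    using submodule_subset[OF submodule_sum[OF S]] K by blast
qed (rule assms(2))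

text \<open>A proper submodule lies below a maximal one, which contains the radical as well.\<close>

lemma finitely_generated_small_radical:
  assumes "finitely_generated R M"
  shows "has_small_radical R M"
  unfolding has_small_radical_def small_submodule_def
proof (intro conjI allI impI)
  fix L assume L: "submodule L R M \<and> L \<noteq> carrier M"
  then obtain N where N: "maximal_submodule R M N" "L \<subseteq> N"
    using proper_submodule_below_maximal[OF assms] by blast
  have "Rad R M <+>\<^bsub>M\<^esub> L \<subseteq> N"
    using N by (intro sum_least) (auto simp: maximal_submodule_def Rad_def)
  then show "Rad R M <+>\<^bsub>M\<^esub> L \<noteq> carrier M"
    using N submodule_subset[of N] unfolding maximal_submodule_def by blast
qed (rule submodule_Rad)

end

lemma (in left_module_epi) semilocal_lift:
  assumes "semilocal_module R P" "preimage {\<zero>\<^bsub>P\<^esub>} \<subseteq> Rad R M"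
  shows "semilocal_module R M"
  using assms(1) complemented_modulo_mono[OF _ preimage_Rad_subset[OF assms(2)]]
    complemented_modulo_preimage[of "Rad R P"] P.submodule_subset[OF P.submodule_Rad]
  by (simp add: M.semilocal_iff_complemented_modulo_Rad P.semilocal_iff_complemented_modulo_Rad)

section \<open>Copies along injections and products\<close>

text \<open>
  The conditions of the theorem range over modules on one universe type. This copy of a module
  along an injection brings the regular module and its quotients into that universe.
\<close>

definition transport_module ::
  "('m \<Rightarrow> 'u) \<Rightarrow> ('a, 'm, 'x) module_scheme \<Rightarrow> ('a, 'u) module" where
  "transport_module f M = \<lparr>carrier = f ` carrier M, monoid.mult = (\<lambda>x y. x), one = f \<zero>\<^bsub>M\<^esub>,
     ring.zero = f \<zero>\<^bsub>M\<^esub>, ring.add = (\<lambda>x y. f (inv_into UNIV f x \<oplus>\<^bsub>M\<^esub> inv_into UNIV f y)),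
     smult = (\<lambda>a x. f (a \<odot>\<^bsub>M\<^esub> inv_into UNIV f x))\<rparr>"

lemma (in left_module) transport_epi:
  assumes "inj f"
  shows "left_module_epi R M (transport_module f M) f"
  by (rule epi_onto_image) (auto simp: transport_module_def inv_f_f[OF assms])

lemma (in left_module) transport_kernel:
  assumes "inj f"
  shows "left_module_morphism.preimage M f {\<zero>\<^bsub>transport_module f M\<^esub>} = {\<zero>\<^bsub>M\<^esub>}"
proof -
  interpret left_module_epi R M "transport_module f M" f by (rule transport_epi[OF assms])
  show ?thesis using inj_eq[OF assms] by (auto simp: preimage_def transport_module_def)
qed

lemma product_left_module:
  assumes R: "ring R" and M: "\<And>i. i \<in> I \<Longrightarrow> left_module R (M i)"
  shows "left_module R (product_module I M)"
proof -
  interpret R: ring R by (rule R)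
  note group = abelian_group.axioms(1)[OF left_module.axioms(2)[OF M]] left_module.axioms(2)[OF M]
  have "abelian_group (product_module I M)"
  proof (rule abelian_groupI; simp add: product_module_def)
    show "\<exists>y\<in>\<Pi>\<^sub>E i\<in>I. carrier (M i). (\<lambda>i\<in>I. y i \<oplus>\<^bsub>M i\<^esub> x i) = (\<lambda>i\<in>I. \<zero>\<^bsub>M i\<^esub>)"
      if "x \<in> (\<Pi>\<^sub>E i\<in>I. carrier (M i))" for x
      using that group
      by (intro bexI[of _ "\<lambda>i\<in>I. \<ominus>\<^bsub>M i\<^esub> x i"])
        (auto intro!: restrict_ext abelian_group.l_neg abelian_group.a_inv_closed simp: PiE_mem)
  qed (use group in \<open>auto intro!: restrict_ext abelian_monoid.a_closed abelian_monoid.a_assoc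
      abelian_monoid.a_comm abelian_monoid.zero_closed abelian_monoid.l_zero extensionalityI[of _ I]
      simp: PiE_mem PiE_iff\<close>)
  then show ?thesis
    using M by (intro left_module.intro left_module_axioms.intro R.ring_axioms)
      (auto simp: product_module_def PiE_mem PiE_iff intro!: restrict_ext extensionalityI[of _ I]
        left_module.smult_closed left_module.smult_l_distr left_module.smult_r_distr
        left_module.smult_assoc left_module.smult_one)
qed

lemma hom_to_product:
  assumes "\<And>i. i \<in> I \<Longrightarrow> g i \<in> left_module_hom R M (P i)"
  shows "(\<lambda>x. \<lambda>i\<in>I. g i x) \<in> left_module_hom R M (product_module I P)"
  using assms unfolding left_module_hom_def product_module_def
  by (auto intro!: restrict_ext simp: Pi_iff PiE_iff)

lemma hom_from_product:
  assumes "i \<in> I"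
  shows "(\<lambda>x. x i) \<in> left_module_hom R (product_module I P) (P i)"
  using assms unfolding left_module_hom_def product_module_def by (auto simp: PiE_iff)

section \<open>The regular module and the Jacobson radical\<close>

lemma regular_module_simps [simp]:
  "carrier (regular_module R) = carrier R"
  "\<zero>\<^bsub>regular_module R\<^esub> = \<zero>\<^bsub>R\<^esub>"
  "x \<oplus>\<^bsub>regular_module R\<^esub> y = x \<oplus>\<^bsub>R\<^esub> y"
  "a \<odot>\<^bsub>regular_module R\<^esub> x = a \<otimes>\<^bsub>R\<^esub> x"
  "\<ominus>\<^bsub>regular_module R\<^esub> x = \<ominus>\<^bsub>R\<^esub> x"
  "x \<ominus>\<^bsub>regular_module R\<^esub> y = x \<ominus>\<^bsub>R\<^esub> y"
  by (simp_all add: regular_module_def a_minus_def a_inv_def m_inv_def)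

abbreviation jacobson_radical :: "('a, 'r) ring_scheme \<Rightarrow> 'a set" where
  "jacobson_radical R \<equiv> Rad R (regular_module R)"

lemma (in ring) regular_left_module: "left_module R (regular_module R)"
proof -
  have "abelian_group (regular_module R)"
    by (rule abelian_groupI) (auto simp: a_assoc intro: a_comm l_neg)
  then show ?thesis
    by (intro left_module.intro left_module_axioms.intro ring_axioms)
      (auto simp: l_distr r_distr m_assoc)
qed

lemma (in ring) regular_eq_carrier:
  assumes "submodule L R (regular_module R)" "\<one> \<in> L"
  shows "L = carrier R"
proof -
  interpret reg: left_module R "regular_module R" by (rule regular_left_module)
  show ?thesis
    using reg.submodule_subset[OF assms(1)] reg.submodule_smult[OF assms(1) _ assms(2)] by auto
qed

lemma (in ring) regular_finitely_generated: "finitely_generated R (regular_module R)"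
proof -
  interpret reg: left_module R "regular_module R" by (rule regular_left_module)
  have "submodule_generated R (regular_module R) {\<one>} = carrier R"
    using reg.generated_submodule[of "{\<one>}"] reg.generated_upper[of "{\<one>}"] regular_eq_carrier by auto
  then show ?thesis unfolding finitely_generated_def by (intro exI[of _ "{\<one>}"]) auto
qed

lemma (in left_module) cyclic_morphism:
  assumes "x \<in> carrier M"
  shows "left_module_morphism R (regular_module R) M (\<lambda>r. r \<odot>\<^bsub>M\<^esub> x)"
  by (rule left_module_morphismI[OF R.regular_left_module left_module_axioms])
    (use assms in \<open>auto simp: left_module_hom_def smult_closed smult_l_distr smult_assoc\<close>)

text \<open>
  Homomorphisms map radicals into radicals, and \<open>r \<mapsto> r x\<close> is a homomorphism from the regular
  module to \<open>M\<close>.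
\<close>

lemma (in left_module) jacobson_radical_smult:
  assumes "j \<in> jacobson_radical R" "x \<in> carrier M"
  shows "j \<odot>\<^bsub>M\<^esub> x \<in> Rad R M"
  using left_module_morphism.hom_Rad[OF cyclic_morphism[OF assms(2)] assms(1)] .

context ring
begin

lemma jacobson_radical_submodule: "submodule (jacobson_radical R) R (regular_module R)"
  by (rule left_module.submodule_Rad[OF regular_left_module])

lemma jacobson_radical_carrier: "j \<in> jacobson_radical R \<Longrightarrow> j \<in> carrier R"
  by (simp add: Rad_def)

text \<open>With \<open>M = R\<close> the preceding fact shows that \<open>J\<close> is a two-sided ideal.\<close>

lemma jacobson_radical_right_mult:
  assumes "j \<in> jacobson_radical R" "r \<in> carrier R"
  shows "j \<otimes> r \<in> jacobson_radical R"
  using left_module.jacobson_radical_smult[OF regular_left_module assms(1), of r] assms(2) by simp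

lemma principal_submodule:
  assumes "a \<in> carrier R"
  shows "submodule ((\<lambda>r. r \<otimes> a) ` carrier R) R (regular_module R)"
proof -
  interpret left_module_morphism R "regular_module R" "regular_module R" "\<lambda>r. r \<otimes> a"
    using left_module.cyclic_morphism[OF regular_left_module, of a] assms by simp
  show ?thesis using submodule_image[OF M.submodule_carrier] by simp
qed

text \<open>
  Otherwise \<open>R a\<close> lies in a maximal left ideal, which then contains both \<open>r a\<close> and \<open>1 - r a\<close>.
\<close>

lemma left_inverse_if_comaximal_radical:
  assumes a: "a \<in> carrier R" "r \<in> carrier R" and j: "\<one> \<ominus> r \<otimes> a \<in> jacobson_radical R"
  shows "\<exists>u\<in>carrier R. u \<otimes> a = \<one>"
proof (rule ccontr)
  assume not: "\<not> ?thesis"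
  interpret reg: left_module R "regular_module R" by (rule regular_left_module)
  let ?L = "(\<lambda>r. r \<otimes> a) ` carrier R"
  have L: "submodule ?L R (regular_module R)" by (rule principal_submodule[OF a(1)])
  have "\<one> \<notin> ?L"
  proof
    assume "\<one> \<in> ?L"
    then obtain u where "u \<in> carrier R" "u \<otimes> a = \<one>" by (metis imageE)
    then show False using not by blast
  qed
  then have "?L \<noteq> carrier (regular_module R)" by (metis one_closed regular_module_simps(1))
  then obtain N where N: "maximal_submodule R (regular_module R) N" "?L \<subseteq> N"
    using reg.proper_submodule_below_maximal[OF regular_finitely_generated L] by blast
  have Ns: "submodule N R (regular_module R)" using N by (simp add: maximal_submodule_def)
  have "\<one> \<ominus> r \<otimes> a \<in> N" "r \<otimes> a \<in> N" using j N a by (auto simp: Rad_def)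
  then have "(\<one> \<ominus> r \<otimes> a) \<oplus> r \<otimes> a \<in> N" using reg.submodule_add[OF Ns] by simp
  moreover have "(\<one> \<ominus> r \<otimes> a) \<oplus> r \<otimes> a = \<one>" using a by (simp add: minus_eq a_assoc l_neg)
  ultimately show False using regular_eq_carrier[OF Ns] N(1) by (simp add: maximal_submodule_def)
qed

lemma one_minus_jacobson_radical_unit:
  assumes j: "j \<in> jacobson_radical R"
  shows "\<one> \<ominus> j \<in> Units R"
proof -
  interpret reg: left_module R "regular_module R" by (rule regular_left_module)
  have left: "\<exists>u\<in>carrier R. u \<otimes> (\<one> \<ominus> i) = \<one>" if i: "i \<in> jacobson_radical R" for i
  proof (rule left_inverse_if_comaximal_radical[of _ \<one>])
    have ic: "i \<in> carrier R" by (rule jacobson_radical_carrier[OF i])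
    then have "\<one> \<ominus> \<one> \<otimes> (\<one> \<ominus> i) = i" by (simp add: minus_eq minus_add r_neg1 flip: a_assoc) (simp add: r_neg)
    then show "\<one> \<ominus> \<one> \<otimes> (\<one> \<ominus> i) \<in> jacobson_radical R" using i by simp
  qed (use jacobson_radical_carrier[OF i] in auto)
  have jc: "j \<in> carrier R" by (rule jacobson_radical_carrier[OF j])
  obtain u where u: "u \<in> carrier R" "u \<otimes> (\<one> \<ominus> j) = \<one>" using left[OF j] by blast
  \<comment> \<open>The left inverse of \<open>1 - j\<close> is again of the form \<open>1 - i\<close>, so it is left invertible too.\<close>
  have "\<ominus> (u \<otimes> j) \<in> jacobson_radical R"
    using reg.submodule_smult[OF jacobson_radical_submodule u(1) j]
      reg.submodule_neg[OF jacobson_radical_submodule] by simp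
  moreover have "u = \<one> \<ominus> (\<ominus> (u \<otimes> j))"
  proof -
    have "u = (u \<ominus> u \<otimes> j) \<oplus> u \<otimes> j" using u jc by (simp add: minus_eq a_assoc l_neg)
    also have "u \<ominus> u \<otimes> j = \<one>" using u jc by (simp add: minus_eq r_distr r_minus)
    finally show ?thesis using u jc by (simp add: minus_eq)
  qed
  ultimately obtain v where v: "v \<in> carrier R" "v \<otimes> u = \<one>" using left by metis
  have "v = v \<otimes> (u \<otimes> (\<one> \<ominus> j))" using u v by simp
  also have "\<dots> = (v \<otimes> u) \<otimes> (\<one> \<ominus> j)" using u(1) v(1) jc by (intro m_assoc[symmetric]) auto
  also have "\<dots> = \<one> \<ominus> j" using v jc by simp
  finally show ?thesis using u v jc by (auto simp: Units_def)
qed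

text \<open>
  If a maximal left ideal \<open>N\<close> misses \<open>x\<close>, then \<open>N + R x = R\<close> yields some \<open>1 - r x \<in> N\<close>, but \<open>N\<close>
  contains no unit.
\<close>

lemma jacobson_radicalI:
  assumes x: "x \<in> carrier R" and units: "\<And>r. r \<in> carrier R \<Longrightarrow> \<one> \<ominus> r \<otimes> x \<in> Units R"
  shows "x \<in> jacobson_radical R"
proof -
  interpret reg: left_module R "regular_module R" by (rule regular_left_module)
  have "x \<in> N" if N: "maximal_submodule R (regular_module R) N" for N
  proof (rule ccontr)
    assume "x \<notin> N"
    let ?L = "(\<lambda>r. r \<otimes> x) ` carrier R"
    have L: "submodule ?L R (regular_module R)" by (rule principal_submodule[OF x])
    have Ns: "submodule N R (regular_module R)" "N \<noteq> carrier R" using N by (auto simp: maximal_submodule_def)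
    have "\<one> \<otimes> x \<in> ?L" by blast
    then have "x \<in> ?L" using x by simp
    then have "N <+>\<^bsub>regular_module R\<^esub> ?L \<noteq> N"
      using \<open>x \<notin> N\<close> reg.sum_upper2[OF Ns(1) L] by blast
    then have "N <+>\<^bsub>regular_module R\<^esub> ?L = carrier R"
      using N reg.submodule_sum[OF Ns(1) L] reg.sum_upper1[OF Ns(1) L]
      unfolding maximal_submodule_def by (metis regular_module_simps(1))
    then have "\<one> \<in> N <+>\<^bsub>regular_module R\<^esub> ?L" by simp
    then obtain n r where nr: "n \<in> N" "r \<in> carrier R" "\<one> = n \<oplus> r \<otimes> x"
      by (auto elim!: reg.sum_memE)
    have "n \<in> carrier R" using reg.submodule_mem[OF Ns(1) nr(1)] by simp
    then have "\<one> \<ominus> r \<otimes> x = n" using nr x by (simp add: minus_eq a_assoc r_neg)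
    then have "n \<in> Units R" using units[OF nr(2)] by simp
    then have "inv n \<otimes> n \<in> N" using reg.submodule_smult[OF Ns(1) _ nr(1), of "inv n"] by simp
    then show False using regular_eq_carrier[OF Ns(1)] Ns(2) \<open>n \<in> Units R\<close> by simp
  qed
  then show ?thesis using x by (simp add: Rad_def)
qed

end

section \<open>Modules over a semilocal ring\<close>

context left_module
begin

text \<open>
  The zero submodule of a simple module is maximal, so the radical of that module is zero.
\<close>

lemma jacobson_radical_kills_simple:
  assumes S: "simple_submodule R M S" and j: "j \<in> jacobson_radical R" and x: "x \<in> S"
  shows "j \<odot>\<^bsub>M\<^esub> x = \<zero>\<^bsub>M\<^esub>"
proof -
  have Ss: "submodule S R M" using S by (simp add: simple_submodule_def)
  interpret S: left_module R "M\<lparr>carrier := S\<rparr>" by (rule submodule_as_module[OF Ss])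
  have "maximal_submodule R (M\<lparr>carrier := S\<rparr>) {\<zero>\<^bsub>M\<^esub>}"
    using S submodule_zero[OF Ss] submodule_zero_set
    unfolding maximal_submodule_def simple_submodule_def by (auto simp: submodule_of_submodule_iff[OF Ss])
  then show ?thesis using S.jacobson_radical_smult[OF j, of x] x by (auto simp: Rad_def)
qed

text \<open>As \<open>J\<close> is a two-sided ideal, the elements killed by \<open>J\<close> form a submodule.\<close>

lemma jacobson_radical_kills_semisimple:
  assumes "semisimple_module R M" and j: "j \<in> jacobson_radical R" and x: "x \<in> carrier M"
  shows "j \<odot>\<^bsub>M\<^esub> x = \<zero>\<^bsub>M\<^esub>"
proof -
  let ?K = "{x \<in> carrier M. \<forall>j\<in>jacobson_radical R. j \<odot>\<^bsub>M\<^esub> x = \<zero>\<^bsub>M\<^esub>}"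
  have sub: "submodule ?K R M"
    by (rule submoduleI)
      (auto simp: R.jacobson_radical_carrier smult_zero_right smult_r_distr smult_closed
        R.jacobson_radical_right_mult simp flip: smult_assoc)
  have le: "\<Union>{S. simple_submodule R M S} \<subseteq> ?K"
    using jacobson_radical_kills_simple simple_submodules_in_carrier by blast
  have "carrier M \<subseteq> ?K"
    using generated_least[OF sub le] assms(1) unfolding semisimple_module_def by simp
  then show ?thesis using j x by blast
qed

text \<open>
  Every cyclic submodule \<open>R x\<close> is an image of the semisimple module \<open>R/J\<close>, so \<open>x\<close> lies in the
  socle.
\<close>

lemma semisimple_if_jacobson_radical_kills:
  assumes semilocal: "semilocal_ring R"
    and kills: "\<And>j x. \<lbrakk>j \<in> jacobson_radical R; x \<in> carrier M\<rbrakk> \<Longrightarrow> j \<odot>\<^bsub>M\<^esub> x = \<zero>\<^bsub>M\<^esub>"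
  shows "semisimple_module R M"
proof -
  let ?soc = "submodule_generated R M (\<Union>{S. simple_submodule R M S})"
  have soc: "submodule ?soc R M" by (rule generated_submodule[OF simple_submodules_in_carrier])
  have "x \<in> ?soc" if x: "x \<in> carrier M" for x
  proof -
    interpret c: left_module_morphism R "regular_module R" M "\<lambda>r. r \<odot>\<^bsub>M\<^esub> x"
      by (rule cyclic_morphism[OF x])
    let ?C = "(\<lambda>r. r \<odot>\<^bsub>M\<^esub> x) ` carrier R"
    have C: "submodule ?C R M" using c.submodule_image[OF c.M.submodule_carrier] by simp
    interpret e: left_module_epi R "regular_module R" "M\<lparr>carrier := ?C\<rparr>" "\<lambda>r. r \<odot>\<^bsub>M\<^esub> x"
      using c.epi_image by simp
    have "jacobson_radical R \<subseteq> e.preimage {\<zero>\<^bsub>M\<^esub>}"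
      using kills[OF _ x] R.jacobson_radical_carrier by (auto simp: e.preimage_def)
    then have ss: "semisimple_module R (M\<lparr>carrier := ?C\<rparr>)"
      using semilocal complemented_modulo_mono
      by (auto simp: e.semisimple_iff_complemented_modulo_kernel semilocal_ring_def
          c.M.semilocal_iff_complemented_modulo_Rad)
    have "S \<subseteq> ?soc \<inter> ?C" if S: "simple_submodule R (M\<lparr>carrier := ?C\<rparr>) S" for S
    proof -
      have "simple_submodule R M S"
        using S unfolding simple_submodule_def submodule_of_submodule_iff[OF C] by simp blast
      then show ?thesis
        using S generated_upper[of "\<Union>{S. simple_submodule R M S}"]
        unfolding simple_submodule_def submodule_of_submodule_iff[OF C] by blast
    qed
    then have "submodule_generated R (M\<lparr>carrier := ?C\<rparr>) (\<Union>{S. simple_submodule R (M\<lparr>carrier := ?C\<rparr>) S}) \<subseteq> ?soc \<inter> ?C"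
      using submodule_Int[OF soc C] by (intro e.P.generated_least) (auto simp: submodule_of_submodule_iff[OF C])
    then have "?C \<subseteq> ?soc" using ss by (simp add: semisimple_module_def)
    moreover have "\<one> \<odot>\<^bsub>M\<^esub> x \<in> ?C" by blast
    ultimately show ?thesis using x smult_one by auto
  qed
  then show ?thesis using submodule_subset[OF soc] unfolding semisimple_module_def by blast
qed

text \<open>The quotient \<open>M/Rad M\<close> is killed by \<open>J\<close>.\<close>

theorem semilocal_over_semilocal_ring:
  assumes "semilocal_ring R"
  shows "semilocal_module R M"
  unfolding semilocal_module_def
proof -
  interpret e: left_module_epi R M "quotient_module M (Rad R M)" "\<lambda>x. Rad R M +>\<^bsub>M\<^esub> x"
    by (rule quotient_epi[OF submodule_Rad])
  show "semisimple_module R (quotient_module M (Rad R M))"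
  proof (rule e.P.semisimple_if_jacobson_radical_kills[OF assms])
    fix j y assume j: "j \<in> jacobson_radical R" and y: "y \<in> carrier (quotient_module M (Rad R M))"
    obtain x where x: "x \<in> carrier M" "Rad R M +>\<^bsub>M\<^esub> x = y" by (rule e.lift[OF y])
    have "j \<odot>\<^bsub>M\<^esub> x \<in> e.preimage {\<zero>\<^bsub>quotient_module M (Rad R M)\<^esub>}"
      using jacobson_radical_smult[OF j x(1)] by (simp add: quotient_kernel[OF submodule_Rad])
    then have "Rad R M +>\<^bsub>M\<^esub> (j \<odot>\<^bsub>M\<^esub> x) = \<zero>\<^bsub>quotient_module M (Rad R M)\<^esub>"
      by (simp add: e.preimage_def)
    then show "j \<odot>\<^bsub>quotient_module M (Rad R M)\<^esub> y = \<zero>\<^bsub>quotient_module M (Rad R M)\<^esub>"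
      using e.hom_smult[OF R.jacobson_radical_carrier[OF j] x(1)] x(2) by simp
  qed
qed

lemma Rad_submodule_subset_Rad:
  assumes T: "submodule T R M"
  shows "Rad R (M\<lparr>carrier := T\<rparr>) \<subseteq> Rad R M"
proof -
  interpret i: left_module_morphism R "M\<lparr>carrier := T\<rparr>" M "\<lambda>x. x"
    by (rule left_module_morphismI[OF submodule_as_module[OF T] left_module_axioms])
      (use submodule_subset[OF T] in \<open>auto simp: left_module_hom_def\<close>)
  show ?thesis using i.hom_Rad by blast
qed

text \<open>If \<open>N\<close> is maximal in \<open>T\<close>, then \<open>S + N\<close> is maximal in \<open>M\<close> and meets \<open>T\<close> in \<open>N\<close>.\<close>

lemma Rad_subset_Rad_of_summand:
  assumes S: "submodule S R M" and T: "submodule T R M"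
    and full: "S <+>\<^bsub>M\<^esub> T = carrier M" and int: "S \<inter> T = {\<zero>\<^bsub>M\<^esub>}"
    and le: "Rad R M \<subseteq> T"
  shows "Rad R M \<subseteq> Rad R (M\<lparr>carrier := T\<rparr>)"
proof -
  have "Rad R M \<subseteq> N" if N: "maximal_submodule R (M\<lparr>carrier := T\<rparr>) N" for N
  proof -
    have Ns: "submodule N R M" "N \<subseteq> T" "N \<noteq> T"
      using N by (auto simp: maximal_submodule_def submodule_of_submodule_iff[OF T])
    have SN: "submodule (S <+>\<^bsub>M\<^esub> N) R M" by (rule submodule_sum[OF S Ns(1)])
    have meet: "(S <+>\<^bsub>M\<^esub> N) \<inter> T \<subseteq> N"
      using modular_law[OF Ns(1) S T Ns(2)] int sum_absorb(2)[OF submodule_zero_set Ns(1)]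
        submodule_zero[OF Ns(1)] sum_commute[OF submodule_subset[OF S] submodule_subset[OF Ns(1)]] by simp
    have "maximal_submodule R M (S <+>\<^bsub>M\<^esub> N)"
      unfolding maximal_submodule_def
    proof (intro conjI allI impI)
      show "S <+>\<^bsub>M\<^esub> N \<noteq> carrier M" using meet Ns submodule_subset[OF T] by auto
      fix L assume L: "submodule L R M \<and> S <+>\<^bsub>M\<^esub> N \<subseteq> L"
      then have up: "S \<subseteq> L" "N \<subseteq> L" using sum_upper1[OF S Ns(1)] sum_upper2[OF S Ns(1)] by blast+
      have "L \<inter> T = N \<or> L \<inter> T = T"
        using N up Ns(2) submodule_Int[of L T] L T
        unfolding maximal_submodule_def submodule_of_submodule_iff[OF T] by simp
      then show "L = S <+>\<^bsub>M\<^esub> N \<or> L = carrier M"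
      proof
        assume "L \<inter> T = N"
        then have "L \<subseteq> S <+>\<^bsub>M\<^esub> N"
          using modular_law[of S T L] S T L up full submodule_subset[of L] by (auto simp: Int_commute)
        then show ?thesis using L by blast
      next
        assume "L \<inter> T = T"
        then show ?thesis using sum_full_mono[OF full _ up(1)] L by blast
      qed
    qed (rule SN)
    then have "Rad R M \<subseteq> S <+>\<^bsub>M\<^esub> N" by (auto simp: Rad_def)
    then show ?thesis using meet le by blast
  qed
  then show ?thesis using le by (auto simp: Rad_def)
qed

text \<open>
  Let \<open>S\<close> be maximal with \<open>S \<inter> Rad M = 0\<close>. It embeds in the semisimple module \<open>M/Rad M\<close>, so it is
  semisimple, and a complement of its image there pulls back to a complement \<open>T\<close> of \<open>S\<close> that
  contains \<open>Rad M\<close>. By the choice of \<open>S\<close>, a nonzero submodule of \<open>T\<close> cannot avoid \<open>Rad M\<close>.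
\<close>

theorem decomposition_over_semilocal_ring:
  assumes semilocal: "semilocal_ring R"
  shows "\<exists>S T. submodule S R M \<and> submodule T R M \<and>
    S <+>\<^bsub>M\<^esub> T = carrier M \<and> S \<inter> T = {\<zero>\<^bsub>M\<^esub>} \<and>
    semisimple_module R (M\<lparr>carrier := S\<rparr>) \<and>
    semilocal_module R (M\<lparr>carrier := T\<rparr>) \<and>
    has_essential_radical R (M\<lparr>carrier := T\<rparr>)"
proof -
  let ?J = "Rad R M"
  have comp: "complemented_modulo R M (carrier M) ?J"
    using semilocal_over_semilocal_ring[OF semilocal] semilocal_iff_complemented_modulo_Rad by simp
  obtain S where S: "submodule S R M" "S \<inter> (?J - {\<zero>\<^bsub>M\<^esub>}) = {}"
    and max: "\<forall>L. submodule L R M \<and> S \<subseteq> L \<and> L \<inter> (?J - {\<zero>\<^bsub>M\<^esub>}) = {} \<longrightarrow> L = S"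
    using exists_maximal_avoiding[OF submodule_zero_set, of "?J - {\<zero>\<^bsub>M\<^esub>}"] by auto
  have SJ: "submodule (S <+>\<^bsub>M\<^esub> ?J) R M" by (rule submodule_sum[OF S(1) submodule_Rad])
  obtain T' where T': "submodule T' R M" "(S <+>\<^bsub>M\<^esub> ?J) <+>\<^bsub>M\<^esub> T' = carrier M"
    "(S <+>\<^bsub>M\<^esub> ?J) \<inter> T' \<subseteq> ?J"
    by (rule complement_exists[OF comp SJ submodule_subset[OF SJ]])
  let ?T = "?J <+>\<^bsub>M\<^esub> T'"
  have T: "submodule ?T R M" by (rule submodule_sum[OF submodule_Rad T'(1)])
  have J_T: "?J \<subseteq> ?T" "T' \<subseteq> ?T"
    using sum_upper1[OF submodule_Rad T'(1)] sum_upper2[OF submodule_Rad T'(1)] by auto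
  have ST: "submodule (S <+>\<^bsub>M\<^esub> ?T) R M" by (rule submodule_sum[OF S(1) T])
  have up: "S \<subseteq> S <+>\<^bsub>M\<^esub> ?T" "?T \<subseteq> S <+>\<^bsub>M\<^esub> ?T" using sum_upper1[OF S(1) T] sum_upper2[OF S(1) T] by auto
  have full: "S <+>\<^bsub>M\<^esub> ?T = carrier M"
    using up J_T by (intro sum_full_mono[OF T'(2) ST] sum_least[OF ST]) auto
  have "?T \<inter> (S <+>\<^bsub>M\<^esub> ?J) \<subseteq> ?J <+>\<^bsub>M\<^esub> (T' \<inter> (S <+>\<^bsub>M\<^esub> ?J))"
    by (rule modular_law[OF submodule_Rad T'(1) SJ sum_upper2[OF S(1) submodule_Rad]])
  also have "\<dots> \<subseteq> ?J" using T'(3) by (intro sum_least[OF submodule_Rad]) auto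
  finally have "S \<inter> ?T \<subseteq> ?J" using sum_upper1[OF S(1) submodule_Rad] by blast
  then have int: "S \<inter> ?T = {\<zero>\<^bsub>M\<^esub>}" using S submodule_zero[OF S(1)] submodule_zero[OF T] by blast
  have "complemented_modulo R M S {\<zero>\<^bsub>M\<^esub>}"
    unfolding complemented_modulo_def
  proof (intro allI impI)
    fix L assume L: "submodule L R M \<and> L \<subseteq> S"
    obtain K where "submodule K R M" "K \<subseteq> S" "L <+>\<^bsub>M\<^esub> K = S" "L \<inter> K \<subseteq> ?J"
      using complement_exists[OF complemented_modulo_hereditary[OF comp S(1) submodule_subset[OF S(1)]], of L] L
      by blast
    then show "\<exists>K. submodule K R M \<and> K \<subseteq> S \<and> L <+>\<^bsub>M\<^esub> K = S \<and> L \<inter> K \<subseteq> {\<zero>\<^bsub>M\<^esub>}"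
      using S(2) by (intro exI[of _ K]) blast
  qed
  then have ss: "semisimple_module R (M\<lparr>carrier := S\<rparr>)" by (simp add: semisimple_submodule_iff[OF S(1)])
  interpret T: left_module R "M\<lparr>carrier := ?T\<rparr>" by (rule submodule_as_module[OF T])
  have rad: "?J \<subseteq> Rad R (M\<lparr>carrier := ?T\<rparr>)"
    by (rule Rad_subset_Rad_of_summand[OF S(1) T full int J_T(1)])
  have "has_essential_radical R (M\<lparr>carrier := ?T\<rparr>)"
    unfolding has_essential_radical_def essential_submodule_def
  proof (intro conjI allI impI)
    fix L assume "submodule L R (M\<lparr>carrier := ?T\<rparr>) \<and> L \<noteq> {\<zero>\<^bsub>M\<lparr>carrier := ?T\<rparr>\<^esub>}"
    then have L: "submodule L R M" "L \<subseteq> ?T" "L \<noteq> {\<zero>\<^bsub>M\<^esub>}"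
      by (auto simp: submodule_of_submodule_iff[OF T])
    have "Rad R (M\<lparr>carrier := ?T\<rparr>) \<inter> L \<noteq> {\<zero>\<^bsub>M\<^esub>}"
    proof
      assume zero: "Rad R (M\<lparr>carrier := ?T\<rparr>) \<inter> L = {\<zero>\<^bsub>M\<^esub>}"
      have "x = \<zero>\<^bsub>M\<^esub>" if x: "x \<in> S <+>\<^bsub>M\<^esub> L" "x \<in> ?J" for x
      proof -
        obtain s l where sl: "s \<in> S" "l \<in> L" "x = s \<oplus>\<^bsub>M\<^esub> l" using x(1) by (rule sum_memE)
        have c: "s \<in> carrier M" "l \<in> carrier M" using sl S L submodule_mem by blast+
        have "x \<ominus>\<^bsub>M\<^esub> l \<in> ?T" using x(2) J_T(1) L(2) sl(2) submodule_minus[OF T] by blast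
        moreover have "x \<ominus>\<^bsub>M\<^esub> l = s" using sl(3) c by (simp add: M.minus_eq M.a_assoc M.r_neg)
        ultimately have "s = \<zero>\<^bsub>M\<^esub>" using int sl(1) by blast
        then have "x = l" using sl(3) c by simp
        then show ?thesis using x(2) rad sl(2) zero by blast
      qed
      then have "S <+>\<^bsub>M\<^esub> L = S"
        using max submodule_sum[OF S(1) L(1)] sum_upper1[OF S(1) L(1)] by blast
      then have "L \<subseteq> S \<inter> ?T" using sum_upper2[OF S(1) L(1)] L(2) by blast
      then show False using int L(3) submodule_zero[OF L(1)] by blast
    qed
    then show "Rad R (M\<lparr>carrier := ?T\<rparr>) \<inter> L \<noteq> {\<zero>\<^bsub>M\<lparr>carrier := ?T\<rparr>\<^esub>}" by simp
  qed (rule T.submodule_Rad)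
  then show ?thesis
    using S(1) T full int ss T.semilocal_over_semilocal_ring[OF semilocal] by blast
qed

lemma semilocal_if_decomposition:
  assumes S: "submodule S R M" and T: "submodule T R M"
    and full: "S <+>\<^bsub>M\<^esub> T = carrier M"
    and ss: "semisimple_module R (M\<lparr>carrier := S\<rparr>)"
    and sl: "semilocal_module R (M\<lparr>carrier := T\<rparr>)"
  shows "semilocal_module R M"
proof -
  have "complemented_modulo R M T (Rad R (M\<lparr>carrier := T\<rparr>))"
    using sl left_module.semilocal_iff_complemented_modulo_Rad[OF submodule_as_module[OF T]]
      complemented_in_submodule[OF T subset_refl] by simp
  then have "complemented_modulo R M T (Rad R M)"
    by (rule complemented_modulo_mono[OF _ Rad_submodule_subset_Rad[OF T]])
  moreover have "complemented_modulo R M S (Rad R M)"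
    using submodule_zero[OF submodule_Rad]
    by (intro complemented_modulo_mono[OF iffD1[OF semisimple_submodule_iff[OF S] ss]]) simp
  ultimately show ?thesis
    using complemented_modulo_sum[OF S _ T _ submodule_Rad full] semilocal_iff_complemented_modulo_Rad by blast
qed

lemma weakly_supplemented_if_semilocal:
  assumes "semilocal_module R M" "has_small_radical R M"
  shows "weakly_supplemented R M"
  unfolding weakly_supplemented_def weak_supplement_def
proof (intro allI impI)
  fix N assume N: "submodule N R M"
  have comp: "complemented_modulo R M (carrier M) (Rad R M)"
    using assms(1) semilocal_iff_complemented_modulo_Rad by simp
  obtain L where L: "submodule L R M" "N <+>\<^bsub>M\<^esub> L = carrier M" "N \<inter> L \<subseteq> Rad R M"
    by (rule complement_exists[OF comp N submodule_subset[OF N]])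
  then show "\<exists>L. submodule L R M \<and> N <+>\<^bsub>M\<^esub> L = carrier M \<and> small_submodule R M (N \<inter> L)"
    using small_submodule_mono[OF _ submodule_Int[OF N L(1)]] assms(2) unfolding has_small_radical_def by blast
qed

text \<open>
  Small submodules lie in the radical, so a weak supplement is a complement modulo the radical.
\<close>

lemma semilocal_if_weakly_supplemented:
  assumes "weakly_supplemented R M"
  shows "semilocal_module R M"
  unfolding semilocal_iff_complemented_modulo_Rad complemented_modulo_def
proof (intro allI impI)
  fix N assume "submodule N R M \<and> N \<subseteq> carrier M"
  then obtain L where L: "weak_supplement R M N L"
    using assms unfolding weakly_supplemented_def by blast
  then have "N \<inter> L \<subseteq> Rad R M" using small_submodule_subset_Rad unfolding weak_supplement_def by blast
  then show "\<exists>L. submodule L R M \<and> L \<subseteq> carrier M \<and> N <+>\<^bsub>M\<^esub> L = carrier M \<and> N \<inter> L \<subseteq> Rad R M"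
    using L submodule_subset unfolding weak_supplement_def by blast
qed

lemma complemented_modulo_Int_maximal:
  assumes A: "complemented_modulo R M (carrier M) A" and N: "maximal_submodule R M N"
  shows "complemented_modulo R M (carrier M) (A \<inter> N)"
  unfolding complemented_modulo_def
proof (intro allI impI)
  fix L assume L': "submodule L R M \<and> L \<subseteq> carrier M"
  then have L: "submodule L R M" by simp
  have Ns: "submodule N R M" using N by (simp add: maximal_submodule_def)
  obtain K where K: "submodule K R M" "L <+>\<^bsub>M\<^esub> K = carrier M" "L \<inter> K \<subseteq> A"
    by (rule complement_exists[OF A L submodule_subset[OF L]])
  show "\<exists>K. submodule K R M \<and> K \<subseteq> carrier M \<and> L <+>\<^bsub>M\<^esub> K = carrier M \<and> L \<inter> K \<subseteq> A \<inter> N"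
  proof (cases "L \<inter> K \<subseteq> N")
    case True
    then show ?thesis using K submodule_subset by blast
  next
    case False
    \<comment> \<open>Now \<open>L \<inter> K\<close> supplies what is lost when \<open>K\<close> is cut down to \<open>K \<inter> N\<close>.\<close>
    have LK: "submodule (L \<inter> K) R M" and KN: "submodule (K \<inter> N) R M"
      using submodule_Int L K(1) Ns by blast+
    have "(L \<inter> K) <+>\<^bsub>M\<^esub> N \<noteq> N" using False sum_upper1[OF LK Ns] by blast
    then have "(L \<inter> K) <+>\<^bsub>M\<^esub> N = carrier M"
      using N submodule_sum[OF LK Ns] sum_upper2[OF LK Ns] unfolding maximal_submodule_def by blast
    then have "K \<subseteq> (L \<inter> K) <+>\<^bsub>M\<^esub> (N \<inter> K)"
      using modular_law[OF LK Ns K(1)] submodule_subset[OF K(1)] by auto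
    also have "\<dots> \<subseteq> L <+>\<^bsub>M\<^esub> (K \<inter> N)" by (rule sum_mono) auto
    finally have "L <+>\<^bsub>M\<^esub> (K \<inter> N) = carrier M"
      using sum_upper1[OF L KN] by (intro sum_full_mono[OF K(2) submodule_sum[OF L KN]])
    then show ?thesis using K KN submodule_subset[OF KN] by (intro exI[of _ "K \<inter> N"]) auto
  qed
qed

lemma complemented_modulo_carrier: "complemented_modulo R M (carrier M) (carrier M)"
  unfolding complemented_modulo_def using submodule_carrier sum_absorb(1) by blast

end

text \<open>\<open>J\<close> kills every semisimple factor, hence the product.\<close>

theorem semisimple_product_over_semilocal_ring:
  assumes R: "ring R" "semilocal_ring R"
    and M: "\<And>i. i \<in> I \<Longrightarrow> left_module R (M i) \<and> semisimple_module R (M i)"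
  shows "semisimple_module R (product_module I M)"
proof (rule left_module.semisimple_if_jacobson_radical_kills[OF product_left_module[OF R(1)] R(2)])
  fix j x assume j: "j \<in> jacobson_radical R" and x: "x \<in> carrier (product_module I M)"
  have "j \<odot>\<^bsub>M i\<^esub> x i = \<zero>\<^bsub>M i\<^esub>" if "i \<in> I" for i
    using left_module.jacobson_radical_kills_semisimple[of R "M i" j "x i"] M[OF that] j x that
    by (auto simp: product_module_def)
  then show "j \<odot>\<^bsub>product_module I M\<^esub> x = \<zero>\<^bsub>product_module I M\<^esub>"
    by (auto simp: product_module_def)
qed (use M in blast)

text \<open>
  The product of the simple modules \<open>R/N\<close>, where \<open>N\<close> runs through the maximal left ideals,
  contains the image of \<open>R\<close> under the diagonal map, and the kernel of that map is \<open>J\<close>. The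
  injection \<open>f\<close> moves both the maximal left ideals, as indices, and the cosets in \<open>R/N\<close> to the
  universe type.
\<close>

lemma semilocal_if_semisimple_products:
  assumes R: "ring (R :: ('a, 'r) ring_scheme)" and inj: "inj (f :: 'a set \<Rightarrow> 'u)"
    and prod: "products_of_semisimple_semisimple R TYPE('u) TYPE('u)"
  shows "semilocal_ring R"
proof -
  interpret R: ring R by (rule R)
  let ?reg = "regular_module R"
  interpret reg: left_module R ?reg by (rule R.regular_left_module)
  let ?I = "f ` {N. maximal_submodule R ?reg N}"
  define N where "N = (\<lambda>i. inv_into UNIV f i)"
  define M where "M = (\<lambda>i. transport_module f (quotient_module ?reg (N i)))"
  define g where "g = (\<lambda>i r. f (N i +>\<^bsub>?reg\<^esub> r))"
  have max: "maximal_submodule R ?reg (N i)" if "i \<in> ?I" for i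
    using that inv_f_f[OF inj] by (auto simp: N_def)
  have epi: "left_module_epi R ?reg (M i) (g i)"
    and ker: "left_module_morphism.preimage ?reg (g i) {\<zero>\<^bsub>M i\<^esub>} = N i" if i: "i \<in> ?I" for i
  proof -
    have Ns: "submodule (N i) R ?reg" using max[OF i] by (simp add: maximal_submodule_def)
    interpret q: left_module_epi R ?reg "quotient_module ?reg (N i)" "\<lambda>r. N i +>\<^bsub>?reg\<^esub> r"
      by (rule reg.quotient_epi[OF Ns])
    interpret t: left_module_epi R "quotient_module ?reg (N i)" "M i" f
      unfolding M_def by (rule q.P.transport_epi[OF inj])
    show e: "left_module_epi R ?reg (M i) (g i)"
      by (rule left_module_epiI[OF reg.left_module_axioms t.P.left_module_axioms])
        (use q.hom t.hom in \<open>auto simp: left_module_hom_def g_def Pi_iff image_image simp flip: t.surj q.surj\<close>)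
    have "left_module_morphism.preimage ?reg (g i) {\<zero>\<^bsub>M i\<^esub>} = q.preimage (t.preimage {\<zero>\<^bsub>M i\<^esub>})"
      using q.hom_closed left_module_morphism.preimage_def[OF left_module_epi.axioms(1)[OF e]]
      by (auto simp: q.preimage_def t.preimage_def g_def)
    also have "t.preimage {\<zero>\<^bsub>M i\<^esub>} = {\<zero>\<^bsub>quotient_module ?reg (N i)\<^esub>}"
      unfolding M_def by (rule q.P.transport_kernel[OF inj])
    finally show "left_module_morphism.preimage ?reg (g i) {\<zero>\<^bsub>M i\<^esub>} = N i"
      by (simp add: reg.quotient_kernel[OF Ns])
  qed
  have ss: "semisimple_module R (M i)" if i: "i \<in> ?I" for i
    unfolding left_module_epi.semisimple_iff_complemented_modulo_kernel[OF epi[OF i]] ker[OF i]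
    using reg.complemented_modulo_Int_maximal[OF reg.complemented_modulo_carrier max[OF i]]
    by (rule complemented_modulo_mono) simp
  have mods: "left_module R (M i)" if "i \<in> ?I" for i
    using left_module_epi.axioms(1)[OF epi[OF that]] by (simp add: left_module_morphism_def)
  interpret P: left_module R "product_module ?I M" by (rule product_left_module[OF R mods])
  have P_ss: "semisimple_module R (product_module ?I M)"
    using prod mods ss unfolding products_of_semisimple_semisimple_def by blast
  let ?g = "\<lambda>r. \<lambda>i\<in>?I. g i r"
  interpret h: left_module_morphism R ?reg "product_module ?I M" ?g
  proof (rule left_module_morphismI[OF reg.left_module_axioms P.left_module_axioms hom_to_product])
    show "g i \<in> left_module_hom R ?reg (M i)" if "i \<in> ?I" for i
      using left_module_epi.axioms(1)[OF epi[OF that]]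
      by (simp add: left_module_morphism_def left_module_morphism_axioms_def)
  qed
  let ?Q = "product_module ?I M\<lparr>carrier := ?g ` carrier ?reg\<rparr>"
  interpret e: left_module_epi R ?reg ?Q ?g by (rule h.epi_image)
  have img: "submodule (?g ` carrier ?reg) R (product_module ?I M)"
    by (rule h.submodule_image[OF reg.submodule_carrier])
  have "semisimple_module R ?Q"
    unfolding P.semisimple_submodule_iff[OF img]
    using P_ss P.complemented_modulo_hereditary[OF _ img P.submodule_subset[OF img]]
    by (simp add: P.semisimple_iff_complemented)
  then have "complemented_modulo R ?reg (carrier ?reg) (e.preimage {\<zero>\<^bsub>?Q\<^esub>})"
    by (simp only: e.semisimple_iff_complemented_modulo_kernel)
  moreover have "e.preimage {\<zero>\<^bsub>?Q\<^esub>} \<subseteq> Rad R ?reg"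
  proof
    fix r assume r: "r \<in> e.preimage {\<zero>\<^bsub>?Q\<^esub>}"
    have "r \<in> L" if L: "maximal_submodule R ?reg L" for L
    proof -
      have i: "f L \<in> ?I" "N (f L) = L" using L inv_f_f[OF inj] by (auto simp: N_def)
      have "?g r = (\<lambda>i\<in>?I. \<zero>\<^bsub>M i\<^esub>)" using r by (simp add: e.preimage_def product_module_def)
      then have "?g r (f L) = (\<lambda>i\<in>?I. \<zero>\<^bsub>M i\<^esub>) (f L)" by (rule fun_cong)
      then have "g (f L) r = \<zero>\<^bsub>M (f L)\<^esub>" using i(1) by (simp only: restrict_apply')
      then have "r \<in> left_module_morphism.preimage ?reg (g (f L)) {\<zero>\<^bsub>M (f L)\<^esub>}"
        using r left_module_morphism.preimage_def[OF left_module_epi.axioms(1)[OF epi[OF i(1)]]]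
        by (simp add: e.preimage_def)
      then show ?thesis by (simp add: ker[OF i(1)] i(2))
    qed
    then show "r \<in> Rad R ?reg" using r by (auto simp: Rad_def e.preimage_def)
  qed
  ultimately show ?thesis
    unfolding semilocal_ring_def reg.semilocal_iff_complemented_modulo_Rad
    by (rule complemented_modulo_mono)
qed

section \<open>Coindependent families\<close>

context left_module
begin

definition meet :: "'m set list \<Rightarrow> 'm set" where
  "meet Vs = carrier M \<inter> \<Inter>(set Vs)"

text \<open>
  Each member is required to be comaximal only with the meet of its successors, which suits
  induction on the list. The order is immaterial: by \<open>coindependent_remove\<close> every member is
  comaximal with the meet of all others.
\<close>

primrec coindependent :: "'m set list \<Rightarrow> bool" where
  "coindependent [] \<longleftrightarrow> True"
| "coindependent (V # Vs) \<longleftrightarrow> submodule V R M \<and> V \<noteq> carrier M \<and>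
     V <+>\<^bsub>M\<^esub> meet Vs = carrier M \<and> coindependent Vs"

text \<open>This expresses in \<open>M\<close> that \<open>M/U\<close> is hollow.\<close>

definition hollow_over :: "'m set \<Rightarrow> bool" where
  "hollow_over U \<longleftrightarrow> submodule U R M \<and> U \<noteq> carrier M \<and>
     (\<forall>X Y. submodule X R M \<and> submodule Y R M \<and> U \<subseteq> X \<and> U \<subseteq> Y \<and> X <+>\<^bsub>M\<^esub> Y = carrier M
        \<longrightarrow> X = carrier M \<or> Y = carrier M)"

lemma meet_Nil [simp]: "meet [] = carrier M" by (simp add: meet_def)

lemma meet_Cons [simp]: "meet (V # Vs) = V \<inter> meet Vs" by (auto simp: meet_def)

lemma meet_append [simp]: "meet (Us @ Vs) = meet Us \<inter> meet Vs" by (auto simp: meet_def)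

lemma submodule_meet: "(\<And>V. V \<in> set Vs \<Longrightarrow> submodule V R M) \<Longrightarrow> submodule (meet Vs) R M"
  unfolding meet_def by (rule submodule_Inter) auto

lemma coindependent_proper:
  "\<lbrakk>coindependent Vs; V \<in> set Vs\<rbrakk> \<Longrightarrow> submodule V R M \<and> V \<noteq> carrier M"
  by (induction Vs) auto

lemma coindependent_meet: "coindependent Vs \<Longrightarrow> submodule (meet Vs) R M"
  using coindependent_proper submodule_meet by blast

lemma hollow_over_maximal:
  assumes N: "maximal_submodule R M N"
  shows "hollow_over N"
  using assms unfolding hollow_over_def maximal_submodule_def
  by (metis submodule_carrier sum_absorb(1) order_refl)

lemma maximal_sum_full:
  assumes N: "maximal_submodule R M N" and A: "submodule A R M" "\<not> A \<subseteq> N"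
  shows "N <+>\<^bsub>M\<^esub> A = carrier M"
proof -
  have Ns: "submodule N R M" using N by (simp add: maximal_submodule_def)
  have "N <+>\<^bsub>M\<^esub> A \<noteq> N" using sum_upper2[OF Ns A(1)] A(2) by blast
  then show ?thesis
    using N submodule_sum[OF Ns A(1)] sum_upper1[OF Ns A(1)] unfolding maximal_submodule_def by blast
qed

text \<open>
  By modularity \<open>A = (U \<inter> A) + (V \<inter> A)\<close> for the meet \<open>A\<close> of the other members, so \<open>V + A = M\<close>
  improves to \<open>V + (U \<inter> A) = M\<close>.
\<close>

lemma coindependent_remove:
  "coindependent (Us @ V # Vs) \<Longrightarrow>
    coindependent (Us @ Vs) \<and> V <+>\<^bsub>M\<^esub> meet (Us @ Vs) = carrier M"
proof (induction Us)
  case (Cons U Us)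
  let ?A = "meet (Us @ Vs)"
  have U: "submodule U R M" "U \<noteq> carrier M" "U <+>\<^bsub>M\<^esub> (V \<inter> ?A) = carrier M"
    and rest: "coindependent (Us @ V # Vs)"
    using Cons.prems by (auto simp: Int_ac)
  have IH: "coindependent (Us @ Vs)" "V <+>\<^bsub>M\<^esub> ?A = carrier M" using Cons.IH[OF rest] by auto
  have V: "submodule V R M" using coindependent_proper[OF rest, of V] by simp
  have A: "submodule ?A R M" by (rule coindependent_meet[OF IH(1)])
  have VA: "submodule (V \<inter> ?A) R M" and UA: "submodule (U \<inter> ?A) R M"
    using submodule_Int U(1) V A by blast+
  have S: "submodule (V <+>\<^bsub>M\<^esub> (U \<inter> ?A)) R M" by (rule submodule_sum[OF V UA])
  have "U <+>\<^bsub>M\<^esub> ?A = carrier M"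
    using sum_upper1[OF U(1) A] sum_upper2[OF U(1) A]
    by (intro sum_full_mono[OF U(3) submodule_sum[OF U(1) A]]) blast+
  moreover have "V <+>\<^bsub>M\<^esub> (U \<inter> ?A) = carrier M"
  proof (rule sum_full_mono[OF IH(2) S sum_upper1[OF V UA]])
    have "((V \<inter> ?A) <+>\<^bsub>M\<^esub> U) \<inter> ?A \<subseteq> (V \<inter> ?A) <+>\<^bsub>M\<^esub> (U \<inter> ?A)"
      by (rule modular_law[OF VA U(1) A]) blast
    moreover have "(V \<inter> ?A) <+>\<^bsub>M\<^esub> U = carrier M"
      using U(3) sum_commute[OF submodule_subset[OF U(1)] submodule_subset[OF VA]] by simp
    moreover have "(V \<inter> ?A) <+>\<^bsub>M\<^esub> (U \<inter> ?A) \<subseteq> V <+>\<^bsub>M\<^esub> (U \<inter> ?A)" by (rule sum_mono) auto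
    ultimately show "?A \<subseteq> V <+>\<^bsub>M\<^esub> (U \<inter> ?A)" using submodule_subset[OF A] by blast
  qed
  ultimately show ?case using U IH(1) by simp
qed simp

lemma coindependent_append:
  "\<lbrakk>coindependent Us; coindependent Vs; meet Us <+>\<^bsub>M\<^esub> meet Vs = carrier M\<rbrakk>
    \<Longrightarrow> coindependent (Us @ Vs)"
proof (induction Us)
  case (Cons U Us)
  let ?A = "meet Us" and ?B = "meet Vs"
  have U: "submodule U R M" "U \<noteq> carrier M" "U <+>\<^bsub>M\<^esub> ?A = carrier M" "coindependent Us"
    using Cons.prems by auto
  have A: "submodule ?A R M" and B: "submodule ?B R M"
    using coindependent_meet U(4) Cons.prems(2) by blast+
  have UA: "submodule (U \<inter> ?A) R M" and AB: "submodule (?A \<inter> ?B) R M" and BA: "submodule (?B \<inter> ?A) R M"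
    using submodule_Int U(1) A B by blast+
  have full: "(U \<inter> ?A) <+>\<^bsub>M\<^esub> ?B = carrier M" using Cons.prems(3) by simp
  have "?A <+>\<^bsub>M\<^esub> ?B = carrier M"
    using sum_upper1[OF A B] sum_upper2[OF A B] by (intro sum_full_mono[OF full submodule_sum[OF A B]]) auto
  moreover have "U <+>\<^bsub>M\<^esub> (?A \<inter> ?B) = carrier M"
  proof (rule sum_full_mono[OF U(3) submodule_sum[OF U(1) AB] sum_upper1[OF U(1) AB]])
    have "((U \<inter> ?A) <+>\<^bsub>M\<^esub> ?B) \<inter> ?A \<subseteq> (U \<inter> ?A) <+>\<^bsub>M\<^esub> (?B \<inter> ?A)"
      by (rule modular_law[OF UA B A]) simp
    also have "\<dots> \<subseteq> U <+>\<^bsub>M\<^esub> (?A \<inter> ?B)" by (rule sum_mono) auto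
    finally show "?A \<subseteq> U <+>\<^bsub>M\<^esub> (?A \<inter> ?B)" using full submodule_subset[OF A] by auto
  qed
  ultimately show ?case using Cons U by simp
qed simp

text \<open>
  A submodule whose image in each hollow module \<open>M/U\<close> is proper, hence small, is small modulo the
  meet of all \<open>U\<close>, because finite sums of small submodules are small. The induction splits off
  the first \<open>U\<close>. Modulo the meet, \<open>M\<close> is the direct sum of \<open>U\<close> and the meet \<open>C\<close> of the others;
  \<open>D\<close> and \<open>E\<close> bound the components of \<open>W\<close> in \<open>C\<close> and in \<open>U\<close>. Hollowness of \<open>M/U\<close> removes \<open>D\<close> from
  the sum \<open>D + E + V = M\<close>, and the induction hypothesis removes \<open>E\<close>.
\<close>

lemma full_if_above_hollow_meet:
  assumes "coindependent Us" "\<And>U. U \<in> set Us \<Longrightarrow> hollow_over U"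
    and W: "submodule W R M" and not_full: "\<And>U. U \<in> set Us \<Longrightarrow> U <+>\<^bsub>M\<^esub> W \<noteq> carrier M"
    and "submodule V R M" "W <+>\<^bsub>M\<^esub> V = carrier M" "meet Us \<subseteq> V"
  shows "V = carrier M"
  using assms(1,2) not_full assms(5,6,7)
proof (induction Us arbitrary: V)
  case Nil
  then show ?case using submodule_subset by auto
next
  case (Cons U Us)
  let ?C = "meet Us"
  have U: "submodule U R M" "U <+>\<^bsub>M\<^esub> ?C = carrier M" "coindependent Us" "hollow_over U"
    using Cons.prems(1,2) by auto
  have C: "submodule ?C R M" by (rule coindependent_meet[OF U(3)])
  note V = Cons.prems(4)
  have WU: "submodule (W <+>\<^bsub>M\<^esub> U) R M" and WC: "submodule (W <+>\<^bsub>M\<^esub> ?C) R M"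
    using submodule_sum W U(1) C by blast+
  let ?D = "?C \<inter> (W <+>\<^bsub>M\<^esub> U)" and ?E = "U \<inter> (W <+>\<^bsub>M\<^esub> ?C)"
  have D: "submodule ?D R M" and E: "submodule ?E R M" and VU: "submodule (V \<inter> U) R M"
    using submodule_Int WU WC U(1) C V by blast+
  have EV: "submodule (?E <+>\<^bsub>M\<^esub> V) R M" by (rule submodule_sum[OF E V])
  have D_EV: "submodule (?D <+>\<^bsub>M\<^esub> (?E <+>\<^bsub>M\<^esub> V)) R M" by (rule submodule_sum[OF D EV])
  have up: "?E \<subseteq> ?E <+>\<^bsub>M\<^esub> V" "V \<subseteq> ?E <+>\<^bsub>M\<^esub> V" using sum_upper1[OF E V] sum_upper2[OF E V] by auto
  have up': "?D \<subseteq> ?D <+>\<^bsub>M\<^esub> (?E <+>\<^bsub>M\<^esub> V)" "?E <+>\<^bsub>M\<^esub> V \<subseteq> ?D <+>\<^bsub>M\<^esub> (?E <+>\<^bsub>M\<^esub> V)"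
    using sum_upper1[OF D EV] sum_upper2[OF D EV] by auto
  \<comment> \<open>Both components of an element of \<open>W\<close> along \<open>U + C = M\<close> are controlled by \<open>W\<close>.\<close>
  have "W \<subseteq> ?D <+>\<^bsub>M\<^esub> ?E"
  proof
    fix w assume w: "w \<in> W"
    have wc: "w \<in> carrier M" by (rule submodule_mem[OF W w])
    then have "w \<in> U <+>\<^bsub>M\<^esub> ?C" using U(2) by simp
    then obtain u c where uc: "u \<in> U" "c \<in> ?C" "w = u \<oplus>\<^bsub>M\<^esub> c" by (rule sum_memE)
    have c: "u \<in> carrier M" "c \<in> carrier M" using submodule_mem[OF U(1) uc(1)] submodule_mem[OF C uc(2)] by auto
    have "c = w \<oplus>\<^bsub>M\<^esub> \<ominus>\<^bsub>M\<^esub> u" using c uc(3) M.a_comm[of u c] by (simp add: M.a_assoc M.r_neg)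
    then have "c \<in> W <+>\<^bsub>M\<^esub> U" using sum_memI[OF w submodule_neg[OF U(1) uc(1)]] by simp
    moreover have "u = w \<oplus>\<^bsub>M\<^esub> \<ominus>\<^bsub>M\<^esub> c" using c uc(3) by (simp add: M.a_assoc M.r_neg)
    then have "u \<in> W <+>\<^bsub>M\<^esub> ?C" using sum_memI[OF w submodule_neg[OF C uc(2)]] by simp
    ultimately have "c \<oplus>\<^bsub>M\<^esub> u \<in> ?D <+>\<^bsub>M\<^esub> ?E" using uc by (intro sum_memI) auto
    then show "w \<in> ?D <+>\<^bsub>M\<^esub> ?E" using uc(3) c M.a_comm by simp
  qed
  then have W_le: "W \<subseteq> ?D <+>\<^bsub>M\<^esub> (?E <+>\<^bsub>M\<^esub> V)" using sum_mono[OF subset_refl up(1)] by blast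
  have full1: "?D <+>\<^bsub>M\<^esub> (?E <+>\<^bsub>M\<^esub> V) = carrier M"
    using up up' by (intro sum_full_mono[OF Cons.prems(5) D_EV W_le]) auto
  have EV_C: "submodule ((?E <+>\<^bsub>M\<^esub> V) \<inter> ?C) R M" by (rule submodule_Int[OF EV C])
  have C_le: "?C \<subseteq> ?D <+>\<^bsub>M\<^esub> ((?E <+>\<^bsub>M\<^esub> V) \<inter> ?C)"
    using modular_law[OF D EV C] full1 submodule_subset[OF C] by auto
  let ?X = "U <+>\<^bsub>M\<^esub> ((?E <+>\<^bsub>M\<^esub> V) \<inter> ?C)" and ?Y = "U <+>\<^bsub>M\<^esub> W"
  have X: "submodule ?X R M" and Y: "submodule ?Y R M" using submodule_sum U(1) EV_C W by blast+
  have D_Y: "?D \<subseteq> ?Y" using sum_commute[OF submodule_subset[OF W] submodule_subset[OF U(1)]] by auto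
  have "?C \<subseteq> ?X <+>\<^bsub>M\<^esub> ?Y"
    using C_le sum_mono[OF D_Y sum_upper2[OF U(1) EV_C]]
      sum_commute[OF submodule_subset[OF X] submodule_subset[OF Y]] by simp
  moreover have "U \<subseteq> ?X <+>\<^bsub>M\<^esub> ?Y" using sum_upper1[OF U(1) EV_C] sum_upper1[OF X Y] by blast
  ultimately have "?X <+>\<^bsub>M\<^esub> ?Y = carrier M" using sum_full_mono[OF U(2) submodule_sum[OF X Y]] by blast
  then have "?X = carrier M"
    using U(4) X Y sum_upper1[OF U(1) EV_C] sum_upper1[OF U(1) W] Cons.prems(3)[of U]
    unfolding hollow_over_def by (metis list.set_intros(1))
  then have "((?E <+>\<^bsub>M\<^esub> V) \<inter> ?C) <+>\<^bsub>M\<^esub> U = carrier M"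
    using sum_commute[OF submodule_subset[OF U(1)] submodule_subset[OF EV_C]] by simp
  then have "?C \<subseteq> ((?E <+>\<^bsub>M\<^esub> V) \<inter> ?C) <+>\<^bsub>M\<^esub> (U \<inter> ?C)"
    using modular_law[OF EV_C U(1) C] submodule_subset[OF C] by auto
  also have "\<dots> \<subseteq> ?E <+>\<^bsub>M\<^esub> V" using Cons.prems(6) up(2) by (intro sum_least[OF EV]) auto
  finally have full2: "?E <+>\<^bsub>M\<^esub> V = carrier M" using sum_full_mono[OF full1 EV] by blast
  have U_le: "U \<subseteq> ?E <+>\<^bsub>M\<^esub> (V \<inter> U)"
    using modular_law[OF E V U(1)] full2 submodule_subset[OF U(1)] by auto
  let ?V = "(V \<inter> U) <+>\<^bsub>M\<^esub> ?C"
  have V': "submodule ?V R M" by (rule submodule_sum[OF VU C])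
  have WV': "submodule (W <+>\<^bsub>M\<^esub> ?V) R M" by (rule submodule_sum[OF W V'])
  have C_WV: "?C \<subseteq> W <+>\<^bsub>M\<^esub> ?V" using sum_upper2[OF VU C] sum_upper2[OF W V'] by blast
  have "W <+>\<^bsub>M\<^esub> ?C \<subseteq> W <+>\<^bsub>M\<^esub> ?V" by (rule sum_least[OF WV' sum_upper1[OF W V'] C_WV])
  then have "?E <+>\<^bsub>M\<^esub> (V \<inter> U) \<subseteq> W <+>\<^bsub>M\<^esub> ?V"
    using sum_upper1[OF VU C] sum_upper2[OF W V'] by (intro sum_least[OF WV']) auto
  then have "W <+>\<^bsub>M\<^esub> ?V = carrier M" using U_le C_WV by (intro sum_full_mono[OF U(2) WV']) auto
  then have "?V = carrier M"
    using Cons.IH[OF U(3) _ _ V' _ sum_upper2[OF VU C]] Cons.prems(2,3) by simp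
  then have "U \<subseteq> (V \<inter> U) <+>\<^bsub>M\<^esub> (?C \<inter> U)"
    using modular_law[OF VU C U(1)] submodule_subset[OF U(1)] by auto
  also have "\<dots> \<subseteq> V" using Cons.prems(6) by (intro sum_least[OF V]) auto
  finally show ?case using sum_full_mono[OF full2 V] by blast
qed

text \<open>
  Dual Steinitz exchange: the members of \<open>Vs\<close> are replaced one at a time by members of \<open>Us\<close>. When
  \<open>V\<close> is dropped from a family and \<open>W\<close> is the meet of the rest, some \<open>U\<close> is comaximal with \<open>W\<close>;
  otherwise \<open>full_if_above_hollow_meet\<close> turns \<open>V + W = M\<close> into \<open>V + B = M\<close> for the meet \<open>B\<close> of
  \<open>Us\<close>, which is excluded. In the induction \<open>sel\<close> holds the members of \<open>Us\<close> already chosen. The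
  next one differs from them, as they contain \<open>W\<close>.
\<close>

theorem hollow_exchange:
  assumes Us: "coindependent Us" "\<And>U. U \<in> set Us \<Longrightarrow> hollow_over U"
    and Vs: "coindependent Vs" "\<And>V. V \<in> set Vs \<Longrightarrow> meet Us <+>\<^bsub>M\<^esub> V \<noteq> carrier M"
  shows "length Vs \<le> length Us"
proof -
  have "length sel + length Vs \<le> length Us"
    if "set sel \<subseteq> set Us" "distinct sel" "coindependent (sel @ Vs)"
      "\<And>V. V \<in> set Vs \<Longrightarrow> meet Us <+>\<^bsub>M\<^esub> V \<noteq> carrier M" for sel
    using that
  proof (induction Vs arbitrary: sel)
    case Nil
    have "length sel = card (set sel)" using Nil.prems(2) by (simp add: distinct_card)
    also have "\<dots> \<le> card (set Us)" using Nil.prems(1) by (simp add: card_mono)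
    also have "\<dots> \<le> length Us" by (rule card_length)
    finally show ?case by simp
  next
    case (Cons V Vs)
    let ?W = "meet (sel @ Vs)"
    have rest: "coindependent (sel @ Vs)" "V <+>\<^bsub>M\<^esub> ?W = carrier M"
      using coindependent_remove[OF Cons.prems(3)] by auto
    have V: "submodule V R M" using coindependent_proper[OF Cons.prems(3), of V] by simp
    have W: "submodule ?W R M" by (rule coindependent_meet[OF rest(1)])
    have B: "submodule (meet Us) R M" by (rule coindependent_meet[OF Us(1)])
    have BV: "submodule (meet Us <+>\<^bsub>M\<^esub> V) R M" by (rule submodule_sum[OF B V])
    have WBV: "?W <+>\<^bsub>M\<^esub> (meet Us <+>\<^bsub>M\<^esub> V) = carrier M"
      using sum_upper1[OF W BV] sum_upper2[OF W BV] sum_upper2[OF B V]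
      by (intro sum_full_mono[OF rest(2) submodule_sum[OF W BV]]) blast+
    obtain U where U: "U \<in> set Us" "U <+>\<^bsub>M\<^esub> ?W = carrier M"
      using full_if_above_hollow_meet[OF Us W _ BV WBV sum_upper1[OF B V]] Cons.prems(4)[of V] by auto
    have Up: "submodule U R M" "U \<noteq> carrier M" using Us(2)[OF U(1)] by (auto simp: hollow_over_def)
    have "U \<notin> set sel"
    proof
      assume "U \<in> set sel"
      then have "?W \<subseteq> U" by (auto simp: meet_def)
      then show False using U(2) Up sum_absorb(2)[OF W Up(1)] by simp
    qed
    moreover have "coindependent ((U # sel) @ Vs)" using Up U(2) rest(1) by simp
    ultimately have "length (U # sel) + length Vs \<le> length Us"
      using Cons.prems U(1) by (intro Cons.IH) auto
    then show ?case by simp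
  qed
  from this[of "[]"] show ?thesis using Vs by simp
qed

text \<open>
  In particular, a coindependent family of maximal submodules has a length that depends only on
  its meet.
\<close>

lemma exchange_maximal:
  assumes Us: "coindependent Us" "\<And>U. U \<in> set Us \<Longrightarrow> maximal_submodule R M U"
    and Vs: "coindependent Vs" and le: "meet Us \<subseteq> meet Vs"
  shows "length Vs \<le> length Us"
proof (rule hollow_exchange[OF Us(1) hollow_over_maximal[OF Us(2)] Vs])
  fix V assume V: "V \<in> set Vs"
  have "meet Us \<subseteq> V" using le V by (auto simp: meet_def)
  then show "meet Us <+>\<^bsub>M\<^esub> V \<noteq> carrier M"
    using coindependent_proper[OF Vs V] sum_absorb(1)[OF coindependent_meet[OF Us(1)]] by simp
qed

text \<open>
  A maximal submodule that does not contain the meet of a coindependent family can be put in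
  front of the family.
\<close>

lemma exists_long_or_radical_family:
  "\<exists>Vs. coindependent Vs \<and> (\<forall>V\<in>set Vs. maximal_submodule R M V) \<and>
    (meet Vs \<subseteq> Rad R M \<or> length Vs = k)"
proof (induction k)
  case 0
  show ?case by (rule exI[of _ "[]"]) simp
next
  case (Suc k)
  then obtain Vs where Vs: "coindependent Vs" "\<forall>V\<in>set Vs. maximal_submodule R M V"
    "meet Vs \<subseteq> Rad R M \<or> length Vs = k" by blast
  show ?case
  proof (cases "meet Vs \<subseteq> Rad R M")
    case False
    then obtain N where N: "maximal_submodule R M N" "\<not> meet Vs \<subseteq> N"
      by (auto simp: Rad_def meet_def)
    have "coindependent (N # Vs)"
      using N maximal_sum_full[OF N(1) coindependent_meet[OF Vs(1)] N(2)] Vs(1)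
      by (simp add: maximal_submodule_def)
    then show ?thesis using Vs N False by (intro exI[of _ "N # Vs"]) auto
  qed (use Vs in blast)
qed

lemma complemented_modulo_meet:
  "(\<And>V. V \<in> set Vs \<Longrightarrow> maximal_submodule R M V) \<Longrightarrow> complemented_modulo R M (carrier M) (meet Vs)"
proof (induction Vs)
  case (Cons V Vs)
  then show ?case using complemented_modulo_Int_maximal[of "meet Vs" V] by (simp add: Int_commute)
qed (simp add: complemented_modulo_carrier)

text \<open>
  A coindependent family of maximal submodules longer than the bound cannot exist, so a family
  grown greedily must stop with its meet in the radical.
\<close>

lemma semilocal_if_bounded_families:
  assumes "\<And>Vs. coindependent Vs \<Longrightarrow> length Vs \<le> n"
  shows "semilocal_module R M"
proof -
  obtain Vs where Vs: "coindependent Vs" "\<forall>V\<in>set Vs. maximal_submodule R M V"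
    "meet Vs \<subseteq> Rad R M \<or> length Vs = Suc n"
    using exists_long_or_radical_family by blast
  then have le: "meet Vs \<subseteq> Rad R M" using assms[OF Vs(1)] by auto
  have "complemented_modulo R M (carrier M) (meet Vs)" using Vs(2) complemented_modulo_meet by blast
  then show ?thesis
    using complemented_modulo_mono[OF _ le] by (simp add: semilocal_iff_complemented_modulo_Rad)
qed

end

section \<open>Finite length of finitely generated semisimple modules\<close>

context left_module
begin

definition add_all :: "'m set list \<Rightarrow> 'm set \<Rightarrow> 'm set" where
  "add_all Ss A = fold (\<lambda>S B. B <+>\<^bsub>M\<^esub> S) Ss A"

lemma add_all_simps [simp]:
  "add_all [] A = A" "add_all (S # Ss) A = add_all Ss (A <+>\<^bsub>M\<^esub> S)"
  "add_all (Ss @ Ts) A = add_all Ts (add_all Ss A)"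
  by (simp_all add: add_all_def)

lemma add_all_mono: "A \<subseteq> B \<Longrightarrow> add_all Ss A \<subseteq> add_all Ss B"
proof (induction Ss arbitrary: A B)
  case (Cons S Ss)
  show ?case using Cons.IH[OF sum_mono[OF Cons.prems subset_refl]] by simp
qed simp

lemma add_all_submodule:
  "\<lbrakk>submodule A R M; \<And>S. S \<in> set Ss \<Longrightarrow> submodule S R M\<rbrakk>
    \<Longrightarrow> submodule (add_all Ss A) R M \<and> A \<subseteq> add_all Ss A"
proof (induction Ss arbitrary: A)
  case (Cons S Ss)
  have S: "submodule S R M" using Cons.prems by simp
  show ?case
    using Cons.IH[OF submodule_sum[OF Cons.prems(1) S]] Cons.prems sum_upper1[OF Cons.prems(1) S] by auto
qed simp

text \<open>
  Finite sums of simple submodules are directed, so their union is a submodule. It is the socle,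
  hence everything, and a finite set inside a directed union lies in one member.
\<close>

lemma finitely_many_simples_suffice:
  assumes ss: "semisimple_module R M" and X: "finite X" "X \<subseteq> carrier M"
  shows "\<exists>Ss. (\<forall>S\<in>set Ss. simple_submodule R M S) \<and> X \<subseteq> add_all Ss {\<zero>\<^bsub>M\<^esub>}"
proof -
  let ?simples = "\<lambda>Ss. \<forall>S\<in>set Ss. simple_submodule R M S"
  let ?T = "{x \<in> carrier M. \<exists>Ss. ?simples Ss \<and> x \<in> add_all Ss {\<zero>\<^bsub>M\<^esub>}}"
  have sub: "submodule (add_all Ss {\<zero>\<^bsub>M\<^esub>}) R M" if "?simples Ss" for Ss
    using add_all_submodule[OF submodule_zero_set, of Ss] that by (simp add: simple_submodule_def)
  have join: "add_all Ss {\<zero>\<^bsub>M\<^esub>} \<union> add_all Ts {\<zero>\<^bsub>M\<^esub>} \<subseteq> add_all (Ss @ Ts) {\<zero>\<^bsub>M\<^esub>}"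
    if s: "?simples Ss" "?simples Ts" for Ss Ts
    using add_all_submodule[OF sub[OF s(1)], of Ts] s(2) submodule_zero[OF sub[OF s(1)]]
      add_all_mono[of "{\<zero>\<^bsub>M\<^esub>}" "add_all Ss {\<zero>\<^bsub>M\<^esub>}" Ts] by (simp add: simple_submodule_def)
  have T: "submodule ?T R M"
  proof (rule submoduleI)
    show "\<zero>\<^bsub>M\<^esub> \<in> ?T" by (auto intro!: exI[of _ "[]"])
    fix x y assume "x \<in> ?T" "y \<in> ?T"
    then obtain Ss Ts where st: "?simples Ss" "x \<in> add_all Ss {\<zero>\<^bsub>M\<^esub>}" "?simples Ts" "y \<in> add_all Ts {\<zero>\<^bsub>M\<^esub>}"
      by blast
    then have all: "?simples (Ss @ Ts)" by auto
    have "x \<oplus>\<^bsub>M\<^esub> y \<in> add_all (Ss @ Ts) {\<zero>\<^bsub>M\<^esub>}"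
      using join[OF st(1,3)] st(2,4) by (intro submodule_add[OF sub[OF all]]) blast+
    then show "x \<oplus>\<^bsub>M\<^esub> y \<in> ?T" using all submodule_mem[OF sub[OF all]] by blast
  next
    fix a x assume a: "a \<in> carrier R" "x \<in> ?T"
    then obtain Ss where Ss: "?simples Ss" "x \<in> add_all Ss {\<zero>\<^bsub>M\<^esub>}" by blast
    then have "a \<odot>\<^bsub>M\<^esub> x \<in> add_all Ss {\<zero>\<^bsub>M\<^esub>}" by (intro submodule_smult[OF sub a(1)])
    moreover have "a \<odot>\<^bsub>M\<^esub> x \<in> carrier M" using a by (intro smult_closed) auto
    ultimately show "a \<odot>\<^bsub>M\<^esub> x \<in> ?T" using Ss(1) by blast
  qed auto
  have le: "\<Union>{S. simple_submodule R M S} \<subseteq> ?T"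
  proof
    fix x assume "x \<in> \<Union>{S. simple_submodule R M S}"
    then obtain S where S: "simple_submodule R M S" "x \<in> S" by blast
    then have Ss: "submodule S R M" by (simp add: simple_submodule_def)
    have "x \<in> add_all [S] {\<zero>\<^bsub>M\<^esub>}" using sum_upper2[OF submodule_zero_set Ss] S(2) by auto
    moreover have "?simples [S]" using S(1) by simp
    ultimately show "x \<in> ?T" using submodule_mem[OF Ss S(2)] by blast
  qed
  have all: "carrier M \<subseteq> ?T" using generated_least[OF T le] ss by (simp add: semisimple_module_def)
  show ?thesis using X
  proof (induction X rule: finite_induct)
    case empty
    show ?case by (rule exI[of _ "[]"]) simp
  next
    case (insert x X)
    obtain Ss where Ss: "?simples Ss" "X \<subseteq> add_all Ss {\<zero>\<^bsub>M\<^esub>}" using insert by auto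
    have "x \<in> ?T" using insert.prems all by blast
    then obtain Ts where Ts: "?simples Ts" "x \<in> add_all Ts {\<zero>\<^bsub>M\<^esub>}" by blast
    show ?case using Ss Ts join[OF Ss(1) Ts(1)] by (intro exI[of _ "Ss @ Ts"]) auto
  qed
qed

text \<open>
  Adding a simple \<open>S\<close> to \<open>A\<close> changes nothing or enlarges \<open>A\<close> by one composition factor. In the
  second case a complement \<open>N\<close> of \<open>A + S\<close> relative to \<open>A\<close> is maximal, and \<open>N\<close> extends the family
  obtained for \<open>A + S\<close>.
\<close>

lemma maximal_family_if_simples_suffice:
  assumes comp: "complemented_modulo R M (carrier M) {\<zero>\<^bsub>M\<^esub>}"
  shows "\<lbrakk>submodule A R M; \<And>S. S \<in> set Ss \<Longrightarrow> simple_submodule R M S; add_all Ss A = carrier M\<rbrakk>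
    \<Longrightarrow> \<exists>Us. coindependent Us \<and> (\<forall>U\<in>set Us. maximal_submodule R M U) \<and> meet Us = A"
proof (induction Ss arbitrary: A)
  case Nil
  then show ?case by (intro exI[of _ "[]"]) simp
next
  case (Cons S Ss)
  note A = Cons.prems(1)
  have S: "simple_submodule R M S" "submodule S R M" using Cons.prems(2) by (auto simp: simple_submodule_def)
  let ?A = "A <+>\<^bsub>M\<^esub> S"
  have AS: "submodule ?A R M" by (rule submodule_sum[OF A S(2)])
  obtain Us where Us: "coindependent Us" "\<forall>U\<in>set Us. maximal_submodule R M U" "meet Us = ?A"
    using Cons.IH[OF AS] Cons.prems(2,3) by auto
  show ?case
  proof (cases "S \<subseteq> A")
    case True
    then show ?thesis using Us sum_absorb(2)[OF S(2) A] by auto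
  next
    case False
    obtain K where K: "submodule K R M" "?A <+>\<^bsub>M\<^esub> K = carrier M" "?A \<inter> K \<subseteq> {\<zero>\<^bsub>M\<^esub>}"
      by (rule complement_exists[OF comp AS submodule_subset[OF AS]])
    let ?N = "A <+>\<^bsub>M\<^esub> K"
    have N: "submodule ?N R M" by (rule submodule_sum[OF A K(1)])
    have up: "A \<subseteq> ?A" "S \<subseteq> ?A" "A \<subseteq> ?N" "K \<subseteq> ?N"
      using sum_upper1[OF A S(2)] sum_upper2[OF A S(2)] sum_upper1[OF A K(1)] sum_upper2[OF A K(1)] by auto
    have "?N \<inter> ?A \<subseteq> A <+>\<^bsub>M\<^esub> (K \<inter> ?A)" by (rule modular_law[OF A K(1) AS up(1)])
    also have "\<dots> \<subseteq> A" using K(3) submodule_zero[OF A] by (intro sum_least[OF A]) auto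
    finally have meetN: "?N \<inter> ?A = A" using up by blast
    have NA: "submodule (?N <+>\<^bsub>M\<^esub> ?A) R M" by (rule submodule_sum[OF N AS])
    have full: "?N <+>\<^bsub>M\<^esub> ?A = carrier M"
      using sum_upper1[OF N AS] sum_upper2[OF N AS] up by (intro sum_full_mono[OF K(2) NA]) auto
    have properN: "?N \<noteq> carrier M"
    proof
      assume "?N = carrier M"
      then have "?A \<subseteq> A" using meetN submodule_subset[OF AS] by blast
      then show False using up False by blast
    qed
    have "L = ?N \<or> L = carrier M" if L: "submodule L R M" "?N \<subseteq> L" for L
    proof (cases "S \<subseteq> L")
      case True
      then have "?A \<subseteq> L" using up L by (intro sum_least[OF L(1)]) auto
      then show ?thesis using sum_full_mono[OF full L(1,2)] by simp
    next
      case False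
      have "S \<inter> L = {\<zero>\<^bsub>M\<^esub>}"
        using S(1) False submodule_Int[OF S(2) L(1)] unfolding simple_submodule_def
        by (metis Int_lower1 inf.absorb_iff1)
      then have "?A \<inter> L \<subseteq> A"
        using modular_law[OF A S(2) L(1)] up L(2) sum_absorb(2)[OF submodule_zero_set A] submodule_zero[OF A]
        by simp
      moreover have "L \<subseteq> ?N <+>\<^bsub>M\<^esub> (?A \<inter> L)"
        using modular_law[OF N AS L(1,2)] full submodule_subset[OF L(1)] by auto
      moreover have "?N <+>\<^bsub>M\<^esub> (?A \<inter> L) \<subseteq> ?N"
        using \<open>?A \<inter> L \<subseteq> A\<close> up by (intro sum_least[OF N]) auto
      ultimately show ?thesis using L(2) by blast
    qed
    then have "maximal_submodule R M ?N" using N properN by (simp add: maximal_submodule_def)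
    moreover have "coindependent (?N # Us)" using Us N properN full by simp
    ultimately show ?thesis using Us meetN by (intro exI[of _ "?N # Us"]) auto
  qed
qed

end

lemma (in left_module_epi) coindependent_preimage:
  "P.coindependent Vs \<Longrightarrow>
    M.coindependent (map preimage Vs) \<and> M.meet (map preimage Vs) = preimage (P.meet Vs)"
proof (induction Vs)
  case (Cons V Vs)
  have V: "submodule V R P" "V \<noteq> carrier P" "V <+>\<^bsub>P\<^esub> P.meet Vs = carrier P" "P.coindependent Vs"
    using Cons.prems by auto
  have im: "g ` preimage V = V" by (rule image_preimage[OF P.submodule_subset[OF V(1)]])
  have "preimage V \<noteq> carrier M" using im V(2) surj by auto
  moreover have "preimage V <+>\<^bsub>M\<^esub> preimage (P.meet Vs) = carrier M"
    using V(3) im by (intro preimage_sum_full[OF submodule_preimage[OF V(1)] _ P.coindependent_meet[OF V(4)]]) simp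
  ultimately show ?case
    using Cons.IH[OF V(4)] submodule_preimage[OF V(1)] by (auto simp: preimage_def)
qed (auto simp: preimage_def hom_closed)

lemma (in left_module_epi) maximal_preimage_epi:
  assumes "maximal_submodule R P N"
  shows "maximal_submodule R M (preimage N)"
proof -
  have "submodule N R P" "N \<noteq> carrier P" using assms by (auto simp: maximal_submodule_def)
  then have "preimage N \<noteq> carrier M" using image_preimage[OF P.submodule_subset] surj by metis
  then show ?thesis using maximal_preimage[OF assms] by blast
qed

text \<open>
  The quotient \<open>M/Rad M\<close> is semisimple and finitely generated, hence a finite sum of simple
  submodules. The family constructed there is pulled back to \<open>M\<close>.
\<close>

theorem (in left_module) maximal_family_with_meet:
  assumes fg: "finitely_generated R M" and sl: "semilocal_module R M"
    and A: "submodule A R M" "Rad R M \<subseteq> A"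
  shows "\<exists>Us. coindependent Us \<and> (\<forall>U\<in>set Us. maximal_submodule R M U) \<and> meet Us = A"
proof -
  let ?Q = "quotient_module M (Rad R M)"
  interpret e: left_module_epi R M ?Q "\<lambda>x. Rad R M +>\<^bsub>M\<^esub> x"
    by (rule quotient_epi[OF submodule_Rad])
  let ?g = "\<lambda>x. Rad R M +>\<^bsub>M\<^esub> x"
  have ss: "semisimple_module R ?Q" using sl by (simp add: semilocal_module_def)
  obtain X where X: "finite X" "X \<subseteq> carrier ?Q" "submodule_generated R ?Q X = carrier ?Q"
    using e.finitely_generated_image[OF fg] by (auto simp: finitely_generated_def)
  obtain Ss where Ss: "\<forall>S\<in>set Ss. simple_submodule R ?Q S" "X \<subseteq> e.P.add_all Ss {\<zero>\<^bsub>?Q\<^esub>}"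
    using e.P.finitely_many_simples_suffice[OF ss X(1,2)] by blast
  have subs: "\<And>S. S \<in> set Ss \<Longrightarrow> submodule S R ?Q" using Ss(1) by (simp add: simple_submodule_def)
  have gA: "submodule (?g ` A) R ?Q" by (rule e.submodule_image[OF A(1)])
  have sum: "submodule (e.P.add_all Ss (?g ` A)) R ?Q" using e.P.add_all_submodule[OF gA subs] by blast
  have "e.P.add_all Ss {\<zero>\<^bsub>?Q\<^esub>} \<subseteq> e.P.add_all Ss (?g ` A)"
    using e.P.submodule_zero[OF gA] by (intro e.P.add_all_mono) simp
  then have "e.P.add_all Ss (?g ` A) = carrier ?Q"
    using e.P.generated_least[OF sum, of X] Ss(2) X(3) e.P.submodule_subset[OF sum] by auto
  then obtain Us where Us: "e.P.coindependent Us" "\<forall>U\<in>set Us. maximal_submodule R ?Q U"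
    "e.P.meet Us = ?g ` A"
    using e.P.maximal_family_if_simples_suffice[OF e.P.semisimple_imp_complemented[OF ss] gA] Ss(1) by blast
  have "e.preimage (?g ` A) = A"
    using A(2) by (intro e.preimage_image[OF A(1)]) (simp add: quotient_kernel[OF submodule_Rad])
  then show ?thesis
    using e.coindependent_preimage[OF Us(1)] Us(2,3) e.maximal_preimage_epi
    by (intro exI[of _ "map e.preimage Us"]) auto
qed

section \<open>Hollow dimension\<close>

context left_module
begin

lemma hollow_quotient:
  assumes U: "hollow_over U"
  shows "hollow_module R (quotient_module M U)"
proof -
  have Us: "submodule U R M" "U \<noteq> carrier M" using U by (auto simp: hollow_over_def)
  let ?Q = "quotient_module M U"
  interpret e: left_module_epi R M ?Q "\<lambda>x. U +>\<^bsub>M\<^esub> x" by (rule quotient_epi[OF Us(1)])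
  have ker: "e.preimage {\<zero>\<^bsub>?Q\<^esub>} = U" by (rule quotient_kernel[OF Us(1)])
  have up: "submodule (e.preimage N) R M" "U \<subseteq> e.preimage N" if "submodule N R ?Q" for N
  proof -
    show "submodule (e.preimage N) R M" by (rule e.submodule_preimage[OF that])
    have "e.preimage {\<zero>\<^bsub>?Q\<^esub>} \<subseteq> e.preimage N" using e.P.submodule_zero[OF that] by (auto simp: e.preimage_def)
    then show "U \<subseteq> e.preimage N" unfolding ker .
  qed
  have full: "N = carrier ?Q" if N: "submodule N R ?Q" "e.preimage N = carrier M" for N
    using e.image_preimage[OF e.P.submodule_subset[OF N(1)]] e.surj N(2) by simp
  show ?thesis
    unfolding hollow_module_def small_submodule_def
  proof (intro conjI allI impI)
    show "carrier ?Q \<noteq> {\<zero>\<^bsub>?Q\<^esub>}"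
    proof
      assume "carrier ?Q = {\<zero>\<^bsub>?Q\<^esub>}"
      then have "carrier M \<subseteq> e.preimage {\<zero>\<^bsub>?Q\<^esub>}" using e.hom_closed by (auto simp: e.preimage_def)
      then show False using ker Us submodule_subset by blast
    qed
    fix N L assume N: "submodule N R ?Q \<and> N \<noteq> carrier ?Q" and L: "submodule L R ?Q \<and> L \<noteq> carrier ?Q"
    show "N <+>\<^bsub>?Q\<^esub> L \<noteq> carrier ?Q"
    proof
      assume "N <+>\<^bsub>?Q\<^esub> L = carrier ?Q"
      then have "e.preimage N <+>\<^bsub>M\<^esub> e.preimage L = carrier M"
        using N L up(1)[of N] e.image_preimage[OF e.P.submodule_subset[of N]]
        by (intro e.preimage_sum_full) auto
      then have "e.preimage N = carrier M \<or> e.preimage L = carrier M"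
        using U up[of N] up[of L] N L unfolding hollow_over_def by blast
      then show False using full[of N] full[of L] N L by blast
    qed
  qed blast
qed

lemma chinese_remainder:
  "\<lbrakk>coindependent Us; \<And>i. i < length Us \<Longrightarrow> z i \<in> carrier M\<rbrakk>
    \<Longrightarrow> \<exists>x\<in>carrier M. \<forall>i<length Us. x \<ominus>\<^bsub>M\<^esub> z i \<in> Us ! i"
proof (induction Us arbitrary: z)
  case (Cons U Us)
  have U: "submodule U R M" "U <+>\<^bsub>M\<^esub> meet Us = carrier M" "coindependent Us"
    using Cons.prems(1) by auto
  obtain x where x: "x \<in> carrier M" "\<forall>i<length Us. x \<ominus>\<^bsub>M\<^esub> z (Suc i) \<in> Us ! i"
    using Cons.IH[OF U(3), of "\<lambda>i. z (Suc i)"] Cons.prems(2) by fastforce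
  have z: "z 0 \<in> carrier M" using Cons.prems(2)[of 0] by simp
  have "x \<ominus>\<^bsub>M\<^esub> z 0 \<in> U <+>\<^bsub>M\<^esub> meet Us" using x z U(2) by simp
  then obtain u c where uc: "u \<in> U" "c \<in> meet Us" "x \<ominus>\<^bsub>M\<^esub> z 0 = u \<oplus>\<^bsub>M\<^esub> c" by (rule sum_memE)
  have c: "u \<in> carrier M" "c \<in> carrier M"
    using submodule_mem[OF U(1) uc(1)] uc(2) by (auto simp: meet_def)
  have "(x \<ominus>\<^bsub>M\<^esub> c) \<ominus>\<^bsub>M\<^esub> z i \<in> (U # Us) ! i" if i: "i < length (U # Us)" for i
  proof (cases i)
    case 0
    have "(x \<ominus>\<^bsub>M\<^esub> c) \<ominus>\<^bsub>M\<^esub> z 0 = (x \<ominus>\<^bsub>M\<^esub> z 0) \<ominus>\<^bsub>M\<^esub> c"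
      using x(1) z c by (simp add: M.minus_eq M.a_ac)
    also have "\<dots> = u" using c uc(3) by (simp add: M.minus_eq M.a_assoc M.r_neg)
    finally show ?thesis using 0 uc(1) by simp
  next
    case (Suc k)
    then have k: "k < length Us" "z i \<in> carrier M" using i Cons.prems(2)[of i] by auto
    have "submodule (Us ! k) R M" using coindependent_proper[OF U(3)] k(1) by simp
    moreover have "c \<in> Us ! k" using uc(2) k(1) by (auto simp: meet_def)
    ultimately have "(x \<ominus>\<^bsub>M\<^esub> z i) \<ominus>\<^bsub>M\<^esub> c \<in> Us ! k" using x(2) k(1) Suc submodule_minus by blast
    moreover have "(x \<ominus>\<^bsub>M\<^esub> z i) \<ominus>\<^bsub>M\<^esub> c = (x \<ominus>\<^bsub>M\<^esub> c) \<ominus>\<^bsub>M\<^esub> z i"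
      using x(1) c k(2) by (simp add: M.minus_eq M.a_ac)
    ultimately show ?thesis using Suc by simp
  qed
  then show ?case using x(1) c by (intro bexI[of _ "x \<ominus>\<^bsub>M\<^esub> c"]) auto
qed auto

text \<open>
  By the Chinese remainder theorem \<open>M\<close> maps onto the product of the hollow modules \<open>M/U\<close>, and the
  kernel is the meet.
\<close>

lemma has_hollow_dim_if_coindependent:
  assumes Us: "coindependent Us" "\<And>U. U \<in> set Us \<Longrightarrow> hollow_over U"
    and small: "small_submodule R M (meet Us)"
  shows "has_hollow_dim R M (length Us)"
  unfolding has_hollow_dim_def
proof (intro exI conjI)
  let ?n = "length Us"
  let ?H = "\<lambda>i. quotient_module M (Us ! i)"
  let ?P = "product_module {..<?n} ?H"
  let ?g = "\<lambda>x. \<lambda>i\<in>{..<?n}. Us ! i +>\<^bsub>M\<^esub> x"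
  have hol: "hollow_over (Us ! i)" "submodule (Us ! i) R M" if "i < ?n" for i
    using Us(2)[OF nth_mem[OF that]] unfolding hollow_over_def by blast+
  note epi = quotient_epi[OF hol(2)] and ker = quotient_kernel[OF hol(2)]
  have mods: "left_module R (?H i)" if "i < ?n" for i
    using epi[OF that] by (simp add: left_module_epi_def left_module_morphism_def)
  show "\<forall>i<?n. left_module R (?H i) \<and> hollow_module R (?H i)" using mods hollow_quotient hol by blast
  have hom: "?g \<in> left_module_hom R M ?P"
    by (rule hom_to_product)
      (use epi in \<open>simp add: left_module_epi_def left_module_morphism_def left_module_morphism_axioms_def\<close>)
  then show "?g \<in> left_module_hom R M ?P" .
  show "?g ` carrier M = carrier ?P"
  proof
    show "?g ` carrier M \<subseteq> carrier ?P" using hom by (auto simp: left_module_hom_def)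
    show "carrier ?P \<subseteq> ?g ` carrier M"
    proof
      fix y assume y: "y \<in> carrier ?P"
      have "\<forall>i\<in>{..<?n}. \<exists>z\<in>carrier M. y i = Us ! i +>\<^bsub>M\<^esub> z"
      proof
        fix i assume i: "i \<in> {..<?n}"
        then have "y i \<in> carrier (?H i)" using y by (simp add: product_module_def PiE_iff)
        also have "\<dots> = (\<lambda>x. Us ! i +>\<^bsub>M\<^esub> x) ` carrier M"
          using left_module_epi.surj[OF epi] i by simp
        finally show "\<exists>z\<in>carrier M. y i = Us ! i +>\<^bsub>M\<^esub> z" by blast
      qed
      then obtain z where z: "\<And>i. i < ?n \<Longrightarrow> z i \<in> carrier M \<and> y i = Us ! i +>\<^bsub>M\<^esub> z i"
        by (metis lessThan_iff)
      obtain x where x: "x \<in> carrier M" "\<And>i. i < ?n \<Longrightarrow> x \<ominus>\<^bsub>M\<^esub> z i \<in> Us ! i"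
        using chinese_remainder[OF Us(1), of z] z by blast
      have "y i = Us ! i +>\<^bsub>M\<^esub> x" if i: "i < ?n" for i
      proof -
        interpret e: left_module_epi R M "?H i" "\<lambda>x. Us ! i +>\<^bsub>M\<^esub> x" by (rule epi[OF i])
        have zc: "z i \<in> carrier M" using z[OF i] by simp
        have "x \<ominus>\<^bsub>M\<^esub> z i \<in> e.preimage {\<zero>\<^bsub>?H i\<^esub>}" using x(2)[OF i] ker[OF i] by simp
        then have "Us ! i +>\<^bsub>M\<^esub> (x \<ominus>\<^bsub>M\<^esub> z i) = \<zero>\<^bsub>?H i\<^esub>" by (simp add: e.preimage_def)
        then have zero: "(Us ! i +>\<^bsub>M\<^esub> x) \<ominus>\<^bsub>?H i\<^esub> (Us ! i +>\<^bsub>M\<^esub> z i) = \<zero>\<^bsub>?H i\<^esub>"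
          using e.hom_minus[OF x(1) zc] by simp
        have c: "Us ! i +>\<^bsub>M\<^esub> x \<in> carrier (?H i)" "Us ! i +>\<^bsub>M\<^esub> z i \<in> carrier (?H i)"
          using e.hom_closed x(1) zc by auto
        then have "((Us ! i +>\<^bsub>M\<^esub> x) \<ominus>\<^bsub>?H i\<^esub> (Us ! i +>\<^bsub>M\<^esub> z i)) \<oplus>\<^bsub>?H i\<^esub> (Us ! i +>\<^bsub>M\<^esub> z i) = Us ! i +>\<^bsub>M\<^esub> x"
          by (simp add: e.P.M.minus_eq e.P.M.a_assoc e.P.M.l_neg)
        then show ?thesis using zero c z[OF i] by simp
      qed
      then have "y = ?g x" using y by (intro extensionalityI[of _ "{..<?n}"]) (auto simp: product_module_def PiE_iff)
      then show "y \<in> ?g ` carrier M" using x(1) by blast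
    qed
  qed
  have "Us ! i +>\<^bsub>M\<^esub> x = \<zero>\<^bsub>?H i\<^esub> \<longleftrightarrow> x \<in> Us ! i" if "i < ?n" "x \<in> carrier M" for i x
    using ker[OF that(1)] that(2) left_module_morphism.preimage_def[OF left_module_epi.axioms(1)[OF epi[OF that(1)]]]
    by (auto simp: set_eq_iff)
  then have "a_kernel M ?P ?g = {x \<in> carrier M. \<forall>i<?n. x \<in> Us ! i}"
    unfolding a_kernel_def' product_module_def by (auto simp: fun_eq_iff restrict_def)
  also have "\<dots> = meet Us" by (auto simp: meet_def set_conv_nth)
  finally show "small_submodule R M (a_kernel M ?P ?g)" using small by simp
qed

text \<open>The family consists of the kernels \<open>U i\<close> of the components of the given epimorphism.\<close>

lemma coindependent_if_has_hollow_dim: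
  assumes "has_hollow_dim R M n"
  shows "\<exists>Us. coindependent Us \<and> (\<forall>U\<in>set Us. hollow_over U) \<and>
    small_submodule R M (meet Us) \<and> length Us = n"
proof -
  obtain H :: "nat \<Rightarrow> ('a, 'm set) module" and g where
    H: "\<And>i. i < n \<Longrightarrow> left_module R (H i)" "\<And>i. i < n \<Longrightarrow> hollow_module R (H i)"
    and g: "g \<in> left_module_hom R M (product_module {..<n} H)"
      "g ` carrier M = carrier (product_module {..<n} H)"
    and small: "small_submodule R M (a_kernel M (product_module {..<n} H) g)"
    using assms unfolding has_hollow_dim_def by blast
  let ?P = "product_module {..<n} H"
  define U where "U = (\<lambda>i. {x \<in> carrier M. g x i = \<zero>\<^bsub>H i\<^esub>})"
  have PiE: "g x \<in> (\<Pi>\<^sub>E i\<in>{..<n}. carrier (H i))" if "x \<in> carrier M" for x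
    using g(1) that by (auto simp: left_module_hom_def product_module_def)
  have gi: "(\<lambda>x. g x i) \<in> left_module_hom R M (H i)" if i: "i < n" for i
    using g(1) PiE i hom_from_product[of i "{..<n}" R H]
    by (auto simp: left_module_hom_def Pi_iff)
  have zero: "\<zero>\<^bsub>H i\<^esub> \<in> carrier (H i)" if "i < n" for i
    using H(1)[OF that] abelian_monoid.zero_closed abelian_group.axioms(1) left_module.axioms(2) by blast
  \<comment> \<open>The element supported at \<open>i\<close> with a prescribed value is attained.\<close>
  have attained: "\<exists>z\<in>carrier M. \<forall>k<n. g z k = (if k = i then y else \<zero>\<^bsub>H k\<^esub>)"
    if i: "i < n" and y: "y \<in> carrier (H i)" for i y
  proof -
    have "(\<lambda>k\<in>{..<n}. if k = i then y else \<zero>\<^bsub>H k\<^esub>) \<in> carrier ?P"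
      using y zero by (auto simp: product_module_def)
    then obtain z where "z \<in> carrier M" "g z = (\<lambda>k\<in>{..<n}. if k = i then y else \<zero>\<^bsub>H k\<^esub>)"
      using g(2) by (metis (no_types, lifting) imageE)
    then show ?thesis by (intro bexI[of _ z]) simp_all
  qed
  have epi: "left_module_epi R M (H i) (\<lambda>x. g x i)" if i: "i < n" for i
  proof (rule left_module_epiI[OF left_module_axioms H(1)[OF i] gi[OF i]])
    show "(\<lambda>x. g x i) ` carrier M = carrier (H i)"
    proof
      show "carrier (H i) \<subseteq> (\<lambda>x. g x i) ` carrier M"
      proof
        fix y assume "y \<in> carrier (H i)"
        then obtain z where "z \<in> carrier M" "g z i = y" using attained[OF i] i by force
        then show "y \<in> (\<lambda>x. g x i) ` carrier M" by blast
      qed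
    qed (use gi[OF i] in \<open>auto simp: left_module_hom_def\<close>)
  qed
  have hollow: "hollow_over (U i)" if i: "i < n" for i
  proof -
    interpret e: left_module_epi R M "H i" "\<lambda>x. g x i" by (rule epi[OF i])
    have U_eq: "U i = e.preimage {\<zero>\<^bsub>H i\<^esub>}" by (auto simp: U_def e.preimage_def)
    have full: "X = carrier M"
      if X: "submodule X R M" "U i \<subseteq> X" "(\<lambda>x. g x i) ` X = carrier (H i)" for X
    proof -
      have "e.preimage (carrier (H i)) = X" using e.preimage_image[OF X(1)] X(2,3) U_eq by simp
      then show ?thesis using e.hom_closed by (auto simp: e.preimage_def)
    qed
    show ?thesis
      unfolding hollow_over_def
    proof (intro conjI allI impI)
      show "submodule (U i) R M" unfolding U_eq by (rule e.submodule_preimage[OF e.P.submodule_zero_set])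
      show "U i \<noteq> carrier M"
      proof
        assume "U i = carrier M"
        then have "\<And>x. x \<in> carrier M \<Longrightarrow> g x i = \<zero>\<^bsub>H i\<^esub>" by (auto simp: U_def)
        then have "carrier (H i) \<subseteq> {\<zero>\<^bsub>H i\<^esub>}" unfolding e.surj[symmetric] by blast
        then show False using H(2)[OF i] zero[OF i] by (auto simp: hollow_module_def)
      qed
      fix X Y assume XY: "submodule X R M \<and> submodule Y R M \<and> U i \<subseteq> X \<and> U i \<subseteq> Y \<and> X <+>\<^bsub>M\<^esub> Y = carrier M"
      let ?X = "(\<lambda>x. g x i) ` X" and ?Y = "(\<lambda>x. g x i) ` Y"
      have "?X <+>\<^bsub>H i\<^esub> ?Y = carrier (H i)" using XY by (intro e.image_sum_full) auto
      moreover have "submodule ?X R (H i)" "submodule ?Y R (H i)" using e.submodule_image XY by auto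
      ultimately have "?X = carrier (H i) \<or> ?Y = carrier (H i)"
        using H(2)[OF i] unfolding hollow_module_def small_submodule_def by blast
      then show "X = carrier M \<or> Y = carrier M" using full XY by blast
    qed
  qed
  have coind: "coindependent (map U is)" if "distinct is" "set is \<subseteq> {..<n}" for "is"
    using that
  proof (induction "is")
    case (Cons i "is")
    have i: "i < n" "submodule (U i) R M" "U i \<noteq> carrier M"
      using Cons.prems hollow[of i] by (auto simp: hollow_over_def)
    have IH: "coindependent (map U is)" using Cons by simp
    have "x \<in> U i <+>\<^bsub>M\<^esub> meet (map U is)" if x: "x \<in> carrier M" for x
    proof -
      interpret e: left_module_epi R M "H i" "\<lambda>x. g x i" by (rule epi[OF i(1)])
      obtain z where z: "z \<in> carrier M" "\<forall>k<n. g z k = (if k = i then g x i else \<zero>\<^bsub>H k\<^esub>)"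
        using attained[OF i(1) e.hom_closed[OF x]] by blast
      have "g (x \<ominus>\<^bsub>M\<^esub> z) i = \<zero>\<^bsub>H i\<^esub>"
        using e.hom_minus[OF x z(1)] e.hom_closed[OF x] z(2) i(1) by (simp add: e.P.M.minus_eq e.P.M.r_neg)
      then have "x \<ominus>\<^bsub>M\<^esub> z \<in> U i" using x z(1) by (simp add: U_def)
      moreover have "g z j = \<zero>\<^bsub>H j\<^esub>" if j: "j \<in> set is" for j
      proof -
        have "j < n" "j \<noteq> i" using j Cons.prems by auto
        then show ?thesis using z(2) by simp
      qed
      then have "z \<in> meet (map U is)" using z(1) by (simp add: meet_def U_def)
      ultimately have "(x \<ominus>\<^bsub>M\<^esub> z) \<oplus>\<^bsub>M\<^esub> z \<in> U i <+>\<^bsub>M\<^esub> meet (map U is)" by (rule sum_memI)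
      then show ?thesis using x z(1) by (simp add: M.minus_eq M.a_assoc M.l_neg)
    qed
    then have "U i <+>\<^bsub>M\<^esub> meet (map U is) = carrier M"
      using submodule_subset[OF submodule_sum[OF i(2) coindependent_meet[OF IH]]] by blast
    then show ?case using i IH by simp
  qed simp
  have "a_kernel M ?P g = meet (map U [0..<n])"
  proof -
    have "g x = (\<lambda>i\<in>{..<n}. \<zero>\<^bsub>H i\<^esub>) \<longleftrightarrow> (\<forall>i<n. g x i = \<zero>\<^bsub>H i\<^esub>)" if "x \<in> carrier M" for x
      using PiE[OF that] by (auto simp: PiE_iff intro!: extensionalityI[of _ "{..<n}"])
    then show ?thesis by (auto simp: a_kernel_def' product_module_def meet_def U_def)
  qed
  then show ?thesis
    using coind[of "[0..<n]"] hollow small by (intro exI[of _ "map U [0..<n]"]) (auto simp: atLeast0LessThan)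
qed

lemma coindependent_length_le_hollow_dim:
  assumes "has_hollow_dim R M n" "coindependent Vs"
  shows "length Vs \<le> n"
proof -
  obtain Us where Us: "coindependent Us" "\<And>U. U \<in> set Us \<Longrightarrow> hollow_over U"
    "small_submodule R M (meet Us)" "length Us = n"
    using coindependent_if_has_hollow_dim[OF assms(1)] by blast
  have "meet Us <+>\<^bsub>M\<^esub> V \<noteq> carrier M" if "V \<in> set Vs" for V
    using Us(3) coindependent_proper[OF assms(2) that] by (simp add: small_submodule_def)
  then show ?thesis using hollow_exchange[OF Us(1,2) assms(2)] Us(4) by blast
qed

text \<open>Exchange in both directions leaves only one possible number of hollow factors.\<close>

theorem hdim_eq:
  assumes "has_hollow_dim R M n"
  shows "hdim R M = n"
  unfolding hdim_def
proof (rule the_equality)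
  show "has_hollow_dim R M n" by (rule assms)
  have "k \<le> m" if km: "has_hollow_dim R M k" "has_hollow_dim R M m" for k m
    using coindependent_if_has_hollow_dim[OF km(1)] coindependent_length_le_hollow_dim[OF km(2)] by blast
  then show "m = n" if "has_hollow_dim R M m" for m using assms that by (simp add: le_antisym)
qed

lemma semilocal_if_finite_hollow_dim:
  assumes "finite_hollow_dim R M"
  shows "semilocal_module R M"
  using assms coindependent_length_le_hollow_dim semilocal_if_bounded_families
  unfolding finite_hollow_dim_def by blast

lemma finite_hollow_dim_if_semilocal:
  assumes fg: "finitely_generated R M" and sl: "semilocal_module R M"
  shows "finite_hollow_dim R M"
proof -
  obtain Us where Us: "coindependent Us" "\<And>U. U \<in> set Us \<Longrightarrow> maximal_submodule R M U" "meet Us = Rad R M"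
    using maximal_family_with_meet[OF fg sl submodule_Rad subset_refl] by blast
  have "small_submodule R M (meet Us)"
    using finitely_generated_small_radical[OF fg] Us(3) by (simp add: has_small_radical_def)
  then show ?thesis
    using has_hollow_dim_if_coindependent[OF Us(1) hollow_over_maximal[OF Us(2)]]
    unfolding finite_hollow_dim_def by blast
qed

end

section \<open>Rank functions and orderings\<close>

context ring
begin

lemma proper_left_ideal_no_unit:
  assumes "submodule V R (regular_module R)" "V \<noteq> carrier R" "x \<in> V"
  shows "x \<notin> Units R"
proof
  assume x: "x \<in> Units R"
  then have "inv x \<otimes> x \<in> V"
    using left_module.submodule_smult[OF regular_left_module assms(1) _ assms(3), of "inv x"] by simp
  then show False using x assms regular_eq_carrier by simp
qed

text \<open>
  An element \<open>a\<close> that is congruent to \<open>1\<close> modulo the meet is multiplied by a factor \<open>1 - e a\<close> in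
  the first member \<open>V\<close>, with \<open>e a\<close> in the meet of the others. The factor is not a unit, so the
  rank grows, and \<open>a (1 - e a)\<close> is still congruent to \<open>1\<close> modulo the meet of the others. Starting
  from \<open>a = 1\<close>, the rank grows once for every member.
\<close>

lemma coindependent_length_le_rank:
  assumes d: "semilocal_rank_function R n d"
    and "left_module.coindependent R (regular_module R) Vs"
  shows "length Vs \<le> n"
proof -
  interpret reg: left_module R "regular_module R" by (rule regular_left_module)
  have "d a + length Vs \<le> n" if "reg.coindependent Vs" "a \<in> carrier R" "a \<ominus> \<one> \<in> reg.meet Vs" for a
    using that
  proof (induction Vs arbitrary: a)
    case Nil
    then show ?case using d by (auto simp: semilocal_rank_function_def Pi_iff)
  next
    case (Cons V Vs)
    note a = Cons.prems(2)
    have V: "submodule V R (regular_module R)" "V \<noteq> carrier R"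
      "V <+>\<^bsub>regular_module R\<^esub> reg.meet Vs = carrier R" "reg.coindependent Vs"
      using Cons.prems(1) by auto
    have meet: "submodule (reg.meet Vs) R (regular_module R)" by (rule reg.coindependent_meet[OF V(4)])
    have "\<one> \<in> V <+>\<^bsub>regular_module R\<^esub> reg.meet Vs" using V(3) by simp
    then obtain v e where ve: "v \<in> V" "e \<in> reg.meet Vs" "\<one> = v \<oplus> e" by (auto elim: reg.sum_memE)
    have c: "v \<in> carrier R" "e \<in> carrier R"
      using reg.submodule_mem[OF V(1) ve(1)] reg.submodule_mem[OF meet ve(2)] by auto
    have am: "a \<ominus> \<one> \<in> V" "a \<ominus> \<one> \<in> reg.meet Vs" using Cons.prems(3) by auto
    \<comment> \<open>Since \<open>a\<close> is \<open>1\<close> modulo the meet, \<open>e a\<close> behaves like \<open>e\<close>.\<close>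
    have ea: "e \<otimes> a = e \<oplus> e \<otimes> (a \<ominus> \<one>)"
      using a c by (simp add: minus_eq r_distr r_minus r_neg1 r_neg2 a_ac)
    have "e \<otimes> (a \<ominus> \<one>) \<in> reg.meet Vs" "e \<otimes> (a \<ominus> \<one>) \<in> V"
      using reg.submodule_smult[OF meet c(2) am(2)]
        reg.submodule_smult[OF V(1) c(2) am(1)] c by simp_all
    then have eam: "e \<otimes> a \<in> reg.meet Vs" and "v \<ominus> e \<otimes> (a \<ominus> \<one>) \<in> V"
      using reg.submodule_add[OF meet ve(2)] reg.submodule_minus[OF V(1) ve(1)] ea by simp_all
    moreover have "v \<ominus> e \<otimes> (a \<ominus> \<one>) = \<one> \<ominus> e \<otimes> a"
    proof -
      have "\<one> \<ominus> e \<otimes> a = (v \<oplus> e) \<ominus> (e \<oplus> e \<otimes> (a \<ominus> \<one>))" using ve(3) ea by simp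
      also have "\<dots> = v \<ominus> e \<otimes> (a \<ominus> \<one>)" using a c by (simp add: minus_eq minus_add a_assoc r_neg2)
      finally show ?thesis by simp
    qed
    ultimately have nonunit: "\<one> \<ominus> e \<otimes> a \<notin> Units R" using proper_left_ideal_no_unit[OF V(1,2)] by simp
    let ?a = "a \<otimes> (\<one> \<ominus> e \<otimes> a)"
    have "?a \<ominus> \<one> = (a \<ominus> \<one>) \<ominus> a \<otimes> (e \<otimes> a)" using a c by (simp add: minus_eq r_distr r_minus a_ac)
    moreover have "a \<otimes> (e \<otimes> a) \<in> reg.meet Vs" using reg.submodule_smult[OF meet a eam] by simp
    ultimately have "?a \<ominus> \<one> \<in> reg.meet Vs" using reg.submodule_minus[OF meet am(2)] by simp
    then have "d ?a + length Vs \<le> n" using a c by (intro Cons.IH[OF V(4)]) auto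
    moreover have "d ?a = d a + d (\<one> \<ominus> e \<otimes> a)" "d (\<one> \<ominus> e \<otimes> a) \<noteq> 0"
      using d nonunit a c unfolding semilocal_rank_function_def by auto
    ultimately show ?case by simp
  qed
  moreover have "\<one> \<ominus> \<one> \<in> reg.meet Vs"
    using reg.submodule_zero[OF reg.coindependent_meet[OF assms(2)]] by (simp add: minus_eq r_neg)
  ultimately show ?thesis using assms(2) by fastforce
qed

text \<open>
  Elements are ordered by decreasing rank; as ranks are bounded, a descending sequence stops
  where its rank is largest.
\<close>

lemma ordering_if_rank_function:
  assumes d: "semilocal_rank_function R n d"
  shows "\<exists>rel. semilocal_ordering R rel"
proof -
  let ?rel = "{(x, y). x \<in> carrier R \<and> y \<in> carrier R \<and> (x = y \<or> d y < d x)}"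
  have "semilocal_ordering R ?rel"
    unfolding semilocal_ordering_def artinian_poset_def
  proof (intro conjI allI impI ballI)
    show "partial_order_on (carrier R) ?rel"
      unfolding partial_order_on_def preorder_on_def refl_on_def trans_def antisym_def by auto
  next
    fix f :: "nat \<Rightarrow> 'a"
    assume f: "(\<forall>i. f i \<in> carrier R) \<and> (\<forall>i. (f (Suc i), f i) \<in> ?rel)"
    then have step: "f (Suc i) = f i \<or> d (f i) < d (f (Suc i))" for i by auto
    then have mono: "mono (\<lambda>i. d (f i))" by (intro mono_iff_le_Suc[THEN iffD2]) (metis less_imp_le order_refl)
    have bound: "d (f i) < Suc n" for i using d f by (auto simp: semilocal_rank_function_def Pi_iff less_Suc_eq_le)
    obtain k where k: "\<And>i. d (f i) \<le> d (f k)"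
      using ex_has_greatest_nat[of "\<lambda>i. True" 0 "\<lambda>i. d (f i)" "Suc n"] bound by auto
    have "f i = f k" if "i \<ge> k" for i
      using that
    proof (induction i rule: dec_induct)
      case (step i)
      then show ?case using \<open>f (Suc i) = f i \<or> d (f i) < d (f (Suc i))\<close> k[of "Suc i"] by auto
    qed simp
    then show "\<exists>k. \<forall>i\<ge>k. f i = f k" by blast
  next
    fix a b assume ab: "a \<in> carrier R" "b \<in> carrier R" "\<one> \<ominus> b \<otimes> a \<notin> Units R"
    then have "d (a \<otimes> (\<one> \<ominus> b \<otimes> a)) = d a + d (\<one> \<ominus> b \<otimes> a)" "d (\<one> \<ominus> b \<otimes> a) \<noteq> 0"
      using d unfolding semilocal_rank_function_def by auto
    then have less: "d a < d (a \<otimes> (\<one> \<ominus> b \<otimes> a))" by simp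
    then show "(a \<otimes> (\<one> \<ominus> b \<otimes> a), a) \<in> ?rel" using ab by auto
    show "a \<otimes> (\<one> \<ominus> b \<otimes> a) \<noteq> a" using less by auto
  qed
  then show ?thesis by blast
qed

text \<open>
  For a left ideal \<open>L\<close> let \<open>a\<close> be minimal in \<open>1 + L\<close>. If \<open>b a \<in> L\<close>, then \<open>a (1 - b a)\<close> lies in \<open>1
  + L\<close> again, so by minimality \<open>1 - b a\<close> is a unit. Applied to all multiples of \<open>b\<close>, this puts \<open>b
  a\<close> into \<open>J\<close>; thus \<open>L \<inter> R a \<subseteq> J\<close>, while \<open>L + R a = R\<close>.
\<close>

lemma semilocal_if_ordering:
  assumes rel: "semilocal_ordering R rel"
  shows "semilocal_ring R"
proof -
  interpret reg: left_module R "regular_module R" by (rule regular_left_module)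
  have po: "partial_order_on (carrier R) rel"
    and chain: "\<And>f :: nat \<Rightarrow> 'a. \<lbrakk>\<And>i. f i \<in> carrier R; \<And>i. (f (Suc i), f i) \<in> rel\<rbrakk> \<Longrightarrow> \<exists>k. \<forall>i\<ge>k. f i = f k"
    and step: "\<And>a b. \<lbrakk>a \<in> carrier R; b \<in> carrier R; \<one> \<ominus> b \<otimes> a \<notin> Units R\<rbrakk>
      \<Longrightarrow> (a \<otimes> (\<one> \<ominus> b \<otimes> a), a) \<in> rel \<and> a \<otimes> (\<one> \<ominus> b \<otimes> a) \<noteq> a"
    using rel unfolding semilocal_ordering_def artinian_poset_def by blast+
  have minimal: "\<exists>a\<in>A. \<forall>b\<in>A. (b, a) \<in> rel \<longrightarrow> b = a" if A: "A \<subseteq> carrier R" "A \<noteq> {}" for A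
  proof (rule ccontr)
    assume "\<not> ?thesis"
    then have "\<forall>a\<in>A. \<exists>b. b \<in> A \<and> (b, a) \<in> rel \<and> b \<noteq> a" by blast
    then obtain h where h: "\<And>a. a \<in> A \<Longrightarrow> h a \<in> A \<and> (h a, a) \<in> rel \<and> h a \<noteq> a" by metis
    obtain a0 where a0: "a0 \<in> A" using A(2) by blast
    define f where "f = (\<lambda>i. (h ^^ i) a0)"
    have fA: "f i \<in> A" for i by (induction i) (use a0 h in \<open>auto simp: f_def\<close>)
    have fS: "f (Suc i) = h (f i)" for i by (simp add: f_def)
    have f: "f i \<in> carrier R" "(f (Suc i), f i) \<in> rel" for i
      using fA[of i] A(1) h[OF fA[of i]] by (blast, simp add: fS)
    obtain k where k: "\<forall>i\<ge>k. f i = f k" using chain[of f, OF f] by (rule exE)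
    have "f (Suc k) = f k" by (rule k[rule_format]) simp
    then show False using h[OF fA[of k]] unfolding fS by simp
  qed
  have "complemented_modulo R (regular_module R) (carrier R) (jacobson_radical R)"
    unfolding complemented_modulo_def
  proof (intro allI impI)
    fix L assume "submodule L R (regular_module R) \<and> L \<subseteq> carrier R"
    then have L: "submodule L R (regular_module R)" "L \<subseteq> carrier R" by auto
    \<comment> \<open>A complement is generated by a minimal element of the coset \<open>1 + L\<close>.\<close>
    let ?A = "{a \<in> carrier R. \<one> \<ominus> a \<in> L}"
    have "\<one> \<in> ?A" using reg.submodule_zero[OF L(1)] by (simp add: minus_eq r_neg)
    then obtain a where a: "a \<in> carrier R" "\<one> \<ominus> a \<in> L" and min: "\<forall>b\<in>?A. (b, a) \<in> rel \<longrightarrow> b = a"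
      using minimal[of ?A] by blast
    let ?K = "(\<lambda>r. r \<otimes> a) ` carrier R"
    have K: "submodule ?K R (regular_module R)" by (rule principal_submodule[OF a(1)])
    have unit: "\<one> \<ominus> b \<otimes> a \<in> Units R" if b: "b \<in> carrier R" "b \<otimes> a \<in> L" for b
    proof (rule ccontr)
      assume "\<one> \<ominus> b \<otimes> a \<notin> Units R"
      then have less: "(a \<otimes> (\<one> \<ominus> b \<otimes> a), a) \<in> rel" "a \<otimes> (\<one> \<ominus> b \<otimes> a) \<noteq> a" using step a(1) b(1) by auto
      have "a \<otimes> (b \<otimes> a) \<in> L" using reg.submodule_smult[OF L(1) a(1) b(2)] by simp
      then have "(\<one> \<ominus> a) \<oplus> a \<otimes> (b \<otimes> a) \<in> L" using reg.submodule_add[OF L(1) a(2)] by simp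
      moreover have "(\<one> \<ominus> a) \<oplus> a \<otimes> (b \<otimes> a) = \<one> \<ominus> a \<otimes> (\<one> \<ominus> b \<otimes> a)"
        using a(1) b(1) by (simp add: minus_eq r_distr r_minus minus_add a_ac)
      ultimately have "a \<otimes> (\<one> \<ominus> b \<otimes> a) \<in> ?A" using a(1) b(1) by simp
      then show False using min less by blast
    qed
    have "L \<inter> ?K \<subseteq> jacobson_radical R"
    proof
      fix x assume "x \<in> L \<inter> ?K"
      then obtain b where b: "b \<in> carrier R" "x = b \<otimes> a" "x \<in> L" by blast
      show "x \<in> jacobson_radical R"
      proof (rule jacobson_radicalI)
        fix r assume r: "r \<in> carrier R"
        have "r \<otimes> x \<in> L" using reg.submodule_smult[OF L(1) r b(3)] by simp
        then show "\<one> \<ominus> r \<otimes> x \<in> Units R" using unit[of "r \<otimes> b"] r a(1) b by (simp add: m_assoc)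
      qed (use a(1) b in simp)
    qed
    moreover have "L <+>\<^bsub>regular_module R\<^esub> ?K = carrier R"
    proof (rule regular_eq_carrier[OF reg.submodule_sum[OF L(1) K]])
      have "\<one> \<otimes> a \<in> ?K" by blast
      then have "(\<one> \<ominus> a) \<oplus> a \<in> L <+>\<^bsub>regular_module R\<^esub> ?K"
        using reg.sum_memI[OF a(2), of a ?K] a(1) by simp
      then show "\<one> \<in> L <+>\<^bsub>regular_module R\<^esub> ?K" using a(1) by (simp add: minus_eq a_assoc l_neg)
    qed
    ultimately show "\<exists>K. submodule K R (regular_module R) \<and> K \<subseteq> carrier R \<and>
        L <+>\<^bsub>regular_module R\<^esub> K = carrier R \<and> L \<inter> K \<subseteq> jacobson_radical R"
      using K reg.submodule_subset[OF K] by (intro exI[of _ ?K]) simp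
  qed
  then show ?thesis by (simp add: semilocal_ring_def reg.semilocal_iff_complemented_modulo_Rad)
qed

end

context ring
begin

lemma sum_principal_radical_iff:
  "y \<in> (\<lambda>r. r \<otimes> x) ` carrier R <+>\<^bsub>regular_module R\<^esub> jacobson_radical R \<longleftrightarrow>
    (\<exists>r\<in>carrier R. \<exists>j\<in>jacobson_radical R. y = r \<otimes> x \<oplus> j)"
  by (simp add: left_module.sum_iff[OF regular_left_module])

text \<open>
  Additivity of the rank rests on this computation, which is the equation \<open>R a \<inter> R (1 - b a) = R
  a (1 - b a)\<close> in the ring \<open>R/J\<close>.
\<close>

lemma principal_Int_modulo_radical:
  fixes a b
  defines "A \<equiv> \<lambda>x. (\<lambda>r. r \<otimes> x) ` carrier R <+>\<^bsub>regular_module R\<^esub> jacobson_radical R"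
  assumes ab: "a \<in> carrier R" "b \<in> carrier R"
  shows "A a \<inter> A (\<one> \<ominus> b \<otimes> a) = A (a \<otimes> (\<one> \<ominus> b \<otimes> a))"
proof -
  interpret reg: left_module R "regular_module R" by (rule regular_left_module)
  let ?c = "\<one> \<ominus> b \<otimes> a"
  have c: "?c \<in> carrier R" "a \<otimes> ?c \<in> carrier R" using ab by auto
  note A = sum_principal_radical_iff
  note J = jacobson_radical_submodule
  show ?thesis
  proof
    show "A (a \<otimes> ?c) \<subseteq> A a \<inter> A ?c"
    proof
      fix y assume "y \<in> A (a \<otimes> ?c)"
      then obtain r j where r: "r \<in> carrier R" "j \<in> jacobson_radical R" "y = r \<otimes> (a \<otimes> ?c) \<oplus> j"
        unfolding A_def A by blast
      have "r \<otimes> (a \<otimes> ?c) = (r \<otimes> a) \<otimes> ?c" using r(1) ab c by (simp add: m_assoc)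
      moreover have "r \<otimes> (a \<otimes> ?c) = (r \<otimes> (\<one> \<ominus> a \<otimes> b)) \<otimes> a"
        using r(1) ab by (simp add: minus_eq r_distr l_distr r_minus l_minus m_assoc)
      ultimately have y: "y = (r \<otimes> a) \<otimes> ?c \<oplus> j" "y = (r \<otimes> (\<one> \<ominus> a \<otimes> b)) \<otimes> a \<oplus> j"
        using r(3) by simp_all
      have ra: "r \<otimes> a \<in> carrier R" "r \<otimes> (\<one> \<ominus> a \<otimes> b) \<in> carrier R" using r(1) ab by auto
      have "y \<in> A a" unfolding A_def A using ra(2) r(2) y(2) by blast
      moreover have "y \<in> A ?c" unfolding A_def A using ra(1) r(2) y(1) by blast
      ultimately show "y \<in> A a \<inter> A ?c" by blast
    qed
    show "A a \<inter> A ?c \<subseteq> A (a \<otimes> ?c)"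
    proof
      fix y assume "y \<in> A a \<inter> A ?c"
      then have "y \<in> A a" "y \<in> A ?c" by auto
      then obtain r j s i where r: "r \<in> carrier R" "j \<in> jacobson_radical R" "y = r \<otimes> a \<oplus> j"
        "s \<in> carrier R" "i \<in> jacobson_radical R" "y = s \<otimes> ?c \<oplus> i"
        unfolding A_def A by (elim bexE)
      have ij: "i \<in> carrier R" "j \<in> carrier R" using r jacobson_radical_carrier by auto
      \<comment> \<open>Solving \<open>r a + j = s (1 - b a) + i\<close> for \<open>s\<close> exhibits \<open>s\<close> as a multiple of \<open>a\<close> modulo the radical.\<close>
      have "s = (s \<otimes> ?c \<oplus> i) \<oplus> (\<ominus> i \<oplus> s \<otimes> (b \<otimes> a))"
        using r(4) ij ab by (simp add: minus_eq r_distr r_minus a_assoc r_neg2 l_neg)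
      also have "\<dots> = (r \<otimes> a \<oplus> j) \<oplus> (\<ominus> i \<oplus> s \<otimes> (b \<otimes> a))" using r(3,6) by simp
      also have "\<dots> = (s \<otimes> b \<oplus> r) \<otimes> a \<oplus> (j \<ominus> i)"
        using r(1,4) ij ab by (simp add: minus_eq l_distr m_assoc a_ac)
      finally have s: "s = (s \<otimes> b \<oplus> r) \<otimes> a \<oplus> (j \<ominus> i)" .
      have "s \<otimes> ?c = ((s \<otimes> b \<oplus> r) \<otimes> a \<oplus> (j \<ominus> i)) \<otimes> ?c" by (rule arg_cong[OF s, of "\<lambda>x. x \<otimes> ?c"])
      also have "\<dots> = (s \<otimes> b \<oplus> r) \<otimes> (a \<otimes> ?c) \<oplus> (j \<ominus> i) \<otimes> ?c"
        using r(1,4) ij ab c by (simp add: l_distr[of _ _ ?c] m_assoc[of _ a ?c])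
      finally have "y = (s \<otimes> b \<oplus> r) \<otimes> (a \<otimes> ?c) \<oplus> ((j \<ominus> i) \<otimes> ?c \<oplus> i)"
        using r(1,4,6) ij ab c by (simp add: a_assoc)
      moreover have "j \<ominus> i \<in> jacobson_radical R" using reg.submodule_minus[OF J r(2,5)] by simp
      then have "(j \<ominus> i) \<otimes> ?c \<oplus> i \<in> jacobson_radical R"
        using reg.submodule_add[OF J jacobson_radical_right_mult[OF _ c(1)] r(5)] by simp
      moreover have "s \<otimes> b \<oplus> r \<in> carrier R" using r(1,4) ab by simp
      ultimately show "y \<in> A (a \<otimes> ?c)" unfolding A_def A by blast
    qed
  qed
qed

text \<open>
  Semilocal rings are Dedekind-finite. As \<open>r \<mapsto> r a\<close> is onto, it pulls a coindependent family of
  maximal left ideals with meet \<open>J\<close> back to such a family of the same length. The new family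
  cannot be extended, by exchange, so its meet lies in \<open>J\<close>: from \<open>r a \<in> J\<close> it follows that \<open>r \<in>
  J\<close>. Since \<open>(1 - a u) a = 0\<close>, this gives \<open>1 - a u \<in> J\<close>, and \<open>a u\<close> is a unit.
\<close>

lemma unit_if_left_invertible_over_semilocal:
  assumes sl: "semilocal_ring R" and a: "a \<in> carrier R" and u: "u \<in> carrier R" "u \<otimes> a = \<one>"
  shows "a \<in> Units R"
proof -
  interpret reg: left_module R "regular_module R" by (rule regular_left_module)
  have sl': "semilocal_module R (regular_module R)" using sl by (simp add: semilocal_ring_def)
  obtain Us where Us: "reg.coindependent Us" "\<And>U. U \<in> set Us \<Longrightarrow> maximal_submodule R (regular_module R) U"
    "reg.meet Us = jacobson_radical R"
    using reg.maximal_family_with_meet[OF regular_finitely_generated sl' reg.submodule_Rad subset_refl] by blast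
  interpret e: left_module_epi R "regular_module R" "regular_module R" "\<lambda>r. r \<otimes> a"
  proof (rule left_module_epi.intro)
    show "left_module_morphism R (regular_module R) (regular_module R) (\<lambda>r. r \<otimes> a)"
      using reg.cyclic_morphism[of a] a by simp
    have "x \<in> (\<lambda>r. r \<otimes> a) ` carrier R" if "x \<in> carrier R" for x
    proof -
      have "x = (x \<otimes> u) \<otimes> a" using that u a by (simp add: m_assoc)
      then show ?thesis using that u(1) by blast
    qed
    then show "left_module_epi_axioms (regular_module R) (regular_module R) (\<lambda>r. r \<otimes> a)"
      using a by unfold_locales auto
  qed
  let ?Vs = "map e.preimage Us"
  have Vs: "reg.coindependent ?Vs" "reg.meet ?Vs = e.preimage (jacobson_radical R)"
    using e.coindependent_preimage[OF Us(1)] Us(3) by auto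
  have pre: "e.preimage (jacobson_radical R) \<subseteq> jacobson_radical R"
  proof (rule ccontr)
    assume "\<not> ?thesis"
    then obtain x where x: "x \<in> e.preimage (jacobson_radical R)" "x \<notin> jacobson_radical R" by blast
    then obtain N where N: "maximal_submodule R (regular_module R) N" "x \<notin> N"
      by (auto simp: Rad_def e.preimage_def)
    have "\<not> reg.meet ?Vs \<subseteq> N" using Vs(2) x(1) N(2) by auto
    then have "reg.coindependent (N # ?Vs)"
      using N Vs(1) reg.maximal_sum_full[OF N(1) reg.coindependent_meet[OF Vs(1)]]
      by (simp add: maximal_submodule_def)
    moreover have "reg.meet Us \<subseteq> reg.meet (N # ?Vs)"
      using N(1) Us(3) Vs(2) jacobson_radical_right_mult[OF _ a] jacobson_radical_carrier
      by (auto simp: e.preimage_def Rad_def)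
    ultimately have "length (N # ?Vs) \<le> length Us" using reg.exchange_maximal[OF Us(1,2)] by blast
    then show False by simp
  qed
  have au: "a \<otimes> u \<in> carrier R" using a u by simp
  have "(\<one> \<ominus> a \<otimes> u) \<otimes> a = \<zero>" using a u by (simp add: minus_eq l_distr l_minus m_assoc r_neg)
  then have "\<one> \<ominus> a \<otimes> u \<in> e.preimage (jacobson_radical R)"
    using au reg.submodule_zero[OF jacobson_radical_submodule] by (simp add: e.preimage_def)
  then have "\<one> \<ominus> (\<one> \<ominus> a \<otimes> u) \<in> Units R" using pre one_minus_jacobson_radical_unit by blast
  moreover have "\<one> \<ominus> (\<one> \<ominus> a \<otimes> u) = a \<otimes> u" using au by (simp add: minus_eq minus_add r_neg2)
  ultimately have au_unit: "a \<otimes> u \<in> Units R" by simp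
  define s where "s = u \<otimes> inv (a \<otimes> u)"
  have sc: "s \<in> carrier R" using u(1) au_unit by (simp add: s_def)
  have as: "a \<otimes> s = \<one>" using a u(1) au_unit by (simp add: s_def Units_r_inv flip: m_assoc)
  have "u = u \<otimes> (a \<otimes> s)" using as u(1) by simp
  also have "\<dots> = (u \<otimes> a) \<otimes> s" using u(1) a sc by (simp add: m_assoc)
  finally have "u = s" using u(2) sc by simp
  then show ?thesis using a u as by (auto simp: Units_def)
qed

text \<open>
  The rank of \<open>a\<close> is the length of \<open>R/(R a + J)\<close>, realised as the length of a coindependent
  family of maximal left ideals with meet \<open>A a = R a + J\<close>, and bounded by the length of \<open>R/J\<close>.
  For comaximal left ideals the families can be concatenated, which makes the rank additive.
\<close>

theorem rank_function_if_semilocal: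
  assumes sl: "semilocal_ring R"
  shows "\<exists>n d. semilocal_rank_function R n d"
proof -
  let ?reg = "regular_module R" and ?J = "jacobson_radical R"
  interpret reg: left_module R ?reg by (rule regular_left_module)
  have sl': "semilocal_module R ?reg" using sl by (simp add: semilocal_ring_def)
  note J = jacobson_radical_submodule
  have ex: "\<exists>Us. submodule A R ?reg \<longrightarrow> ?J \<subseteq> A \<longrightarrow>
      reg.coindependent Us \<and> (\<forall>U\<in>set Us. maximal_submodule R ?reg U) \<and> reg.meet Us = A" for A
    using reg.maximal_family_with_meet[OF regular_finitely_generated sl', of A] by blast
  define fam where "fam = (\<lambda>A. SOME Us. submodule A R ?reg \<longrightarrow> ?J \<subseteq> A \<longrightarrow>
      reg.coindependent Us \<and> (\<forall>U\<in>set Us. maximal_submodule R ?reg U) \<and> reg.meet Us = A)"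
  have fam: "submodule A R ?reg \<longrightarrow> ?J \<subseteq> A \<longrightarrow>
      reg.coindependent (fam A) \<and> (\<forall>U\<in>set (fam A). maximal_submodule R ?reg U) \<and> reg.meet (fam A) = A" for A
    unfolding fam_def by (rule someI_ex[OF ex])
  define A where "A = (\<lambda>x. (\<lambda>r. r \<otimes> x) ` carrier R <+>\<^bsub>?reg\<^esub> ?J)"
  define d where "d = (\<lambda>x. length (fam (A x)))"
  have A: "submodule (A x) R ?reg" "?J \<subseteq> A x" "x \<in> A x" if x: "x \<in> carrier R" for x
  proof -
    have P: "submodule ((\<lambda>r. r \<otimes> x) ` carrier R) R ?reg" by (rule principal_submodule[OF x])
    show "submodule (A x) R ?reg" "?J \<subseteq> A x"
      unfolding A_def using reg.submodule_sum[OF P J] reg.sum_upper2[OF P J] by auto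
    have "\<one> \<otimes> x \<in> (\<lambda>r. r \<otimes> x) ` carrier R" by blast
    then show "x \<in> A x" unfolding A_def using reg.sum_upper1[OF P J] x by auto
  qed
  have F: "reg.coindependent (fam (A x))" "\<And>U. U \<in> set (fam (A x)) \<Longrightarrow> maximal_submodule R ?reg U"
    "reg.meet (fam (A x)) = A x" if "x \<in> carrier R" for x
    using fam[of "A x"] A[OF that] by blast+
  have FJ: "reg.coindependent (fam ?J)" "\<And>U. U \<in> set (fam ?J) \<Longrightarrow> maximal_submodule R ?reg U"
    "reg.meet (fam ?J) = ?J"
    using fam[of ?J] J by blast+
  have "semilocal_rank_function R (length (fam ?J)) d"
    unfolding semilocal_rank_function_def
  proof (intro conjI ballI impI)
    show "d \<in> carrier R \<rightarrow> {0..length (fam ?J)}"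
      using reg.exchange_maximal[OF FJ(1,2) F(1)] F(3) FJ(3) A(2) by (auto simp: d_def)
    fix a assume a: "a \<in> carrier R"
    show "a \<in> Units R" if zero: "d a = 0"
    proof -
      have "A a = carrier R" using F(3)[OF a] zero by (simp add: d_def)
      then have "\<one> \<in> A a" by simp
      then obtain r j where r: "r \<in> carrier R" "j \<in> ?J" "\<one> = r \<otimes> a \<oplus> j"
        unfolding A_def sum_principal_radical_iff by blast
      have "\<one> \<ominus> r \<otimes> a = j"
        using r a jacobson_radical_carrier[OF r(2)] a_comm[of "r \<otimes> a" j] by (simp add: minus_eq a_assoc r_neg)
      then obtain u where "u \<in> carrier R" "u \<otimes> a = \<one>"
        using left_inverse_if_comaximal_radical[OF a r(1)] r(2) by auto
      then show ?thesis by (rule unit_if_left_invertible_over_semilocal[OF sl a])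
    qed
    fix b assume b: "b \<in> carrier R"
    let ?c = "\<one> \<ominus> b \<otimes> a"
    have c: "?c \<in> carrier R" "a \<otimes> ?c \<in> carrier R" using a b by auto
    have sum: "submodule (A a <+>\<^bsub>?reg\<^esub> A ?c) R ?reg" by (rule reg.submodule_sum[OF A(1)[OF a] A(1)[OF c(1)]])
    have "b \<otimes> a \<in> A a" using reg.submodule_smult[OF A(1)[OF a] b A(3)[OF a]] by simp
    then have "b \<otimes> a \<oplus> ?c \<in> A a <+>\<^bsub>?reg\<^esub> A ?c" using reg.sum_memI[OF _ A(3)[OF c(1)]] by auto
    moreover have "b \<otimes> a \<oplus> ?c = \<one>" using a b by (simp add: minus_eq a_lcomm r_neg)
    ultimately have full: "A a <+>\<^bsub>?reg\<^esub> A ?c = carrier ?reg" using regular_eq_carrier[OF sum] by simp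
    let ?Us = "fam (A a) @ fam (A ?c)"
    have Us: "reg.coindependent ?Us" "\<And>U. U \<in> set ?Us \<Longrightarrow> maximal_submodule R ?reg U"
      using reg.coindependent_append[OF F(1)[OF a] F(1)[OF c(1)]] F(3)[OF a] F(3)[OF c(1)] full
        F(2)[OF a] F(2)[OF c(1)] by auto
    have meet: "reg.meet ?Us = reg.meet (fam (A (a \<otimes> ?c)))"
      using F(3)[OF a] F(3)[OF c(1)] F(3)[OF c(2)] principal_Int_modulo_radical[OF a b] by (simp add: A_def)
    have "length ?Us = length (fam (A (a \<otimes> ?c)))"
    proof (rule le_antisym)
      show "length (fam (A (a \<otimes> ?c))) \<le> length ?Us"
        using reg.exchange_maximal[OF Us F(1)[OF c(2)]] equalityD1[OF meet] by blast
      show "length ?Us \<le> length (fam (A (a \<otimes> ?c)))"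
        using reg.exchange_maximal[OF F(1)[OF c(2)] F(2)[OF c(2)] Us(1)] equalityD2[OF meet] by blast
    qed
    then show "d (a \<otimes> ?c) = d a + d ?c" by (simp add: d_def)
  qed
  then show ?thesis by blast
qed

lemma hdim_regular_le_rank:
  assumes d: "semilocal_rank_function R n d"
  shows "finite_hollow_dim R (regular_module R) \<and> hdim R (regular_module R) \<le> n"
proof -
  interpret reg: left_module R "regular_module R" by (rule regular_left_module)
  have "semilocal_module R (regular_module R)"
    using coindependent_length_le_rank[OF d] by (rule reg.semilocal_if_bounded_families)
  then have fin: "finite_hollow_dim R (regular_module R)"
    by (rule reg.finite_hollow_dim_if_semilocal[OF regular_finitely_generated])
  then obtain k where k: "has_hollow_dim R (regular_module R) k" by (auto simp: finite_hollow_dim_def)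
  then obtain Us where "reg.coindependent Us" "length Us = k"
    using reg.coindependent_if_has_hollow_dim by blast
  then show ?thesis using fin reg.hdim_eq[OF k] coindependent_length_le_rank[OF d] by auto
qed

lemma semilocal_ring_if_transported:
  assumes "inj f" "semilocal_module R (transport_module f (regular_module R))"
  shows "semilocal_ring R"
proof -
  interpret reg: left_module R "regular_module R" by (rule regular_left_module)
  interpret e: left_module_epi R "regular_module R" "transport_module f (regular_module R)" f
    by (rule reg.transport_epi[OF assms(1)])
  show ?thesis
    unfolding semilocal_ring_def
    using reg.submodule_zero[OF reg.submodule_Rad]
    by (intro e.semilocal_lift[OF assms(2)]) (simp add: reg.transport_kernel[OF assms(1)])
qed

end

section \<open>The characterisations\<close>

lemma over_semilocal_ring:
  assumes "ring R" "semilocal_ring R"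
  shows "all_modules_semilocal R TYPE('m)" "all_modules_decompose R TYPE('m)"
    "all_small_radical_weakly_supplemented R TYPE('m)" "all_fin_gen_finite_hollow_dim R TYPE('m)"
    "products_of_semisimple_semisimple R TYPE('i) TYPE('m)"
proof -
  note sl = assms(2)
  show "all_modules_semilocal R TYPE('m)"
    unfolding all_modules_semilocal_def
    using left_module.semilocal_over_semilocal_ring[OF _ sl] by blast
  then show "all_small_radical_weakly_supplemented R TYPE('m)" "all_fin_gen_finite_hollow_dim R TYPE('m)"
    unfolding all_modules_semilocal_def all_small_radical_weakly_supplemented_def
      all_fin_gen_finite_hollow_dim_def
    using left_module.weakly_supplemented_if_semilocal left_module.finite_hollow_dim_if_semilocal by blast+
  show "all_modules_decompose R TYPE('m)"
    unfolding all_modules_decompose_def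
    by (intro allI impI left_module.decomposition_over_semilocal_ring[OF _ sl])
  show "products_of_semisimple_semisimple R TYPE('i) TYPE('m)"
    unfolding products_of_semisimple_semisimple_def
    by (intro allI impI semisimple_product_over_semilocal_ring[OF assms]) simp
qed

theorem theorem3p5:
  fixes R :: "('a, 'r) ring_scheme"
  assumes "ring R"
    and "large_universe TYPE('a) TYPE('u)"
  shows "all_equivalent
      [semilocal_ring R,
       all_modules_semilocal R TYPE('u),
       all_modules_decompose R TYPE('u),
       all_small_radical_weakly_supplemented R TYPE('u),
       all_fin_gen_finite_hollow_dim R TYPE('u),
       products_of_semisimple_semisimple R TYPE('u) TYPE('u),
       \<exists>n d. semilocal_rank_function R n d,
       \<exists>rel. semilocal_ordering R rel]
    \<and> (semilocal_ring R \<longrightarrow>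
         all_modules_semilocal R TYPE('m) \<and>
         all_modules_decompose R TYPE('m) \<and>
         all_small_radical_weakly_supplemented R TYPE('m) \<and>
         all_fin_gen_finite_hollow_dim R TYPE('m) \<and>
         products_of_semisimple_semisimple R TYPE('i) TYPE('m))
    \<and> (\<forall>n d. semilocal_rank_function R n d \<longrightarrow>
         finite_hollow_dim R (regular_module R) \<and> hdim R (regular_module R) \<le> n)"
proof -
  interpret R: ring R by (rule assms(1))
  interpret reg: left_module R "regular_module R" by (rule R.regular_left_module)
  obtain f :: "'a set \<Rightarrow> 'u" where f: "inj f" using assms(2) by (auto simp: large_universe_def)
  define h where "h = (\<lambda>x. f {x})"
  have h: "inj h" using f by (auto simp: inj_def h_def)
  define T where "T = transport_module h (regular_module R)"
  interpret e: left_module_epi R "regular_module R" T h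
    unfolding T_def by (rule reg.transport_epi[OF h])
  have T: "left_module R T" by (rule e.P.left_module_axioms)
  have fg: "finitely_generated R T" by (rule e.finitely_generated_image[OF R.regular_finitely_generated])
  have semilocal_R: "semilocal_ring R" if "semilocal_module R T"
    using R.semilocal_ring_if_transported[OF h] that by (simp add: T_def)
  note over = over_semilocal_ring[OF assms(1)]
  have b: "all_modules_semilocal R TYPE('u) = semilocal_ring R"
    using T semilocal_R over(1) unfolding all_modules_semilocal_def by blast
  have c: "all_modules_decompose R TYPE('u) = semilocal_ring R"
  proof
    assume "all_modules_decompose R TYPE('u)"
    then obtain X Y where "submodule X R T" "submodule Y R T" "X <+>\<^bsub>T\<^esub> Y = carrier T"
      "semisimple_module R (T\<lparr>carrier := X\<rparr>)" "semilocal_module R (T\<lparr>carrier := Y\<rparr>)"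
      using T unfolding all_modules_decompose_def by blast
    then show "semilocal_ring R" by (intro semilocal_R e.P.semilocal_if_decomposition)
  qed (rule over(2))
  have d: "all_small_radical_weakly_supplemented R TYPE('u) = semilocal_ring R"
    using T semilocal_R e.P.semilocal_if_weakly_supplemented
      e.P.finitely_generated_small_radical[OF fg] over(3)
    unfolding all_small_radical_weakly_supplemented_def by blast
  have e: "all_fin_gen_finite_hollow_dim R TYPE('u) = semilocal_ring R"
    using T fg semilocal_R e.P.semilocal_if_finite_hollow_dim over(4)
    unfolding all_fin_gen_finite_hollow_dim_def by blast
  have f: "products_of_semisimple_semisimple R TYPE('u) TYPE('u) = semilocal_ring R"
    using semilocal_if_semisimple_products[OF assms(1) f] over(5) by blast
  have g: "(\<exists>n d. semilocal_rank_function R n d) = semilocal_ring R"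
    using R.rank_function_if_semilocal R.ordering_if_rank_function R.semilocal_if_ordering by blast
  have h: "(\<exists>rel. semilocal_ordering R rel) = semilocal_ring R"
    using R.rank_function_if_semilocal R.ordering_if_rank_function R.semilocal_if_ordering by blast
  show ?thesis
    unfolding all_equivalent_def b c d e f g h
    by (simp add: over R.hdim_regular_le_rank)
qed

end
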